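(* Let $p\in(1,\infty)$, $s>0$, $\gamma\in(-\infty,d]$, $\beta=2^{\gamma-d}$, and $sp>d\ge d+\min(\gamma,0)$. Let $f\in V'$, let $b_T$ be a $B_p^s$-random variable with wavelet density $\beta$, $a=\exp(b_{T,\mathcal D})$ and, for $N\in\mathbb N$, $a_N=\exp(b_{T,N}|_{\mathcal D})$ (see context). Let $u$ and $u_N$ be the pathwise weak solutions in $V$ of $$\int_{\mathcal D}a(\omega)\nabla u(\omega)\cdot\nabla v\,dx=\langle f,v\rangle,\qquad \int_{\mathcal D}a_N(\omega)\nabla u_N(\omega)\cdot\nabla v\,dx=\langle f,v\rangle\qquad\text{for all }v\in V.$$ Then, for any $q\ge1$ and $t\in\left(0,s-\frac dp-\frac{\min(\gamma,0)}{q}\right)$ there is a $C>0$ such that for every $N\in\mathbb N$ it holds $$\|u-u_N\|_{L^q(\Omega;V)}\le C2^{-Nt}.$$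
   Context: Domain and spaces. $d\in\{1,2,3\}$; $\mathcal D\subseteq\mathbb T^d=[0,1]^d$ is a convex polytopal domain (a finite interval if $d=1$). $H=L^2(\mathcal D)$, $V=H^1_0(\mathcal D)$ with $\|v\|_V=\|\nabla v\|_H$, $V'$ the dual of $V$, $\langle\cdot,\cdot\rangle$ the $V'$–$V$ pairing. $L^q(\Omega;\mathcal X)$ denotes the Lebesgue–Bochner space. Wavelets. Functions on the torus $\mathbb T^d$ are identified with one-periodic functions on $\mathbb R^d$. Let $\phi,\psi\in \mathrm C^{\alpha}(\mathbb R)$, $\alpha\ge1$, $\alpha\ge s$, be compactly supported scaling and wavelet functions of an orthonormal multiresolution analysis of $L^2(\mathbb R)$, with $\|\phi\|_{L^2}=\|\psi\|_{L^2}=1$ and $\int_{\mathbb R}\psi(x)x^m\,dx=0$ for $m\in\mathbb N_0$, $m<\alpha$. Put $\psi_{j,k,0}(x)=\phi(2^jx-k)$, $\psi_{j,k,1}(x)=\psi(2^jx-k)$. Let $\mathcal L_0=\{0,1\}^d$, $\mathcal L_j=\mathcal L_0\setminus\{(0,\dots,0)\}$ for $j\ge1$, $K_j=\{k\in\mathbb Z^d: 0\le k_1,\dots,k_d<2^j\}$, $\psi_{j,k,l}(x)=2^{dj/2}\prod_{i=1}^d\psi_{j,k_i,l(i)}(x_i)$ and $\psi_{j,k}^l(x)=\sum_{n\in\mathbb Z^d}\psi_{j,k,l}(x-n)$. With $\mathcal I_{\mathbf\Psi}=\{(j,k,l): j\in\mathbb N_0,k\in K_j,l\in\mathcal L_j\}$,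 $(\psi_{j,k}^l)_{(j,k,l)\in\mathcal I_{\mathbf\Psi}}$ is an orthonormal basis of $L^2(\mathbb T^d)$. Galton–Watson trees. Let $\mathcal U=\bigcup_{n\ge0}\mathbb N^n$, $\varrho=()$ the empty sequence, $|\mathfrak n|$ the length of $\mathfrak n$. A tree is a subset $\mathbf t\subset\mathcal U$ that contains $\varrho$, contains every proper prefix of each of its elements, and such that for each $\mathfrak n\in\mathbf t$ there is $\mathfrak K_{\mathfrak n}(\mathbf t)\in\mathbb N_0\cup\{\infty\}$ with: for $i\in\mathbb N$, $\mathfrak n i\in\mathbf t$ iff $1\le i\le\mathfrak K_{\mathfrak n}(\mathbf t)$. $\mathfrak T$ is the set of all trees with all $\mathfrak K_{\mathfrak n}(\mathbf t)<\infty$, with metric $\delta_{\mathfrak T}(\mathbf t,\mathbf t')=2^{-\sup\{n\in\mathbb N_0:\ \mathfrak r_n(\mathbf t)=\mathfrak r_n(\mathbf t')\}}$, $\mathfrak r_n(\mathbf t)=\{\mathfrak n\in\mathbf t:|\mathfrak n|\le n\}$, and its Borel $\sigma$-algebra. A Galton–Watson (GW) tree with offspring distribution $\mathcal P$ is a $\mathfrak T$-valued random variable $T$ with $\mathfrak K_\varrho(T)\sim\mathcal P$ and such that, conditionally on $\mathfrak K_\varrho(T)=n$, the sub-trees $\{\mathfrak m\in\mathcal U: i\mathfrak m\in T\}$, $i=1,\dots,n$, are independent and distributed as $T$. Besov random tree prior. Let $(\Omega,\mathcal A,P)$ be a complete probability space, $\kappa>0$, $X=(X_{j,k}^l)_{(j,k,l)\in\mathcal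 I_{\mathbf\Psi}}$ i.i.d. real random variables with density $c_p^{-1}\exp(-|x|^p/\kappa)$, $c_p=\int_{\mathbb R}\exp(-|x|^p/\kappa)dx$, and $T$ a GW tree with offspring distribution $\mathrm{Bin}(2^d,\beta)$, independent of $X$. For $\mathfrak n\in\{1,\dots,2^d\}^j$ put $\mathfrak I^1_{d,j}(\mathfrak n)=1+\sum_{i=1}^j2^{d(j-i)}(\mathfrak n_i-1)$, $\mathfrak I^2_{d,j}(n)=\big(\lfloor (n-1)/2^{j(i-1)}\rfloor \bmod 2^j\big)_{i=1,\dots,d}\in K_j$, and $\mathfrak I_{d,j}=\mathfrak I^2_{d,j}\circ\mathfrak I^1_{d,j}$, a bijection $\{1,\dots,2^d\}^j\to K_j$. Set $\mathcal I_T=\{(j,k,l): (j,k)=(|\mathfrak n|,\mathfrak I_{d,|\mathfrak n|}(\mathfrak n))\text{ for some }\mathfrak n\in T,\ l\in\mathcal L_j\}$. The $B^s_p$-random variable with wavelet density $\beta$ is $b_T(\omega)=\sum_{(j,k,l)\in\mathcal I_T(\omega)}\eta_jX_{j,k}^l(\omega)\psi_{j,k}^l$ with $\eta_j=2^{-j(s+\frac d2-\frac dp)}$; its truncation $b_{T,N}$ is the same sum restricted to indices with $j\le N$. $b_{T,\mathcal D}(\omega)$ is the restriction to $\mathcal D$ of (the one-periodic extension of) $b_T(\omega)$. *)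

theory Defs
  imports "HOL-Probability.Probability"
begin

section \<open>Square-integrable functions\<close>

text \<open>
  Elements of L2 spaces are handled through representatives: total functions of which only the
  almost-everywhere class on the space of the measure matters.
\<close>

definition L2 :: "'a measure \<Rightarrow> ('a \<Rightarrow> 'b::real_normed_vector) set" where
  "L2 M = {f \<in> borel_measurable M. integrable M (\<lambda>x. (norm (f x))\<^sup>2)}"

definition L2_norm :: "'a measure \<Rightarrow> ('a \<Rightarrow> 'b::real_normed_vector) \<Rightarrow> real" where
  "L2_norm M f = sqrt (\<integral>x. (norm (f x))\<^sup>2 \<partial>M)"

definition L2_closure :: "'a measure \<Rightarrow> ('a \<Rightarrow> real) set \<Rightarrow> ('a \<Rightarrow> real) set" where
  "L2_closure M S =
    {f \<in> L2 M. \<exists>g. (\<forall>n::nat. g n \<in> S) \<and> (\<lambda>n. L2_norm M (\<lambda>x. f x - g n x)) \<longlonglongrightarrow> 0}"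

definition L2_closed_subspace :: "'a measure \<Rightarrow> ('a \<Rightarrow> real) set \<Rightarrow> bool" where
  "L2_closed_subspace M W \<longleftrightarrow>
    W \<subseteq> L2 M \<and> (\<lambda>_. 0) \<in> W \<and>
    (\<forall>f\<in>W. \<forall>g\<in>W. (\<lambda>x. f x + g x) \<in> W) \<and>
    (\<forall>c. \<forall>f\<in>W. (\<lambda>x. c * f x) \<in> W) \<and>
    L2_closure M W = W"

definition L2_orthonormal_basis ::
    "'a measure \<Rightarrow> ('i \<Rightarrow> 'a \<Rightarrow> real) \<Rightarrow> ('a \<Rightarrow> real) set \<Rightarrow> bool" where
  "L2_orthonormal_basis M e W \<longleftrightarrow>
    (\<forall>k. e k \<in> W) \<and>
    (\<forall>k l. (\<integral>x. e k x * e l x \<partial>M) = (if k = l then 1 else 0)) \<and>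
    W \<subseteq> L2_closure M {(\<lambda>x. \<Sum>k\<in>F. c k * e k x) | F c. finite F}"

text \<open>Unconditional convergence of a series of functions in L2, with (a representative of) its sum.\<close>

definition L2_has_sum ::
    "'a measure \<Rightarrow> ('i \<Rightarrow> 'a \<Rightarrow> real) \<Rightarrow> 'i set \<Rightarrow> ('a \<Rightarrow> real) \<Rightarrow> bool" where
  "L2_has_sum M e I b \<longleftrightarrow>
    b \<in> L2 M \<and>
    ((\<lambda>F. L2_norm M (\<lambda>x. b x - (\<Sum>i\<in>F. e i x))) \<longlongrightarrow> 0) (finite_subsets_at_top I)"

definition L2_infsum ::
    "'a measure \<Rightarrow> ('i \<Rightarrow> 'a \<Rightarrow> real) \<Rightarrow> 'i set \<Rightarrow> 'a \<Rightarrow> real" where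
  "L2_infsum M e I = (SOME b. L2_has_sum M e I b)"


section \<open>Differentiability classes\<close>

fun C_k :: "nat \<Rightarrow> ('a::euclidean_space \<Rightarrow> real) \<Rightarrow> bool" where
  "C_k 0 f \<longleftrightarrow> continuous_on UNIV f"
| "C_k (Suc k) f \<longleftrightarrow>
    (\<forall>x. f differentiable (at x)) \<and>
    (\<forall>e\<in>Basis. C_k k (\<lambda>x. frechet_derivative f (at x) e))"

definition compactly_supported :: "('a::topological_space \<Rightarrow> real) \<Rightarrow> bool" where
  "compactly_supported f \<longleftrightarrow> compact (closure {x. f x \<noteq> 0})"

text \<open>
  The class of real order \<open>\<alpha>\<close>: \<open>\<alpha>\<close> times continuously differentiable for integer \<open>\<alpha>\<close>, and for
  non-integer \<open>\<alpha>\<close> the derivative of order \<open>\<lfloor>\<alpha>\<rfloor>\<close> is in addition Hoelder continuous with exponent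
  \<open>\<alpha> - \<lfloor>\<alpha>\<rfloor>\<close>.
\<close>

definition C_alpha :: "real \<Rightarrow> (real \<Rightarrow> real) \<Rightarrow> bool" where
  "C_alpha \<alpha> f \<longleftrightarrow>
    C_k (nat \<lfloor>\<alpha>\<rfloor>) f \<and>
    (\<alpha> \<notin> \<int> \<longrightarrow>
      (\<exists>C. \<forall>x y. \<bar>(deriv ^^ nat \<lfloor>\<alpha>\<rfloor>) f x - (deriv ^^ nat \<lfloor>\<alpha>\<rfloor>) f y\<bar>
                 \<le> C * \<bar>x - y\<bar> powr (\<alpha> - of_int \<lfloor>\<alpha>\<rfloor>)))"


section \<open>Sobolev spaces and the elliptic problem\<close>

definition convex_polytopal_domain :: "(real^'d) set \<Rightarrow> bool" where
  "convex_polytopal_domain D \<longleftrightarrow> (\<exists>P. polytope P \<and> D = interior P) \<and> D \<noteq> {}"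

definition test_function :: "(real^'d) set \<Rightarrow> (real^'d \<Rightarrow> real) \<Rightarrow> bool" where
  "test_function D \<theta> \<longleftrightarrow>
    (\<forall>k. C_k k \<theta>) \<and> compactly_supported \<theta> \<and> closure {x. \<theta> x \<noteq> 0} \<subseteq> D"

definition has_weak_gradient ::
    "(real^'d) set \<Rightarrow> (real^'d \<Rightarrow> real) \<Rightarrow> (real^'d \<Rightarrow> real^'d) \<Rightarrow> bool" where
  "has_weak_gradient D v g \<longleftrightarrow>
    (\<forall>\<theta>. test_function D \<theta> \<longrightarrow>
      (\<forall>i. (\<integral>x. v x * frechet_derivative \<theta> (at x) (axis i 1) \<partial>lebesgue_on D)
           = - (\<integral>x. g x $ i * \<theta> x \<partial>lebesgue_on D)))"

definition H1 :: "(real^'d) set \<Rightarrow> (real^'d \<Rightarrow> real) set" where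
  "H1 D = {v \<in> L2 (lebesgue_on D). \<exists>g \<in> L2 (lebesgue_on D). has_weak_gradient D v g}"

definition weak_gradient :: "(real^'d) set \<Rightarrow> (real^'d \<Rightarrow> real) \<Rightarrow> real^'d \<Rightarrow> real^'d" where
  "weak_gradient D v = (SOME g. g \<in> L2 (lebesgue_on D) \<and> has_weak_gradient D v g)"

definition H1_norm :: "(real^'d) set \<Rightarrow> (real^'d \<Rightarrow> real) \<Rightarrow> real" where
  "H1_norm D v =
    sqrt ((L2_norm (lebesgue_on D) v)\<^sup>2 + (L2_norm (lebesgue_on D) (weak_gradient D v))\<^sup>2)"

definition H10 :: "(real^'d) set \<Rightarrow> (real^'d \<Rightarrow> real) set" where
  "H10 D = {v \<in> H1 D. \<exists>\<theta>. (\<forall>n::nat. test_function D (\<theta> n)) \<and>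
                          (\<lambda>n. H1_norm D (\<lambda>x. v x - \<theta> n x)) \<longlonglongrightarrow> 0}"

definition V_norm :: "(real^'d) set \<Rightarrow> (real^'d \<Rightarrow> real) \<Rightarrow> real" where
  "V_norm D v = L2_norm (lebesgue_on D) (weak_gradient D v)"

text \<open>
  Bounded linear functionals on \<open>H10 D\<close>. Linearity and boundedness force equal values on functions
  that agree almost everywhere on \<open>D\<close>, so these are functionals on the space of classes.
\<close>

definition V_dual :: "(real^'d) set \<Rightarrow> ((real^'d \<Rightarrow> real) \<Rightarrow> real) set" where
  "V_dual D =
    {f. (\<forall>v\<in>H10 D. \<forall>w\<in>H10 D. f (\<lambda>x. v x + w x) = f v + f w) \<and>
        (\<forall>c. \<forall>v\<in>H10 D. f (\<lambda>x. c * v x) = c * f v) \<and>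
        (\<exists>C. \<forall>v\<in>H10 D. \<bar>f v\<bar> \<le> C * V_norm D v)}"

definition weak_solution ::
    "(real^'d) set \<Rightarrow> (real^'d \<Rightarrow> real) \<Rightarrow> ((real^'d \<Rightarrow> real) \<Rightarrow> real) \<Rightarrow> (real^'d \<Rightarrow> real) \<Rightarrow> bool" where
  "weak_solution D a f u \<longleftrightarrow>
    u \<in> H10 D \<and>
    (\<forall>v\<in>H10 D. has_bochner_integral (lebesgue_on D)
       (\<lambda>x. a x * (weak_gradient D u x \<bullet> weak_gradient D v x)) (f v))"

text \<open>
  The Lebesgue--Bochner space of \<open>V\<close>-valued maps: strongly measurable maps (almost sure limits, in
  the norm of \<open>V\<close>, of simple functions) whose norm has an integrable \<open>q\<close>-th power.
\<close>

definition strongly_measurable_V ::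
    "'w measure \<Rightarrow> (real^'d) set \<Rightarrow> ('w \<Rightarrow> real^'d \<Rightarrow> real) \<Rightarrow> bool" where
  "strongly_measurable_V M D v \<longleftrightarrow>
    (\<exists>S. (\<forall>n::nat. simple_function M (S n) \<and> S n ` space M \<subseteq> H10 D) \<and>
         (AE \<omega> in M. v \<omega> \<in> H10 D \<and> (\<lambda>n. V_norm D (\<lambda>x. v \<omega> x - S n \<omega> x)) \<longlonglongrightarrow> 0))"

definition Lq_V :: "'w measure \<Rightarrow> real \<Rightarrow> (real^'d) set \<Rightarrow> ('w \<Rightarrow> real^'d \<Rightarrow> real) set" where
  "Lq_V M q D =
    {v. strongly_measurable_V M D v \<and> integrable M (\<lambda>\<omega>. V_norm D (v \<omega>) powr q)}"

definition Lq_V_norm :: "'w measure \<Rightarrow> real \<Rightarrow> (real^'d) set \<Rightarrow> ('w \<Rightarrow> real^'d \<Rightarrow> real) \<Rightarrow> real" where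
  "Lq_V_norm M q D v = (\<integral>\<omega>. V_norm D (v \<omega>) powr q \<partial>M) powr (1 / q)"


section \<open>Wavelets\<close>

definition orthonormal_MRA :: "(int \<Rightarrow> (real \<Rightarrow> real) set) \<Rightarrow> (real \<Rightarrow> real) \<Rightarrow> bool" where
  "orthonormal_MRA W \<phi> \<longleftrightarrow>
    (\<forall>j. L2_closed_subspace lebesgue (W j)) \<and>
    (\<forall>j. W j \<subseteq> W (j + 1)) \<and>
    (\<forall>f\<in>(\<Inter>j. W j). AE x in lebesgue. f x = 0) \<and>
    L2_closure lebesgue (\<Union>j. W j) = L2 lebesgue \<and>
    (\<forall>j f. f \<in> W j \<longleftrightarrow> (\<lambda>x. f (2 * x)) \<in> W (j + 1)) \<and>
    L2_orthonormal_basis lebesgue (\<lambda>(k::int) x. \<phi> (x - of_int k)) (W 0)"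

text \<open>
  The translates of the wavelet form an orthonormal basis of the orthogonal complement of \<open>W 0\<close>
  in \<open>W 1\<close>.
\<close>

definition MRA_wavelet :: "(int \<Rightarrow> (real \<Rightarrow> real) set) \<Rightarrow> (real \<Rightarrow> real) \<Rightarrow> bool" where
  "MRA_wavelet W \<psi> \<longleftrightarrow>
    L2_orthonormal_basis lebesgue (\<lambda>(k::int) x. \<psi> (x - of_int k))
      {f \<in> W 1. \<forall>g\<in>W 0. (\<integral>x. f x * g x \<partial>lebesgue) = 0}"

definition wavelet_system :: "real \<Rightarrow> (real \<Rightarrow> real) \<Rightarrow> (real \<Rightarrow> real) \<Rightarrow> bool" where
  "wavelet_system \<alpha> \<phi> \<psi> \<longleftrightarrow>
    C_alpha \<alpha> \<phi> \<and> C_alpha \<alpha> \<psi> \<and> compactly_supported \<phi> \<and> compactly_supported \<psi> \<and>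
    (\<exists>W. orthonormal_MRA W \<phi> \<and> MRA_wavelet W \<psi>) \<and>
    L2_norm lebesgue \<phi> = 1 \<and> L2_norm lebesgue \<psi> = 1 \<and>
    (\<forall>m::nat. real m < \<alpha> \<longrightarrow> (\<integral>x. \<psi> x * x ^ m \<partial>lebesgue) = 0)"

type_synonym 'd windex = "nat \<times> (int^'d) \<times> (nat^'d)"

definition K_set :: "nat \<Rightarrow> (int^'d) set" where
  "K_set j = {k. \<forall>i. 0 \<le> k $ i \<and> k $ i < 2 ^ j}"

definition L_set :: "nat \<Rightarrow> (nat^'d) set" where
  "L_set j = (if j = 0 then {l. \<forall>i. l $ i \<in> {0, 1}}
              else {l. \<forall>i. l $ i \<in> {0, 1}} - {0})"

definition I_Psi :: "'d::finite windex set" where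
  "I_Psi = {(j, k, l). k \<in> K_set j \<and> l \<in> L_set j}"

definition psi1 :: "(real \<Rightarrow> real) \<Rightarrow> (real \<Rightarrow> real) \<Rightarrow> nat \<Rightarrow> int \<Rightarrow> nat \<Rightarrow> real \<Rightarrow> real" where
  "psi1 \<phi> \<psi> j k l x = (if l = 0 then \<phi> (2 ^ j * x - of_int k) else \<psi> (2 ^ j * x - of_int k))"

definition psi_tensor ::
    "(real \<Rightarrow> real) \<Rightarrow> (real \<Rightarrow> real) \<Rightarrow> 'd windex \<Rightarrow> real^'d \<Rightarrow> real" where
  "psi_tensor \<phi> \<psi> = (\<lambda>(j, k, l) x.
    2 powr (real CARD('d) * real j / 2) * (\<Prod>i\<in>UNIV. psi1 \<phi> \<psi> j (k $ i) (l $ i) (x $ i)))"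

text \<open>For compactly supported \<open>\<phi>\<close> and \<open>\<psi>\<close> only finitely many terms are nonzero at each point.\<close>

definition psi_per ::
    "(real \<Rightarrow> real) \<Rightarrow> (real \<Rightarrow> real) \<Rightarrow> 'd windex \<Rightarrow> real^'d \<Rightarrow> real" where
  "psi_per \<phi> \<psi> i x = (\<Sum>\<^sub>\<infinity>n\<in>(UNIV :: (int^'d) set). psi_tensor \<phi> \<psi> i (x - (\<chi> c. of_int (n $ c))))"


section \<open>Galton--Watson trees\<close>

definition words :: "nat list set" where
  "words = {n. \<forall>i\<in>set n. 1 \<le> i}"

definition is_tree :: "nat list set \<Rightarrow> bool" where
  "is_tree t \<longleftrightarrow>
    t \<subseteq> words \<and> [] \<in> t \<and>
    (\<forall>n m. n @ m \<in> t \<longrightarrow> n \<in> t) \<and>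
    (\<forall>n\<in>t. \<exists>K::enat. \<forall>i\<ge>1. n @ [i] \<in> t \<longleftrightarrow> enat i \<le> K)"

definition offspring :: "nat list \<Rightarrow> nat list set \<Rightarrow> enat" where
  "offspring n t = (THE K. \<forall>i\<ge>1. n @ [i] \<in> t \<longleftrightarrow> enat i \<le> K)"

definition trees :: "nat list set set" where
  "trees = {t. is_tree t \<and> (\<forall>n\<in>t. offspring n t < \<infinity>)}"

definition tree_trunc :: "nat \<Rightarrow> nat list set \<Rightarrow> nat list set" where
  "tree_trunc n t = {m \<in> t. length m \<le> n}"

text \<open>The first case is the convention \<open>2\<^sup>-\<^sup>\<infinity> = 0\<close>.\<close>

definition tree_dist :: "nat list set \<Rightarrow> nat list set \<Rightarrow> real" where
  "tree_dist t t' =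
    (if \<forall>n. tree_trunc n t = tree_trunc n t' then 0
     else (1 / 2) ^ Sup {n. tree_trunc n t = tree_trunc n t'})"

lemma tree_trunc_eq_mono:
  assumes "tree_trunc n t = tree_trunc n t'" "m \<le> n"
  shows "tree_trunc m t = tree_trunc m t'"
proof -
  have "tree_trunc m r = {w \<in> tree_trunc n r. length w \<le> m}" for r
    using assms(2) by (auto simp: tree_trunc_def)
  then show ?thesis using assms(1) by simp
qed

lemma tree_dist_le_iff:
  assumes "t \<in> trees" "t' \<in> trees"
  shows "tree_dist t t' \<le> (1 / 2) ^ n \<longleftrightarrow> tree_trunc n t = tree_trunc n t'"
proof (cases "\<forall>n. tree_trunc n t = tree_trunc n t'")
  case True
  then show ?thesis by (simp add: tree_dist_def)
next
  case False
  let ?S = "{n. tree_trunc n t = tree_trunc n t'}"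
  from False obtain k where k: "tree_trunc k t \<noteq> tree_trunc k t'" by blast
  have fin: "finite ?S"
  proof (rule finite_subset)
    show "?S \<subseteq> {..k}" using k tree_trunc_eq_mono by (metis (mono_tags, lifting) atMost_iff mem_Collect_eq nle_le subsetI)
  qed simp
  have "0 \<in> ?S" using assms by (auto simp: trees_def is_tree_def tree_trunc_def)
  then have ne: "?S \<noteq> {}" by blast
  have Sup: "Sup ?S = Max ?S" using fin ne by (simp add: cSup_eq_Max)
  have "tree_dist t t' = (1 / 2) ^ Max ?S" using False Sup by (auto simp: tree_dist_def)
  then have "tree_dist t t' \<le> (1 / 2) ^ n \<longleftrightarrow> n \<le> Max ?S"
    by (simp add: power_decreasing_iff)
  also have "\<dots> \<longleftrightarrow> n \<in> ?S"
    using Max_in[OF fin ne] Max_ge[OF fin] tree_trunc_eq_mono by blast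
  finally show ?thesis by simp
qed

lemma Metric_space_trees: "Metric_space trees tree_dist"
proof
  fix x y z assume x: "x \<in> trees" and y: "y \<in> trees"
  show "tree_dist x y = 0 \<longleftrightarrow> x = y"
  proof
    assume "tree_dist x y = 0"
    then have "\<forall>n. tree_trunc n x = tree_trunc n y" by (auto simp: tree_dist_def split: if_splits)
    then show "x = y" unfolding tree_trunc_def by blast
  qed (simp add: tree_dist_def)
  assume z: "z \<in> trees"
  show "tree_dist x z \<le> tree_dist x y + tree_dist y z"
  proof -
    have nn: "0 \<le> tree_dist a b" for a b by (simp add: tree_dist_def)
    have val: "tree_dist a b = 0 \<or> (\<exists>n. tree_dist a b = (1/2) ^ n)" for a b
      by (auto simp: tree_dist_def)
    have "tree_dist x z \<le> max (tree_dist x y) (tree_dist y z)"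
    proof (cases "max (tree_dist x y) (tree_dist y z) = 0")
      case True
      then have "tree_dist x y = 0" "tree_dist y z = 0" using nn[of x y] nn[of y z] by linarith+
      then have "\<forall>n. tree_trunc n x = tree_trunc n z" by (auto simp: tree_dist_def split: if_splits)
      then show ?thesis using nn[of x y] by (simp add: tree_dist_def)
    next
      case False
      then obtain n where n: "max (tree_dist x y) (tree_dist y z) = (1/2) ^ n"
        using val[of x y] val[of y z] by (metis max_def)
      then have "tree_dist x y \<le> (1/2) ^ n" "tree_dist y z \<le> (1/2) ^ n" by linarith+
      then show ?thesis using n x y z by (simp add: tree_dist_le_iff)
    qed
    then show ?thesis using nn[of x y] nn[of y z] by linarith
  qed
next
  fix x y
  show "0 \<le> tree_dist x y" by (simp add: tree_dist_def)
  have "(tree_trunc n x = tree_trunc n y) = (tree_trunc n y = tree_trunc n x)" for n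
    by (rule eq_commute)
  then show "tree_dist x y = tree_dist y x" unfolding tree_dist_def by presburger
qed

definition tree_sigma :: "nat list set measure" where
  "tree_sigma = sigma trees {U. openin (Metric_space.mtopology trees tree_dist) U}"

definition subtree :: "nat \<Rightarrow> nat list set \<Rightarrow> nat list set" where
  "subtree i t = {m \<in> words. i # m \<in> t}"

text \<open>
  Conditioning on an event of positive probability, with the event as the new sample space: the
  \<open>i\<close>-th sub-tree is a tree only where the root has at least \<open>i\<close> children.
\<close>

definition cond_measure :: "'w measure \<Rightarrow> 'w set \<Rightarrow> 'w measure" where
  "cond_measure M A = uniform_measure (restrict_space M A) A"

definition GW_tree :: "'w measure \<Rightarrow> nat pmf \<Rightarrow> ('w \<Rightarrow> nat list set) \<Rightarrow> bool" where
  "GW_tree M Q T \<longleftrightarrow>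
    T \<in> measurable M tree_sigma \<and>
    distr M (count_space UNIV) (\<lambda>\<omega>. the_enat (offspring [] (T \<omega>))) = measure_pmf Q \<and>
    (\<forall>n A. A = {\<omega> \<in> space M. offspring [] (T \<omega>) = enat n} \<and> measure M A > 0 \<longrightarrow>
       prob_space.indep_vars (cond_measure M A) (\<lambda>_. tree_sigma) (\<lambda>i \<omega>. subtree i (T \<omega>)) {1..n} \<and>
       (\<forall>i\<in>{1..n}. distr (cond_measure M A) tree_sigma (\<lambda>\<omega>. subtree i (T \<omega>)) = distr M tree_sigma T))"


section \<open>Besov random tree prior\<close>

text \<open>
  The coordinate type has no order of its own; \<open>coord\<close> numbers the coordinates by 1, ..., d.
  Positions in lists start at 0, so \<open>n ! i\<close> is the entry with number \<open>i + 1\<close>.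
\<close>

definition idx1 :: "nat \<Rightarrow> nat list \<Rightarrow> nat" where
  "idx1 d n = 1 + (\<Sum>i<length n. 2 ^ (d * (length n - (i + 1))) * (n ! i - 1))"

definition idx2 :: "('d \<Rightarrow> nat) \<Rightarrow> nat \<Rightarrow> nat \<Rightarrow> int^'d" where
  "idx2 coord j n = (\<chi> c. int (((n - 1) div 2 ^ (j * (coord c - 1))) mod 2 ^ j))"

definition tree_index :: "('d::finite \<Rightarrow> nat) \<Rightarrow> nat list \<Rightarrow> int^'d" where
  "tree_index coord n = idx2 coord (length n) (idx1 CARD('d) n)"

definition I_tree :: "('d::finite \<Rightarrow> nat) \<Rightarrow> nat list set \<Rightarrow> 'd windex set" where
  "I_tree coord t = {(j, k, l). (\<exists>n\<in>t. j = length n \<and> k = tree_index coord n) \<and> l \<in> L_set j}"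

definition besov_coefficients ::
    "'w measure \<Rightarrow> real \<Rightarrow> real \<Rightarrow> ('d::finite windex \<Rightarrow> 'w \<Rightarrow> real) \<Rightarrow> bool" where
  "besov_coefficients M p \<kappa> X \<longleftrightarrow>
    prob_space.indep_vars M (\<lambda>_. borel) X I_Psi \<and>
    (\<forall>i\<in>I_Psi. distributed M lborel (X i)
       (\<lambda>x. ennreal (exp (- (\<bar>x\<bar> powr p) / \<kappa>) / (\<integral>y. exp (- (\<bar>y\<bar> powr p) / \<kappa>) \<partial>lborel))))"

definition besov_tree_data ::
    "'w measure \<Rightarrow> real \<Rightarrow> real \<Rightarrow> real \<Rightarrow> ('d::finite windex \<Rightarrow> 'w \<Rightarrow> real) \<Rightarrow> ('w \<Rightarrow> nat list set) \<Rightarrow> bool"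
  where
  "besov_tree_data M p \<kappa> \<beta> X T \<longleftrightarrow>
    besov_coefficients M p \<kappa> X \<and>
    GW_tree M (binomial_pmf (2 ^ CARD('d)) \<beta>) T \<and>
    prob_space.indep_set M
      {(\<lambda>\<omega>. \<lambda>i\<in>I_Psi. X i \<omega>) -` A \<inter> space M | A. A \<in> sets (PiM I_Psi (\<lambda>_. borel))}
      {T -` B \<inter> space M | B. B \<in> sets tree_sigma}"

definition besov_term ::
    "(real \<Rightarrow> real) \<Rightarrow> (real \<Rightarrow> real) \<Rightarrow> real \<Rightarrow> real \<Rightarrow> ('d::finite windex \<Rightarrow> 'w \<Rightarrow> real)
     \<Rightarrow> 'w \<Rightarrow> 'd windex \<Rightarrow> real^'d \<Rightarrow> real" where
  "besov_term \<phi> \<psi> p s X \<omega> i x =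
    2 powr (- (real (fst i) * (s + real CARD('d) / 2 - real CARD('d) / p)))
    * X i \<omega> * psi_per \<phi> \<psi> i x"

text \<open>The series is summed in L2 of the torus, represented by the unit cube.\<close>

definition besov_tree_rv ::
    "('d::finite \<Rightarrow> nat) \<Rightarrow> (real \<Rightarrow> real) \<Rightarrow> (real \<Rightarrow> real) \<Rightarrow> real \<Rightarrow> real
     \<Rightarrow> ('d windex \<Rightarrow> 'w \<Rightarrow> real) \<Rightarrow> ('w \<Rightarrow> nat list set) \<Rightarrow> 'w \<Rightarrow> real^'d \<Rightarrow> real" where
  "besov_tree_rv coord \<phi> \<psi> p s X T \<omega> =
    L2_infsum (lebesgue_on (cbox 0 1)) (besov_term \<phi> \<psi> p s X \<omega>) (I_tree coord (T \<omega>))"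

definition besov_tree_rv_trunc ::
    "('d::finite \<Rightarrow> nat) \<Rightarrow> (real \<Rightarrow> real) \<Rightarrow> (real \<Rightarrow> real) \<Rightarrow> real \<Rightarrow> real
     \<Rightarrow> ('d windex \<Rightarrow> 'w \<Rightarrow> real) \<Rightarrow> ('w \<Rightarrow> nat list set) \<Rightarrow> nat \<Rightarrow> 'w \<Rightarrow> real^'d \<Rightarrow> real" where
  "besov_tree_rv_trunc coord \<phi> \<psi> p s X T N \<omega> x =
    (\<Sum>i \<in> {i \<in> I_tree coord (T \<omega>). fst i \<le> N}. besov_term \<phi> \<psi> p s X \<omega> i x)"

end

theory Submission
  imports Defs
begin

text \<open>
  Pathwise, testing the difference of two weak formulations with the difference of the solutions
  bounds \<open>u - uN\<close> in \<open>V\<close> by a constant times \<open>exp (3 * R) * \<parallel>b - b\<^sub>N\<parallel>\<close> in the sup norm, where \<open>R\<close>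
  bounds both exponents. Put \<open>\<delta> = s - d / p > 0\<close>. At each point only boundedly many wavelets of a
  level are nonzero, so a level-\<open>j\<close> coefficient contributes at most a multiple of
  \<open>2 powr (- j * \<delta>) * \<bar>X\<bar>\<close>.

  Two random constants replace any fine analysis of the suprema. Since \<open>p > 1\<close>, all
  \<open>E (exp (c * \<bar>X\<bar>))\<close> are finite, and a union bound over all coefficients gives
  \<open>\<bar>X\<bar> \<le> Z * 2 powr (j * \<delta> / 2)\<close> with \<open>exp (c * Z)\<close> integrable. Along the tree, the expected
  number of nodes of level \<open>j\<close> is \<open>2 powr (j * \<gamma>)\<close>, so \<open>\<bar>X\<bar> \<le> W * 2 powr (j * (\<delta> - t))\<close> with
  \<open>W powr r\<close> integrable whenever \<open>r * (t - \<delta>) + \<gamma> < 0\<close>; the hypothesis on \<open>t\<close> leaves room for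
  some \<open>r > q\<close>. Summing the tail gives \<open>\<parallel>b - b\<^sub>N\<parallel> \<le> const * W * 2 powr (- N * t)\<close>, and the product of
  \<open>exp (3 * R)\<close> and \<open>W\<close> lies in \<open>L\<^sup>q\<close>.
\<close>

section \<open>Smooth functions and bump functions\<close>

text \<open>The hypotheses say nothing about measurability of \<open>u\<close> and \<open>uN\<close>
  in the random parameter, yet the conclusion includes membership in \<open>Lq_V\<close>. The
  stability estimate supplies it: a solution depends continuously on the random coefficients in its
  exponent, and these are measurable. Moreover \<open>weak_gradient\<close> and
  \<open>L2_infsum\<close> are arbitrary choices, so uniqueness almost everywhere has to be proved
  before anything can be computed with them; for gradients this rests on the fundamental lemma of
  the calculus of variations and on smooth bumps.

  There are two random constants because their roles conflict. \<open>Z\<close> has exponential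
  moments but ignores the tree. \<open>W\<close> sees how sparse the tree is, but its moments are
  guaranteed only up to an order r. For negative \<gamma> the rate t may exceed \<delta>, and then
  only \<open>W\<close> can deliver it. Young's inequality with the exponents r / (r - q) and r / q
  joins the two, which is why r has to exceed q strictly.\<close>

lemma C_k_mono: "C_k (Suc k) f \<Longrightarrow> C_k k f"
proof (induction k arbitrary: f)
  case 0
  then show ?case
    by (auto simp: continuous_on_eq_continuous_at intro: differentiable_imp_continuous_within)
qed auto

lemma C_k_const: "C_k k (\<lambda>_. c)"
  by (induction k arbitrary: c) auto

lemma C_k_SucI:
  assumes d: "\<And>x. (f has_derivative f' x) (at x)" and "\<And>e. e \<in> Basis \<Longrightarrow> C_k k (\<lambda>x. f' x e)"
  shows "C_k (Suc k) f"
proof -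
  have "frechet_derivative f (at x) = f' x" for x by (rule frechet_derivative_at[OF d, symmetric])
  moreover have "f differentiable at x" for x using d unfolding differentiable_def by blast
  ultimately show ?thesis using assms(2) by simp
qed

lemma C_k_SucD:
  assumes "C_k (Suc k) f"
  shows "(f has_derivative frechet_derivative f (at x)) (at x)"
    "e \<in> Basis \<Longrightarrow> C_k k (\<lambda>x. frechet_derivative f (at x) e)"
  using assms by (auto simp: frechet_derivative_works)

lemma C_k_add: "C_k k f \<Longrightarrow> C_k k g \<Longrightarrow> C_k k (\<lambda>x. f x + g x)"
proof (induction k arbitrary: f g)
  case 0
  then show ?case by (auto intro: continuous_on_add)
next
  case (Suc k)
  note f = C_k_SucD[OF Suc.prems(1)] and g = C_k_SucD[OF Suc.prems(2)]
  show ?case by (rule C_k_SucI, rule has_derivative_add[OF f(1) g(1)]) (intro Suc.IH f g)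
qed

lemma C_k_mult: "C_k k f \<Longrightarrow> C_k k g \<Longrightarrow> C_k k (\<lambda>x. f x * g x)"
proof (induction k arbitrary: f g)
  case 0
  then show ?case by (auto intro: continuous_on_mult)
next
  case (Suc k)
  note f = C_k_SucD[OF Suc.prems(1)] and g = C_k_SucD[OF Suc.prems(2)]
  show ?case
    by (rule C_k_SucI, rule has_derivative_mult[OF f(1) g(1)])
      (intro C_k_add Suc.IH f g C_k_mono[OF Suc.prems(1)] C_k_mono[OF Suc.prems(2)])
qed

lemma C_k_prod: "finite A \<Longrightarrow> (\<And>i. i \<in> A \<Longrightarrow> C_k k (f i)) \<Longrightarrow> C_k k (\<lambda>x. \<Prod>i\<in>A. f i x)"
  by (induction A rule: finite_induct) (auto intro: C_k_const C_k_mult)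

text \<open>Bumps on boxes are products of functions of a single coordinate, so this special case of
  the chain rule carries smoothness from one variable to several.\<close>

lemma C_k_compose_affine:
  fixes h :: "real \<Rightarrow> real"
  shows "C_k k h \<Longrightarrow> C_k k (\<lambda>x::real^'d. h (m * x $ c + b))"
proof (induction k arbitrary: h)
  case 0
  show ?case using 0
    by (auto intro!: continuous_on_compose2[of UNIV h UNIV "\<lambda>x. m * x $ c + b"] continuous_intros)
next
  case (Suc k)
  note h = C_k_SucD(1)[OF Suc.prems]
  have d: "((\<lambda>x::real^'d. h (m * x $ c + b)) has_derivative
      (\<lambda>y. frechet_derivative h (at (m * x $ c + b)) (m * y $ c))) (at x)" for x
  proof -
    have "((\<lambda>x::real^'d. m * x $ c + b) has_derivative (\<lambda>y. m * y $ c)) (at x)"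
      by (auto intro!: derivative_eq_intros bounded_linear_imp_has_derivative bounded_linear_vec_nth)
    from diff_chain_at[OF this h] show ?thesis by (simp add: o_def)
  qed
  have e: "frechet_derivative h (at t) (m * e $ c) = frechet_derivative h (at t) 1 * (m * e $ c)" for t and e :: "real^'d"
    using linear_cmul[OF has_derivative_linear[OF h], of t "m * e $ c" 1] by simp
  have "C_k k (\<lambda>x. frechet_derivative h (at x) 1)" using Suc.prems by auto
  from Suc.IH[OF this] show ?case by (intro C_k_SucI[OF d]) (simp add: e C_k_mult C_k_const)
qed

lemma C_k_real_SucI:
  fixes f :: "real \<Rightarrow> real"
  assumes "\<And>x. (f has_real_derivative f' x) (at x)" "C_k k f'"
  shows "C_k (Suc k) f"
  by (rule C_k_SucI[OF assms(1)[unfolded has_field_derivative_def]]) (use assms(2) in simp)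

lemma C_k_diff: "C_k k f \<Longrightarrow> C_k k g \<Longrightarrow> C_k k (\<lambda>x. f x - g x)"
  using C_k_add[OF _ C_k_mult[OF C_k_const[of k "-1"]], of f g] by simp

lemma test_functionI:
  assumes "\<And>k. C_k k f" "compact K" "{x. f x \<noteq> 0} \<subseteq> K" "K \<subseteq> D"
  shows "test_function D f"
proof -
  have "closure {x. f x \<noteq> 0} \<subseteq> K"
    using assms by (simp add: closure_minimal compact_imp_closed)
  moreover from this have "compact (closure {x. f x \<noteq> 0})"
    using compact_Int_closed[OF assms(2) closed_closure, of "{x. f x \<noteq> 0}"]
    by (simp add: Int_absorb1)
  ultimately show ?thesis using assms(1,4)
    unfolding test_function_def compactly_supported_def by blast
qed

text \<open>For n = 0 this is the classical smooth function that is flat at the origin. The powers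
  of 1 / t close the family under differentiation, so that smoothness becomes one induction over all
  n at once.\<close>

definition flat_exp :: "nat \<Rightarrow> real \<Rightarrow> real" where
  "flat_exp n t = (if t > 0 then (1 / t) ^ n * exp (- 1 / t) else 0)"

lemma flat_exp_tendsto_0: "((\<lambda>t::real. (1 / t) ^ n * exp (- 1 / t)) \<longlongrightarrow> 0) (at_right 0)"
proof -
  have "((\<lambda>x::real. x ^ n / exp x) \<longlongrightarrow> 0) at_top" by (rule tendsto_power_div_exp_0)
  then have "((\<lambda>t::real. inverse t ^ n / exp (inverse t)) \<longlongrightarrow> 0) (at_right 0)"
    by (rule filterlim_compose[OF _ filterlim_inverse_at_top_right])
  then show ?thesis by (simp add: exp_minus field_simps)
qed

text \<open>Only \<open>t = 0\<close> is delicate: there the difference quotient is 0 on the left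
  and the member n + 1 of the same family on the right, which tends to 0 because the exponential
  beats every power.\<close>

lemma flat_exp_deriv:
  "(flat_exp n has_real_derivative (flat_exp (n + 2) t + (- real n) * flat_exp (n + 1) t)) (at t)"
proof (cases "t = 0")
  case True
  have "((\<lambda>h. flat_exp n h / h) \<longlongrightarrow> 0) (at 0)"
  proof (rule filterlim_split_at)
    have "eventually (\<lambda>h. flat_exp n h / h = 0) (at_left 0)"
      unfolding eventually_at by (auto simp: flat_exp_def intro!: exI[of _ 1])
    then show "((\<lambda>h. flat_exp n h / h) \<longlongrightarrow> 0) (at_left 0)"
      by (rule tendsto_eventually)
    have "eventually (\<lambda>h. (1 / h) ^ (Suc n) * exp (- 1 / h) = flat_exp n h / h) (at_right 0)"
      unfolding eventually_at by (auto simp: flat_exp_def intro!: exI[of _ 1])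
    then show "((\<lambda>h. flat_exp n h / h) \<longlongrightarrow> 0) (at_right 0)"
      by (rule Lim_transform_eventually[OF flat_exp_tendsto_0])
  qed
  then show ?thesis using True by (simp add: DERIV_def flat_exp_def)
next
  case False
  show ?thesis
  proof (cases "t > 0")
    case True
    have "((\<lambda>t. (1 / t) ^ n * exp (- 1 / t)) has_real_derivative
       (flat_exp (n + 2) t + (- real n) * flat_exp (n + 1) t)) (at t)"
      using True
      apply (auto intro!: derivative_eq_intros simp: flat_exp_def)
      apply (cases n)
       apply (auto simp: field_simps power2_eq_square)
      done
    then show ?thesis
      by (rule has_field_derivative_transform_within_open[of _ _ _ "{0<..}"])
        (use True in \<open>auto simp: flat_exp_def\<close>)
  next
    case F: False
    have "((\<lambda>t. 0) has_real_derivative (flat_exp (n + 2) t + (- real n) * flat_exp (n + 1) t)) (at t)"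
      using F False by (auto simp: flat_exp_def)
    then show ?thesis
      by (rule has_field_derivative_transform_within_open[of _ _ _ "{..<0}"])
        (use F False in \<open>auto simp: flat_exp_def\<close>)
  qed
qed

lemma C_k_flat_exp: "C_k k (flat_exp n)"
proof (induction k arbitrary: n)
  case 0
  have "isCont (flat_exp n) t" for t using flat_exp_deriv DERIV_isCont by blast
  then show ?case by (simp add: continuous_on_eq_continuous_at)
next
  case (Suc k)
  then show ?case
    by (intro C_k_real_SucI[OF flat_exp_deriv] C_k_add C_k_mult C_k_const)
qed

text \<open>The factor n steepens the flanks without moving the support: for growing n the bumps
  approach the indicator of the open box from below, all of them bounded by 1, as dominated
  convergence requires.\<close>

definition box_bump :: "(real^'d) \<Rightarrow> (real^'d) \<Rightarrow> nat \<Rightarrow> real^'d \<Rightarrow> real" where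
  "box_bump a b n x =
    (\<Prod>c\<in>UNIV. flat_exp 0 (real n * (x $ c - a $ c)) * flat_exp 0 (real n * (b $ c - x $ c)))"

lemma flat_exp_bounds: "0 \<le> flat_exp 0 t" "flat_exp 0 t \<le> 1"
  by (auto simp: flat_exp_def)

lemma box_bump_bounds: "0 \<le> box_bump a b n x" "box_bump a b n x \<le> 1"
  unfolding box_bump_def
  by (auto intro!: prod_nonneg prod_le_1 mult_nonneg_nonneg mult_le_one simp: flat_exp_bounds)

lemma box_bump_eq_0: "x \<notin> box a b \<Longrightarrow> box_bump a b n x = 0"
proof -
  assume "x \<notin> box a b"
  then obtain c where "\<not> (a $ c < x $ c \<and> x $ c < b $ c)" by (auto simp: mem_box_cart)
  then have "flat_exp 0 (real n * (x $ c - a $ c)) * flat_exp 0 (real n * (b $ c - x $ c)) = 0"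
    by (auto simp: flat_exp_def zero_less_mult_iff)
  then show ?thesis by (auto simp: box_bump_def prod_zero_iff)
qed

lemma box_bump_tendsto: "(\<lambda>n. box_bump a b n x) \<longlonglongrightarrow> indicator (box a b) x"
proof (cases "x \<in> box a b")
  case True
  have fl: "(\<lambda>n. flat_exp 0 (real n * t)) \<longlonglongrightarrow> 1" if "t > 0" for t
  proof -
    have "(\<lambda>n. exp (- (1 / t) * (1 / real n))) \<longlonglongrightarrow> exp (- (1 / t) * 0)"
      by (intro tendsto_intros lim_1_over_n)
    then have l: "(\<lambda>n. exp (- (1 / t) * (1 / real n))) \<longlonglongrightarrow> 1" by simp
    have "eventually (\<lambda>n. exp (- (1 / t) * (1 / real n)) = flat_exp 0 (real n * t)) sequentially"
      using eventually_gt_at_top[of 0]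
      by eventually_elim (use that in \<open>auto simp: flat_exp_def field_simps\<close>)
    from Lim_transform_eventually[OF l this] show ?thesis .
  qed
  have "(\<lambda>n. box_bump a b n x) \<longlonglongrightarrow> (\<Prod>c\<in>(UNIV::'a set). 1 * 1)"
    unfolding box_bump_def
    by (intro tendsto_prod tendsto_mult fl) (use True in \<open>auto simp: mem_box_cart\<close>)
  then show ?thesis using True by simp
qed (simp add: box_bump_eq_0)

lemma C_k_box_bump: "C_k k (box_bump a b n)"
proof -
  have eq: "box_bump a b n = (\<lambda>x. \<Prod>c\<in>UNIV. flat_exp 0 (real n * x $ c + (- real n * a $ c)) *
      flat_exp 0 ((- real n) * x $ c + real n * b $ c))"
    by (rule ext) (simp add: box_bump_def algebra_simps)
  show ?thesis unfolding eq
    by (intro C_k_prod C_k_mult C_k_compose_affine C_k_flat_exp) simp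
qed

lemma test_function_box_bump:
  assumes "cbox a b \<subseteq> D"
  shows "test_function D (box_bump a b n)"
proof (rule test_functionI[OF C_k_box_bump compact_cbox _ assms])
  show "{x. box_bump a b n x \<noteq> 0} \<subseteq> cbox a b" using box_bump_eq_0 box_subset_cbox by blast
qed

section \<open>Test functions and their partial derivatives\<close>

abbreviation partial :: "'d \<Rightarrow> (real^'d \<Rightarrow> real) \<Rightarrow> real^'d \<Rightarrow> real" where
  "partial i f \<equiv> \<lambda>x. frechet_derivative f (at x) (axis i 1)"

lemma test_function_D:
  fixes D :: "(real^'d) set"
  assumes "test_function D \<theta>"
  shows "continuous_on UNIV \<theta>" "\<theta> differentiable (at x)"
    "C_k k (partial i \<theta>)"
proof -
  have C: "C_k k \<theta>" for k using assms by (auto simp: test_function_def)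
  from C[of 0] show "continuous_on UNIV \<theta>" by simp
  from C[of 1] show "\<theta> differentiable (at x)" by simp
  have "axis i (1::real) \<in> Basis" by (simp add: axis_in_Basis_iff)
  then show "C_k k (partial i \<theta>)" using C[of "Suc k"] by auto
qed

lemma compactly_supported_bounded:
  assumes "continuous_on UNIV f" "compactly_supported f"
  obtains B where "B \<ge> 0" "\<And>x. \<bar>f x\<bar> \<le> B"
proof -
  let ?K = "closure {x. f x \<noteq> 0}"
  have "compact (f ` ?K)"
    using assms by (auto simp: compactly_supported_def intro: compact_continuous_image continuous_on_subset)
  then have "bounded (f ` ?K)" by (rule compact_imp_bounded)
  then obtain B where B: "\<forall>y\<in>f ` ?K. norm y \<le> B" by (auto simp: bounded_iff)
  have "\<bar>f x\<bar> \<le> max B 0" for x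
  proof (cases "f x = 0")
    case False
    then have "x \<in> ?K" using closure_subset by fastforce
    then show ?thesis using B by fastforce
  qed auto
  then show ?thesis using that[of "max B 0"] by simp
qed

lemma frechet_derivative_outside_support:
  assumes "x \<notin> closure {x. f x \<noteq> 0}"
  shows "frechet_derivative f (at x) = (\<lambda>_. 0)"
proof -
  have "((\<lambda>_. 0) has_derivative (\<lambda>_. 0)) (at x)" by simp
  then have "(f has_derivative (\<lambda>_. 0)) (at x)"
    by (rule has_derivative_transform_within_open[where s = "- closure {x. f x \<noteq> 0}"])
      (use assms closure_subset[of "{x. f x \<noteq> 0}"] in auto)
  then show ?thesis by (rule frechet_derivative_at[symmetric])
qed

lemma test_function_partial:
  assumes "test_function D \<theta>"
  shows "test_function D (partial i \<theta>)"
proof (rule test_functionI[OF test_function_D(3)[OF assms]])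
  show "{x. partial i \<theta> x \<noteq> 0} \<subseteq> closure {x. \<theta> x \<noteq> 0}"
    using frechet_derivative_outside_support by fastforce
qed (use assms in \<open>simp_all add: test_function_def compactly_supported_def\<close>)

lemma test_function_bounded:
  assumes "test_function D \<theta>"
  obtains B where "B \<ge> 0" "\<And>x. \<bar>\<theta> x\<bar> \<le> B"
proof (rule compactly_supported_bounded[OF _ _ that])
  show "continuous_on UNIV \<theta>" by (rule test_function_D(1)[OF assms])
  show "compactly_supported \<theta>" using assms by (simp add: test_function_def)
qed

section \<open>Square-integrable functions\<close>

lemma L2_add:
  fixes f g :: "'a \<Rightarrow> 'b::euclidean_space"
  assumes "f \<in> L2 M" "g \<in> L2 M"
  shows "(\<lambda>x. f x + g x) \<in> L2 M"
proof -
  have m[measurable]: "f \<in> borel_measurable M" "g \<in> borel_measurable M"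
    and i: "integrable M (\<lambda>x. (norm (f x))\<^sup>2)" "integrable M (\<lambda>x. (norm (g x))\<^sup>2)"
    using assms by (auto simp: L2_def)
  have "(norm (f x + g x))\<^sup>2 \<le> 2 * (norm (f x))\<^sup>2 + 2 * (norm (g x))\<^sup>2" for x
  proof -
    have "(norm (f x + g x))\<^sup>2 \<le> (norm (f x) + norm (g x))\<^sup>2"
      by (intro power_mono norm_triangle_ineq) simp
    also have "\<dots> \<le> 2 * (norm (f x))\<^sup>2 + 2 * (norm (g x))\<^sup>2"
      using sum_squares_bound[of "norm (f x)" "norm (g x)"] by (simp add: power2_sum)
    finally show ?thesis .
  qed
  then have b: "AE x in M. norm ((norm (f x + g x))\<^sup>2) \<le> norm (2 * (norm (f x))\<^sup>2 + 2 * (norm (g x))\<^sup>2)"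
    by simp
  have j: "integrable M (\<lambda>x. 2 * (norm (f x))\<^sup>2 + 2 * (norm (g x))\<^sup>2)" using i by simp
  have "integrable M (\<lambda>x. (norm (f x + g x))\<^sup>2)"
    by (rule Bochner_Integration.integrable_bound[OF j _ b]) simp
  then show ?thesis by (simp add: L2_def)
qed

lemma L2_scaleR:
  fixes f :: "'a \<Rightarrow> 'b::euclidean_space"
  assumes "f \<in> L2 M"
  shows "(\<lambda>x. c *\<^sub>R f x) \<in> L2 M"
  using assms by (auto simp: L2_def power_mult_distrib)

lemma L2_diff:
  fixes f g :: "'a \<Rightarrow> 'b::euclidean_space"
  assumes "f \<in> L2 M" "g \<in> L2 M"
  shows "(\<lambda>x. f x - g x) \<in> L2 M"
  using L2_add[OF assms(1) L2_scaleR[OF assms(2), of "-1"]] by simp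

lemma L2_vec_nth:
  fixes f :: "'a \<Rightarrow> real^'n"
  assumes "f \<in> L2 M"
  shows "(\<lambda>x. f x $ i) \<in> L2 M"
proof -
  have m[measurable]: "f \<in> borel_measurable M" and i: "integrable M (\<lambda>x. (norm (f x))\<^sup>2)"
    using assms by (auto simp: L2_def)
  have [measurable]: "(\<lambda>x. f x $ i) \<in> borel_measurable M"
    using borel_measurable_continuous_onI[OF continuous_on_component[OF continuous_on_id], of i] m
    by (rule measurable_compose_rev)
  have "integrable M (\<lambda>x. (norm (f x $ i))\<^sup>2)"
  proof (rule Bochner_Integration.integrable_bound[OF i])
    have "\<bar>f x $ i\<bar> \<le> norm (f x)" for x by (rule component_le_norm_cart)
    then show "AE x in M. norm ((norm (f x $ i))\<^sup>2) \<le> norm ((norm (f x))\<^sup>2)"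
      by (intro AE_I2) (simp add: abs_le_square_iff[symmetric])
  qed simp
  then show ?thesis by (simp add: L2_def)
qed

text \<open>From \<bar>f\<bar> \<le> 1 + f^2, where the constant 1 is integrable because the measure
  is finite.\<close>

lemma (in finite_measure) integrable_L2_mult_bounded:
  fixes f g :: "'a \<Rightarrow> real"
  assumes "f \<in> L2 M" and [measurable]: "g \<in> borel_measurable M" and "\<And>x. \<bar>g x\<bar> \<le> B"
  shows "integrable M (\<lambda>x. f x * g x)"
proof -
  have [measurable]: "f \<in> borel_measurable M" and i: "integrable M (\<lambda>x. (f x)\<^sup>2)"
    using assms by (auto simp: L2_def)
  show ?thesis
  proof (rule Bochner_Integration.integrable_bound[where f = "\<lambda>x. B * (1 + (f x)\<^sup>2)"])
    show "AE x in M. norm (f x * g x) \<le> norm (B * (1 + (f x)\<^sup>2))"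
    proof (rule AE_I2)
      fix x
      have B: "B \<ge> 0" using assms(3)[of x] by linarith
      have "\<bar>f x\<bar> * 1 \<le> 1 + (f x)\<^sup>2" using sum_squares_bound[of "\<bar>f x\<bar>" 1] by simp
      then have "\<bar>f x\<bar> * \<bar>g x\<bar> \<le> (1 + (f x)\<^sup>2) * B"
        using assms(3)[of x] by (intro mult_mono) auto
      then show "norm (f x * g x) \<le> norm (B * (1 + (f x)\<^sup>2))"
        using B by (simp add: abs_mult mult.commute)
    qed
  qed (use i in auto)
qed

text \<open>Boxes form an intersection-stable generator of the Borel sets. The induction runs over
  all Borel sets but integrates only over their intersection with the fixed box, so that the
  hypothesis on its sub-boxes starts it and survives complements.\<close>

lemma borel_integral_zero_on_box:
  fixes h :: "'a::euclidean_space \<Rightarrow> real"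
  assumes int: "integrable lborel h"
    and box: "\<And>c d. box c d \<subseteq> box a b \<Longrightarrow> (\<integral>x. h x * indicator (box c d) x \<partial>lborel) = 0"
  shows "AE x in lborel. x \<in> box a b \<longrightarrow> h x = 0"
proof -
  have [measurable]: "h \<in> borel_measurable borel" using int by auto
  have ii: "integrable lborel (\<lambda>x. h x * indicator A x)" if "A \<in> sets borel" for A
    using integrable_mult_indicator[OF _ int, of A] that by (simp add: mult.commute)
  have *: "A \<in> sets borel \<Longrightarrow> (\<integral>x. h x * indicator (A \<inter> box a b) x \<partial>lborel) = 0" for A
  proof -
    let ?G = "range (\<lambda>(a, b). box a b :: 'a set)"
    assume "A \<in> sets borel"
    then have A: "A \<in> sigma_sets UNIV ?G" by (simp add: borel_eq_box)
    have bI: "sigma_sets UNIV ?G = sets borel" by (simp add: borel_eq_box)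
    have G: "Int_stable ?G" by (auto simp: Int_stable_def box_Int_box image_iff)
    from G subset_UNIV[of ?G, folded Pow_UNIV] A show ?thesis
    proof (induction rule: sigma_sets_induct_disjoint)
      case (basic A)
      then obtain c d where "A = box c d" by auto
      then obtain c' d' where e: "A \<inter> box a b = box c' d'" by (auto simp: box_Int_box)
      then show ?case using box[of c' d'] by auto
    next
      case (compl A)
      then have Ab: "A \<in> sets borel" by (simp add: bI)
      have "(\<lambda>x. h x * indicator ((UNIV - A) \<inter> box a b) x) =
        (\<lambda>x. h x * indicator (box a b) x - h x * indicator (A \<inter> box a b) x)"
        by (auto simp: indicator_def fun_eq_iff)
      moreover have "(\<integral>x. h x * indicator (box a b) x - h x * indicator (A \<inter> box a b) x \<partial>lborel) = 0"
        using compl Ab by (subst Bochner_Integration.integral_diff) (auto intro!: ii box)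
      ultimately show ?case by simp
    next
      case (union F)
      then have Fb: "F i \<in> sets borel" for i by (auto simp: bI)
      have dis: "disjoint_family (\<lambda>i. F i \<inter> box a b)"
        using union by (auto simp: disjoint_family_on_def)
      have "(LINT x:(\<Union>i. F i \<inter> box a b)|lborel. h x) = (\<Sum>i. (LINT x:(F i \<inter> box a b)|lborel. h x))"
      proof (rule lebesgue_integral_countable_add)
        show "set_integrable lborel (\<Union>i. F i \<inter> box a b) h"
          unfolding set_integrable_def using ii[of "\<Union>i. F i \<inter> box a b"] Fb
          by (simp add: mult.commute)
      qed (use Fb dis in \<open>auto simp: disjoint_family_on_def\<close>)
      also have "\<dots> = 0" using union.IH by (simp add: set_lebesgue_integral_def mult.commute)
      finally show ?case by (simp add: set_lebesgue_integral_def mult.commute)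
    qed auto
  qed
  \<comment> \<open>On the Borel set where \<open>f\<close> is positive a nonnegative function has
    integral 0. Taking \<open>h\<close> and then its negative for \<open>f\<close> leaves only the
    value 0.\<close>
  have pos: "AE x in lborel. f x * indicator (box a b) x \<le> 0"
    if f: "f = h \<or> f = (\<lambda>x. - h x)" for f
  proof -
    have [measurable]: "f \<in> borel_measurable borel" using f by auto
    let ?A = "{x \<in> space borel. f x > 0}"
    have A: "?A \<in> sets borel" by measurable
    have "(\<integral>x. f x * indicator (?A \<inter> box a b) x \<partial>lborel) = 0"
      using f *[OF A] by auto
    moreover have "integrable lborel (\<lambda>x. f x * indicator (?A \<inter> box a b) x)"
      using f ii[of "?A \<inter> box a b"] A by auto
    ultimately have "AE x in lborel. f x * indicator (?A \<inter> box a b) x = 0"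
      by (subst (asm) integral_nonneg_eq_0_iff_AE) (auto simp: indicator_def)
    then show ?thesis by eventually_elim (auto simp: indicator_def split: if_splits)
  qed
  from pos[of h] pos[of "\<lambda>x. - h x"] show ?thesis
    by (auto simp: indicator_def elim!: eventually_elim2 split: if_splits)
qed

section \<open>Weak gradients\<close>

text \<open>Bumps turn the hypothesis into vanishing integrals over every box whose closure lies in
  D; there \<open>g\<close> vanishes almost everywhere, and countably many such boxes exhaust
  D.\<close>

lemma fundamental_lemma_variations:
  fixes g :: "real^'d \<Rightarrow> real"
  assumes "open D" and int: "integrable (lebesgue_on D) g"
    and z: "\<And>\<theta>. test_function D \<theta> \<Longrightarrow> (\<integral>x. g x * \<theta> x \<partial>lebesgue_on D) = 0"
  shows "AE x in lebesgue_on D. g x = 0"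
proof -
  have D: "D \<in> sets lebesgue" using assms(1) by auto
  define h where "h x = (if x \<in> D then g x else 0)" for x
  have ih: "integrable lebesgue h"
    using int D unfolding h_def by (subst Lebesgue_Measure.integrable_restrict_UNIV)
  then have hm[measurable]: "h \<in> borel_measurable lebesgue" by auto
  \<comment> \<open>The induction over Borel sets needs a Borel function, whereas \<open>g\<close>
    is only Lebesgue measurable: replace its extension by zero with a Borel version.\<close>
  then obtain h' where h': "h' \<in> borel_measurable lborel" and e: "AE x in lborel. h x = h' x"
    using completion_ex_borel_measurable_real by blast
  have [measurable]: "h' \<in> borel_measurable borel" using h' by simp
  have h'l[measurable]: "h' \<in> borel_measurable lebesgue" using h' by (rule measurable_completion)
  have e': "AE x in lebesgue. h x = h' x" using AE_completion[OF e] .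
  have "integrable lebesgue h'" using ih e' by (subst integrable_cong_AE[where g = h]) auto
  then have ih': "integrable lborel h'" by (simp add: integrable_completion)
  have intz: "(\<integral>x. h' x * \<theta> x \<partial>lborel) = 0" if t: "test_function D \<theta>" for \<theta>
  proof -
    have tb[measurable]: "\<theta> \<in> borel_measurable borel"
      using test_function_D(1)[OF t] by (rule borel_measurable_continuous_onI)
    have [measurable]: "\<theta> \<in> borel_measurable lebesgue"
      by (rule measurable_completion) simp
    have "(\<integral>x. h' x * \<theta> x \<partial>lborel) = (\<integral>x. h' x * \<theta> x \<partial>lebesgue)"
      by (subst integral_completion) auto
    also have "\<dots> = (\<integral>x. h x * \<theta> x \<partial>lebesgue)"
      by (rule integral_cong_AE) (use e' in auto)
    also have "\<dots> = (\<integral>x. (if x \<in> D then g x * \<theta> x else 0) \<partial>lebesgue)"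
      by (rule Bochner_Integration.integral_cong) (auto simp: h_def)
    also have "\<dots> = (\<integral>x. g x * \<theta> x \<partial>lebesgue_on D)"
      by (rule Lebesgue_Measure.integral_restrict_UNIV[OF D])
    finally show ?thesis using z[OF t] by simp
  qed
  have box: "(\<integral>x. h' x * indicator (box c d) x \<partial>lborel) = 0"
    if "box c d \<subseteq> box a b" "cbox a b \<subseteq> D" for a b c d :: "real^'d"
  proof (cases "box c d = {}")
    case False
    then have "cbox c d \<subseteq> cbox a b"
      using that(1) by (metis closure_box closure_mono empty_subsetI subset_empty)
    then have t: "test_function D (box_bump c d n)" for n
      using that by (intro test_function_box_bump) auto
    have [measurable]: "box_bump c d n \<in> borel_measurable borel" for n
      using test_function_D(1)[OF t] by (rule borel_measurable_continuous_onI)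
    have "(\<lambda>n. \<integral>x. h' x * box_bump c d n x \<partial>lborel) \<longlonglongrightarrow> (\<integral>x. h' x * indicator (box c d) x \<partial>lborel)"
    proof (rule integral_dominated_convergence[where w = "\<lambda>x. norm (h' x)"])
      show "AE x in lborel. norm (h' x * box_bump c d i x) \<le> norm (h' x)" for i
        using box_bump_bounds[of c d i] by (auto simp: abs_mult intro!: mult_left_le)
      show "AE x in lborel. (\<lambda>i. h' x * box_bump c d i x) \<longlonglongrightarrow> h' x * indicator (box c d) x"
        by (intro AE_I2 tendsto_mult tendsto_const box_bump_tendsto)
    qed (use ih' in auto)
    then have "(\<lambda>n::nat. 0::real) \<longlonglongrightarrow> (\<integral>x. h' x * indicator (box c d) x \<partial>lborel)"
      by (simp add: intz[OF t])
    then show ?thesis using LIMSEQ_unique tendsto_const by blast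
  qed simp
  \<comment> \<open>Closed boxes with rational corners inside D: a countable cover, so the
    exceptional null sets, including the boundaries of the boxes, can be united.\<close>
  define \<B> where "\<B> = {f \<in> (Basis :: (real^'d) set) \<rightarrow>\<^sub>E \<rat> \<times> \<rat>.
    cbox (\<Sum>i\<in>Basis. fst (f i) *\<^sub>R i) (\<Sum>i\<in>Basis. snd (f i) *\<^sub>R i) \<subseteq> D}"
  define Q where "Q f = cbox (\<Sum>i\<in>Basis. fst (f i) *\<^sub>R i) (\<Sum>i\<in>Basis. snd (f i) *\<^sub>R i)"
    for f :: "real^'d \<Rightarrow> real \<times> real"
  have cB: "countable \<B>" unfolding \<B>_def
    by (rule countable_subset[where B = "Basis \<rightarrow>\<^sub>E \<rat> \<times> \<rat>"])
      (auto intro!: countable_PiE countable_rat)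
  have DQ: "D = (\<Union>f\<in>\<B>. Q f)" unfolding \<B>_def Q_def by (rule open_UNION_cbox[OF assms(1)])
  have "AE x in lborel. \<forall>f\<in>\<B>. x \<in> Q f \<longrightarrow> h' x = 0"
  proof (subst AE_ball_countable[OF cB], intro ballI)
    fix f assume f: "f \<in> \<B>"
    obtain a b where ab: "Q f = cbox a b" "cbox a b \<subseteq> D"
      using f by (auto simp: Q_def \<B>_def)
    have 1: "AE x in lborel. x \<in> box a b \<longrightarrow> h' x = 0"
      using box[OF _ ab(2)] by (rule borel_integral_zero_on_box[OF ih'])
    have "cbox a b - box a b \<in> null_sets lebesgue"
      using negligible_frontier_interval negligible_iff_null_sets by blast
    then have "cbox a b - box a b \<in> null_sets lborel"
      by (subst (asm) null_sets_completion_iff) auto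
    then have 2: "AE x in lborel. x \<notin> cbox a b - box a b" by (rule AE_not_in)
    from 1 2 show "AE x in lborel. x \<in> Q f \<longrightarrow> h' x = 0"
      unfolding ab by eventually_elim auto
  qed
  then have "AE x in lborel. x \<in> D \<longrightarrow> h' x = 0" by eventually_elim (auto simp: DQ)
  with e have "AE x in lborel. x \<in> D \<longrightarrow> g x = 0" by eventually_elim (auto simp: h_def)
  then show ?thesis using D AE_completion by (subst AE_restrict_space_iff) auto
qed

context
  fixes D :: "(real^'d) set"
  assumes D: "open D" "bounded D"
begin

lemma domain_sets: "D \<in> sets lebesgue" using D(1) by auto

lemma domain_finite_measure: "finite_measure (lebesgue_on D)"
  by (rule finite_measure_lebesgue_on) (use D in \<open>auto intro: bounded_set_imp_lmeasurable\<close>)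

lemma test_function_measurable: "test_function E \<theta> \<Longrightarrow> \<theta> \<in> borel_measurable (lebesgue_on D)"
  by (intro measurable_restrict_space1 measurable_completion)
    (simp add: borel_measurable_continuous_onI test_function_D(1))

lemma integrable_L2_test_function:
  assumes "f \<in> L2 (lebesgue_on D)" "test_function E \<theta>"
  shows "integrable (lebesgue_on D) (\<lambda>x. f x * \<theta> x)"
proof -
  interpret finite_measure "lebesgue_on D" by (rule domain_finite_measure)
  obtain B where "\<And>x. \<bar>\<theta> x\<bar> \<le> B" using test_function_bounded[OF assms(2)] by blast
  then show ?thesis
    using integrable_L2_mult_bounded[OF assms(1) test_function_measurable[OF assms(2)]] by blast
qed

lemma bounded_measurable_L2:
  fixes f :: "real^'d \<Rightarrow> 'b::euclidean_space"
  assumes [measurable]: "f \<in> borel_measurable (lebesgue_on D)" and b: "\<And>x. norm (f x) \<le> B"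
  shows "f \<in> L2 (lebesgue_on D)"
proof -
  interpret finite_measure "lebesgue_on D" by (rule domain_finite_measure)
  have "integrable (lebesgue_on D) (\<lambda>x. (norm (f x))\<^sup>2)"
    by (rule integrable_const_bound[where B = "B\<^sup>2"]) (use b in \<open>auto intro!: AE_I2 power_mono\<close>)
  then show ?thesis by (simp add: L2_def)
qed

text \<open>This makes the arbitrary choice behind \<open>weak_gradient\<close> harmless, at the
  price that identities between weak gradients hold only almost everywhere.\<close>

lemma has_weak_gradient_unique:
  assumes g: "g \<in> L2 (lebesgue_on D)" "g' \<in> L2 (lebesgue_on D)"
    and w: "has_weak_gradient D v g" "has_weak_gradient D v g'"
  shows "AE x in lebesgue_on D. g x = g' x"
proof -
  interpret finite_measure "lebesgue_on D" by (rule domain_finite_measure)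
  have "AE x in lebesgue_on D. g x $ i - g' x $ i = 0" for i
  proof (rule fundamental_lemma_variations[OF D(1)])
    have "(\<lambda>x. g x $ i - g' x $ i) \<in> L2 (lebesgue_on D)"
      by (intro L2_diff L2_vec_nth g)
    from integrable_L2_mult_bounded[OF this, of "\<lambda>_. 1" 1]
    show "integrable (lebesgue_on D) (\<lambda>x. g x $ i - g' x $ i)" by simp
    fix \<theta> assume t: "test_function D \<theta>"
    have "(\<integral>x. g x $ i * \<theta> x \<partial>lebesgue_on D) = (\<integral>x. g' x $ i * \<theta> x \<partial>lebesgue_on D)"
      using w t by (simp add: has_weak_gradient_def)
    then show "(\<integral>x. (g x $ i - g' x $ i) * \<theta> x \<partial>lebesgue_on D) = 0"
      using integrable_L2_test_function[OF L2_vec_nth[OF g(1), of i] t]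
        integrable_L2_test_function[OF L2_vec_nth[OF g(2), of i] t]
      by (simp add: left_diff_distrib)
  qed
  then have "AE x in lebesgue_on D. \<forall>i\<in>UNIV. g x $ i - g' x $ i = 0"
    by (subst AE_ball_countable) (auto simp: countable_finite)
  then show ?thesis by eventually_elim (auto simp: vec_eq_iff)
qed

lemma has_weak_gradient_diff:
  assumes v: "v \<in> L2 (lebesgue_on D)" "w \<in> L2 (lebesgue_on D)"
    and g: "g \<in> L2 (lebesgue_on D)" "h \<in> L2 (lebesgue_on D)"
    and "has_weak_gradient D v g" "has_weak_gradient D w h"
  shows "has_weak_gradient D (\<lambda>x. v x - w x) (\<lambda>x. g x - h x)"
  unfolding has_weak_gradient_def
proof (intro allI impI)
  fix \<theta> i assume t: "test_function D \<theta>"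
  show "(\<integral>x. (v x - w x) * partial i \<theta> x \<partial>lebesgue_on D) =
       - (\<integral>x. (g x - h x) $ i * \<theta> x \<partial>lebesgue_on D)"
    using assms(5,6) t integrable_L2_test_function[OF v(1) test_function_partial[OF t, of i]]
      integrable_L2_test_function[OF v(2) test_function_partial[OF t, of i]]
      integrable_L2_test_function[OF L2_vec_nth[OF g(1)] t]
      integrable_L2_test_function[OF L2_vec_nth[OF g(2)] t]
    by (simp add: has_weak_gradient_def left_diff_distrib)
qed

lemma weak_gradient_H1:
  assumes "v \<in> H1 D"
  shows "weak_gradient D v \<in> L2 (lebesgue_on D)" "has_weak_gradient D v (weak_gradient D v)"
proof -
  have "\<exists>g. g \<in> L2 (lebesgue_on D) \<and> has_weak_gradient D v g" using assms by (auto simp: H1_def)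
  from someI_ex[OF this]
  show "weak_gradient D v \<in> L2 (lebesgue_on D)" "has_weak_gradient D v (weak_gradient D v)"
    by (auto simp: weak_gradient_def)
qed

text \<open>The chosen gradient of a difference need not be the difference of the chosen gradients,
  but both are weak gradients of the same function and hence agree almost everywhere.\<close>

lemma weak_gradient_diff:
  assumes "v \<in> H1 D" "w \<in> H1 D"
  shows "(\<lambda>x. v x - w x) \<in> H1 D"
    "AE x in lebesgue_on D. weak_gradient D (\<lambda>x. v x - w x) x = weak_gradient D v x - weak_gradient D w x"
proof -
  have L: "v \<in> L2 (lebesgue_on D)" "w \<in> L2 (lebesgue_on D)" using assms by (auto simp: H1_def)
  note g = weak_gradient_H1[OF assms(1)] weak_gradient_H1[OF assms(2)]
  have d: "has_weak_gradient D (\<lambda>x. v x - w x) (\<lambda>x. weak_gradient D v x - weak_gradient D w x)"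
    by (rule has_weak_gradient_diff) (use L g in auto)
  have dL: "(\<lambda>x. weak_gradient D v x - weak_gradient D w x) \<in> L2 (lebesgue_on D)"
    by (rule L2_diff) (use g in auto)
  show H: "(\<lambda>x. v x - w x) \<in> H1 D" using d dL L2_diff[OF L] by (auto simp: H1_def)
  show "AE x in lebesgue_on D. weak_gradient D (\<lambda>x. v x - w x) x = weak_gradient D v x - weak_gradient D w x"
    by (rule has_weak_gradient_unique[OF _ dL _ d]) (use weak_gradient_H1[OF H] in auto)
qed

end

section \<open>Test functions belong to the Sobolev space\<close>

lemma test_function_diff:
  assumes "test_function D f" "test_function D g"
  shows "test_function D (\<lambda>x. f x - g x)"
proof (rule test_functionI)
  show "{x. f x - g x \<noteq> 0} \<subseteq> closure {x. f x \<noteq> 0} \<union> closure {x. g x \<noteq> 0}"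
  proof
    fix x assume "x \<in> {x. f x - g x \<noteq> 0}"
    then have "x \<in> {x. f x \<noteq> 0} \<or> x \<in> {x. g x \<noteq> 0}" by auto
    then show "x \<in> closure {x. f x \<noteq> 0} \<union> closure {x. g x \<noteq> 0}"
      using closure_subset[of "{x. f x \<noteq> 0}"] closure_subset[of "{x. g x \<noteq> 0}"] by blast
  qed
qed (use assms in \<open>auto simp: test_function_def compactly_supported_def intro!: C_k_diff\<close>)

lemma test_function_mult:
  assumes "test_function D f" "test_function D g"
  shows "test_function D (\<lambda>x. f x * g x)"
proof (rule test_functionI)
  show "{x. f x * g x \<noteq> 0} \<subseteq> closure {x. f x \<noteq> 0}"
    using closure_subset[of "{x. f x \<noteq> 0}"] by auto
qed (use assms in \<open>auto simp: test_function_def compactly_supported_def intro!: C_k_mult\<close>)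

text \<open>Translation invariance makes the integrals of the difference quotients vanish.\<close>

lemma integral_partial_eq_0:
  fixes F :: "real^'d \<Rightarrow> real"
  assumes F: "test_function D F"
  shows "(\<integral>x. partial i F x \<partial>lborel) = 0"
proof -
  let ?e = "axis i (1::real) :: real^'d"
  define P where "P = partial i F"
  obtain B where B: "B \<ge> 0" "\<And>x. \<bar>P x\<bar> \<le> B"
    using test_function_bounded[OF test_function_partial[OF F, of i]] by (auto simp: P_def)
  have cF: "continuous_on UNIV F" and cP: "continuous_on UNIV P"
    using test_function_D(1)[OF F] test_function_D(1)[OF test_function_partial[OF F]] by (auto simp: P_def)
  have mF[measurable]: "F \<in> borel_measurable borel" "P \<in> borel_measurable borel"
    using cF cP by (auto intro: borel_measurable_continuous_onI)
  obtain R where R: "\<And>x. F x \<noteq> 0 \<Longrightarrow> norm x \<le> R"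
  proof -
    have "bounded (closure {x. F x \<noteq> 0})"
      using F by (auto simp: test_function_def compactly_supported_def compact_imp_bounded)
    then show ?thesis using closure_subset[of "{x. F x \<noteq> 0}"] that by (auto simp: bounded_iff)
  qed
  have deriv: "((\<lambda>s. F (x + s *\<^sub>R ?e)) has_real_derivative P (x + s *\<^sub>R ?e)) (at s)" for x s
  proof -
    have d: "(F has_derivative frechet_derivative F (at (x + s *\<^sub>R ?e))) (at (x + s *\<^sub>R ?e))"
      using test_function_D(2)[OF F] by (simp add: frechet_derivative_works)
    have "((\<lambda>s. x + s *\<^sub>R ?e) has_derivative (\<lambda>h. h *\<^sub>R ?e)) (at s)"
      by (auto intro!: derivative_eq_intros)
    from diff_chain_at[OF this d]
    have "((\<lambda>s. F (x + s *\<^sub>R ?e)) has_derivative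
        (\<lambda>h. frechet_derivative F (at (x + s *\<^sub>R ?e)) (h *\<^sub>R ?e))) (at s)"
      by (simp add: o_def)
    moreover have "frechet_derivative F (at (x + s *\<^sub>R ?e)) (h *\<^sub>R ?e) = P (x + s *\<^sub>R ?e) * h" for h
      using linear_cmul[OF linear_frechet_derivative[OF test_function_D(2)[OF F]]]
      by (simp add: P_def)
    ultimately show ?thesis by (simp add: has_field_derivative_def)
  qed
  define q where "q n x = (F (x + (1 / real (Suc n)) *\<^sub>R ?e) - F x) * real (Suc n)" for n x
  have [measurable]: "q n \<in> borel_measurable borel" for n
    unfolding q_def by (intro borel_measurable_continuous_onI continuous_intros
      continuous_on_compose2[OF cF]) auto
  \<comment> \<open>Steps have length at most 1, so beyond radius \<bar>R\<bar> + 1 both values of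
    \<open>F\<close> are 0; inside, the mean value theorem bounds the quotient by the bound of the
    derivative. This gives one integrable majorant for all n.\<close>
  have qB: "\<bar>q n x\<bar> \<le> B * indicator (cball 0 (\<bar>R\<bar> + 1)) x" for n x
  proof (cases "norm x \<le> \<bar>R\<bar> + 1")
    case True
    let ?h = "1 / real (Suc n)"
    obtain z where "F (x + ?h *\<^sub>R ?e) - F (x + 0 *\<^sub>R ?e) = (?h - 0) * P (x + z *\<^sub>R ?e)"
      using MVT2[of 0 ?h "\<lambda>s. F (x + s *\<^sub>R ?e)" "\<lambda>s. P (x + s *\<^sub>R ?e)"] deriv by auto
    then have "q n x = P (x + z *\<^sub>R ?e)" by (simp add: q_def)
    then show ?thesis using B True by auto
  next
    case False
    have "norm (x + (1 / real (Suc n)) *\<^sub>R ?e) \<ge> norm x - norm ((1 / real (Suc n)) *\<^sub>R ?e)"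
      using norm_diff_ineq by blast
    moreover have "norm ((1 / real (Suc n)) *\<^sub>R ?e) \<le> 1" using norm_Basis[of ?e] by (simp add: axis_in_Basis_iff)
    ultimately have "\<not> norm (x + (1 / real (Suc n)) *\<^sub>R ?e) \<le> R" using False by linarith
    moreover have "\<not> norm x \<le> R" using False by linarith
    ultimately have "F (x + (1 / real (Suc n)) *\<^sub>R ?e) = 0" "F x = 0" using R by blast+
    then show ?thesis using False by (simp add: q_def)
  qed
  have iB: "integrable lborel (\<lambda>x. B * indicator (cball 0 r) x :: real)" for r :: real and B
    by (intro integrable_mult_right integrable_real_indicator emeasure_bounded_finite) auto
  have iF: "integrable lborel F"
  proof -
    obtain C where C: "C \<ge> 0" "\<And>x. \<bar>F x\<bar> \<le> C" using test_function_bounded[OF F] by blast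
    have "AE x in lborel. norm (F x) \<le> norm (C * indicator (cball 0 R) x)"
      using C R by (auto simp: indicator_def)
    then show ?thesis by (rule Bochner_Integration.integrable_bound[OF iB, rotated]) simp
  qed
  have q0: "(\<integral>x. q n x \<partial>lborel) = 0" for n
  proof -
    let ?c = "(1 / real (Suc n)) *\<^sub>R ?e"
    have "integrable (distr lborel borel ((+) ?c)) F" using iF by (simp only: lborel_distr_plus)
    then have i: "integrable lborel (\<lambda>x. F (x + ?c))" by (simp add: integrable_distr_eq add.commute)
    have "(\<integral>x. F x \<partial>lborel) = (\<integral>x. F x \<partial>distr lborel borel ((+) ?c))"
      by (simp only: lborel_distr_plus)
    also have "\<dots> = (\<integral>x. F (x + ?c) \<partial>lborel)" by (subst integral_distr) (auto simp: add.commute)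
    finally show ?thesis using i iF unfolding q_def by simp
  qed
  have "(\<lambda>n. \<integral>x. q n x \<partial>lborel) \<longlonglongrightarrow> (\<integral>x. P x \<partial>lborel)"
  proof (rule integral_dominated_convergence[where w = "\<lambda>x. B * indicator (cball 0 (\<bar>R\<bar> + 1)) x"])
    show "AE x in lborel. (\<lambda>n. q n x) \<longlonglongrightarrow> P x"
    proof (rule AE_I2)
      fix x
      have "((\<lambda>h. (F (x + (0 + h) *\<^sub>R ?e) - F (x + 0 *\<^sub>R ?e)) / h) \<longlongrightarrow> P (x + 0 *\<^sub>R ?e)) (at 0)"
        using deriv[of x 0] by (simp only: DERIV_def)
      moreover have "filterlim (\<lambda>n. 1 / real (Suc n)) (at 0) sequentially"
        by (intro filterlim_atI LIMSEQ_Suc lim_1_over_n) auto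
      ultimately have "(\<lambda>n. (F (x + (0 + 1 / real (Suc n)) *\<^sub>R ?e) - F (x + 0 *\<^sub>R ?e)) / (1 / real (Suc n)))
          \<longlonglongrightarrow> P (x + 0 *\<^sub>R ?e)"
        by (rule filterlim_compose)
      then show "(\<lambda>n. q n x) \<longlonglongrightarrow> P x" by (simp add: q_def)
    qed
  qed (use qB iB in auto)
  then have "(\<lambda>n::nat. 0::real) \<longlonglongrightarrow> (\<integral>x. P x \<partial>lborel)" by (simp add: q0)
  then show ?thesis unfolding P_def using LIMSEQ_unique tendsto_const by blast
qed

lemma integral_lebesgue_on_supported:
  fixes f :: "real^'d \<Rightarrow> real"
  assumes "D \<in> sets lebesgue" "continuous_on UNIV f" "\<And>x. x \<notin> D \<Longrightarrow> f x = 0"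
  shows "(\<integral>x. f x \<partial>lebesgue_on D) = (\<integral>x. f x \<partial>lborel)"
proof -
  have "(\<integral>x. f x \<partial>lebesgue_on D) = (\<integral>x. (if x \<in> D then f x else 0) \<partial>lebesgue)"
    by (rule Lebesgue_Measure.integral_restrict_UNIV[OF assms(1), symmetric])
  also have "\<dots> = (\<integral>x. f x \<partial>lebesgue)"
    using assms(3) by (intro Bochner_Integration.integral_cong) auto
  also have "\<dots> = (\<integral>x. f x \<partial>lborel)"
    using assms(2) by (intro integral_completion) (simp add: borel_measurable_continuous_onI)
  finally show ?thesis .
qed

text \<open>Integration by parts: the derivative of the product of the two test functions integrates
  to 0, and the product rule splits it into the two terms.\<close>

lemma test_function_weak_gradient:
  fixes D :: "(real^'d) set"
  assumes D: "open D" "bounded D" and t: "test_function D \<theta>"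
  shows "has_weak_gradient D \<theta> (\<lambda>x. \<chi> i. partial i \<theta> x)"
  unfolding has_weak_gradient_def
proof (intro allI impI)
  fix \<eta> :: "real^'d \<Rightarrow> real" and i assume e: "test_function D \<eta>"
  have L: "\<theta> \<in> L2 (lebesgue_on D)" "\<eta> \<in> L2 (lebesgue_on D)"
    using bounded_measurable_L2[OF D test_function_measurable[OF D]] test_function_bounded t e
    by (metis real_norm_def)+
  have p: "partial i (\<lambda>x. \<theta> x * \<eta> x) x = \<theta> x * partial i \<eta> x + partial i \<theta> x * \<eta> x" for x
  proof -
    have "((\<lambda>x. \<theta> x * \<eta> x) has_derivative
      (\<lambda>h. \<theta> x * frechet_derivative \<eta> (at x) h + frechet_derivative \<theta> (at x) h * \<eta> x)) (at x)"
      using test_function_D(2)[OF t] test_function_D(2)[OF e]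
      by (auto intro!: has_derivative_mult simp: frechet_derivative_works)
    from frechet_derivative_at[OF this, symmetric] show ?thesis by simp
  qed
  have z: "partial i (\<lambda>x. \<theta> x * \<eta> x) x = 0" if "x \<notin> D" for x
  proof -
    have "x \<notin> closure {x. \<theta> x * \<eta> x \<noteq> 0}"
      using that test_function_mult[OF t e] unfolding test_function_def by blast
    from frechet_derivative_outside_support[OF this] show ?thesis by simp
  qed
  have "(\<integral>x. \<theta> x * partial i \<eta> x + partial i \<theta> x * \<eta> x \<partial>lebesgue_on D) = (\<integral>x. partial i (\<lambda>x. \<theta> x * \<eta> x) x \<partial>lborel)"
    unfolding p[symmetric]
    by (rule integral_lebesgue_on_supported[OF domain_sets[OF D]])
      (use z test_function_D(1)[OF test_function_partial[OF test_function_mult[OF t e]]] in auto)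
  also have "\<dots> = 0" by (rule integral_partial_eq_0[OF test_function_mult[OF t e]])
  also have "(\<integral>x. \<theta> x * partial i \<eta> x + partial i \<theta> x * \<eta> x \<partial>lebesgue_on D) =
      (\<integral>x. \<theta> x * partial i \<eta> x \<partial>lebesgue_on D) + (\<integral>x. partial i \<theta> x * \<eta> x \<partial>lebesgue_on D)"
    using integrable_L2_test_function[OF D L(1) test_function_partial[OF e, of i]]
      integrable_L2_test_function[OF D L(2) test_function_partial[OF t, of i]]
    by (subst Bochner_Integration.integral_add) (auto simp: mult.commute)
  finally show "(\<integral>x. \<theta> x * partial i \<eta> x \<partial>lebesgue_on D) =
      - (\<integral>x. (\<chi> i. partial i \<theta> x) $ i * \<eta> x \<partial>lebesgue_on D)"
    by simp
qed

text \<open>The approximants in the definition of \<open>H10\<close> have to lie in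
  \<open>H1\<close> before \<open>weak_gradient\<close> of a difference with one of them can be
  controlled.\<close>

lemma test_function_H1:
  fixes D :: "(real^'d) set"
  assumes D: "open D" "bounded D" and t: "test_function D \<theta>"
  shows "\<theta> \<in> H1 D"
proof -
  have L: "\<theta> \<in> L2 (lebesgue_on D)"
    using bounded_measurable_L2[OF D test_function_measurable[OF D t]] test_function_bounded[OF t]
    by (metis real_norm_def)
  let ?g = "\<lambda>x::real^'d. \<chi> i. partial i \<theta> x"
  obtain B where B: "\<And>i x. \<bar>partial i \<theta> x\<bar> \<le> B i"
  proof -
    have "\<forall>i. \<exists>B. \<forall>x. \<bar>partial i \<theta> x\<bar> \<le> B"
      using test_function_bounded[OF test_function_partial[OF t]] by meson
    then show ?thesis using that by (auto simp: choice_iff)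
  qed
  have "?g \<in> L2 (lebesgue_on D)"
  proof (rule bounded_measurable_L2[OF D])
    have "continuous_on UNIV ?g"
      using test_function_D(1)[OF test_function_partial[OF t]] by (intro continuous_on_vec_lambda) auto
    then show "?g \<in> borel_measurable (lebesgue_on D)"
      by (intro measurable_restrict_space1 measurable_completion)
        (simp add: borel_measurable_continuous_onI)
    show "norm (?g x) \<le> (\<Sum>i\<in>UNIV. B i)" for x
    proof -
      have "norm (?g x) \<le> (\<Sum>i\<in>UNIV. \<bar>?g x $ i\<bar>)" by (rule norm_le_l1_cart)
      also have "\<dots> \<le> (\<Sum>i\<in>UNIV. B i)" using B by (intro sum_mono) simp
      finally show ?thesis .
    qed
  qed
  then show ?thesis using L test_function_weak_gradient[OF D t] by (auto simp: H1_def)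
qed

section \<open>The norm of L2\<close>

lemma L2_norm_sq: "(L2_norm M f)\<^sup>2 = (\<integral>x. (norm (f x))\<^sup>2 \<partial>M)"
  by (simp add: L2_norm_def)

lemma L2_norm_nonneg [simp]: "0 \<le> L2_norm M f"
  by (simp add: L2_norm_def)

lemma L2_norm_cong_AE:
  fixes f g :: "'a \<Rightarrow> 'b::euclidean_space"
  assumes "f \<in> borel_measurable M" "g \<in> borel_measurable M" "AE x in M. f x = g x"
  shows "L2_norm M f = L2_norm M g"
proof -
  have [measurable]: "f \<in> borel_measurable M" "g \<in> borel_measurable M" using assms by auto
  have "(\<integral>x. (norm (f x))\<^sup>2 \<partial>M) = (\<integral>x. (norm (g x))\<^sup>2 \<partial>M)"
    by (rule integral_cong_AE) (use assms(3) in auto)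
  then show ?thesis by (simp add: L2_norm_def)
qed

text \<open>Minkowski by weighted Young: the weights b / a and a / b are optimal when a and b are
  the two norms. The added \<epsilon> / 2 keeps both positive, so that a vanishing norm is no
  special case.\<close>

lemma L2_norm_triangle_add:
  fixes f g :: "'a \<Rightarrow> 'b::euclidean_space"
  assumes "f \<in> L2 M" "g \<in> L2 M"
  shows "L2_norm M (\<lambda>x. f x + g x) \<le> L2_norm M f + L2_norm M g"
proof (rule field_le_epsilon)
  fix e :: real assume e: "e > 0"
  define a where "a = L2_norm M f + e / 2"
  define b where "b = L2_norm M g + e / 2"
  have ab: "a > 0" "b > 0" using e by (auto simp: a_def b_def intro: add_nonneg_pos)
  have i: "integrable M (\<lambda>x. (norm (f x))\<^sup>2)" "integrable M (\<lambda>x. (norm (g x))\<^sup>2)"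
    "integrable M (\<lambda>x. (norm (f x + g x))\<^sup>2)"
    using assms L2_add[OF assms] by (auto simp: L2_def)
  have pw: "(norm (f x + g x))\<^sup>2 \<le> (1 + b / a) * (norm (f x))\<^sup>2 + (1 + a / b) * (norm (g x))\<^sup>2" for x
  proof -
    let ?u = "norm (f x)" and ?v = "norm (g x)"
    have "(norm (f x + g x))\<^sup>2 \<le> (?u + ?v)\<^sup>2"
      by (intro power_mono norm_triangle_ineq) simp
    also have "\<dots> \<le> (1 + b / a) * ?u\<^sup>2 + (1 + a / b) * ?v\<^sup>2"
    proof -
      have "0 \<le> (b * ?u - a * ?v)\<^sup>2 / (a * b)" using ab by simp
      also have "\<dots> = (b / a) * ?u\<^sup>2 + (a / b) * ?v\<^sup>2 - 2 * ?u * ?v"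
        using ab by (simp add: field_simps power2_eq_square)
      finally show ?thesis by (simp add: power2_sum algebra_simps)
    qed
    finally show ?thesis .
  qed
  have "(L2_norm M (\<lambda>x. f x + g x))\<^sup>2 \<le> (\<integral>x. (1 + b / a) * (norm (f x))\<^sup>2 + (1 + a / b) * (norm (g x))\<^sup>2 \<partial>M)"
    unfolding L2_norm_sq using i pw by (intro integral_mono) auto
  also have "\<dots> = (1 + b / a) * (L2_norm M f)\<^sup>2 + (1 + a / b) * (L2_norm M g)\<^sup>2"
    using i by (simp add: L2_norm_sq)
  also have "\<dots> \<le> (1 + b / a) * a\<^sup>2 + (1 + a / b) * b\<^sup>2"
    using ab e by (intro add_mono mult_left_mono power_mono) (auto simp: a_def b_def)
  also have "\<dots> = (a + b)\<^sup>2" using ab by (simp add: field_simps power2_eq_square)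
  finally have "L2_norm M (\<lambda>x. f x + g x) \<le> a + b" using ab by (auto intro: power2_le_imp_le)
  then show "L2_norm M (\<lambda>x. f x + g x) \<le> L2_norm M f + L2_norm M g + e" by (simp add: a_def b_def)
qed

lemma L2_norm_triangle_diff:
  fixes f g :: "'a \<Rightarrow> 'b::euclidean_space"
  assumes "f \<in> L2 M" "g \<in> L2 M"
  shows "L2_norm M (\<lambda>x. f x - g x) \<le> L2_norm M f + L2_norm M g"
proof -
  have "L2_norm M (\<lambda>x. (- 1) *\<^sub>R g x) = L2_norm M g" by (simp add: L2_norm_def)
  then show ?thesis using L2_norm_triangle_add[OF assms(1) L2_scaleR[OF assms(2), of "-1"]] by simp
qed

section \<open>The elliptic problem\<close>

lemma H10_D: "v \<in> H10 D \<Longrightarrow> v \<in> H1 D"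
  by (simp add: H10_def)

lemma V_norm_nonneg [simp]: "0 \<le> V_norm D v"
  by (simp add: V_norm_def)

lemma H1_norm_ge: "L2_norm (lebesgue_on D) v \<le> H1_norm D v" "V_norm D v \<le> H1_norm D v"
  by (auto simp: H1_norm_def V_norm_def intro!: real_le_rsqrt)

context
  fixes D :: "(real^'d) set"
  assumes D: "open D" "bounded D"
begin

text \<open>Passing once from the chosen gradient of a difference to the difference of the gradients
  reduces the inequalities for \<open>V_norm\<close> to those for \<open>L2_norm\<close>.\<close>

lemma V_norm_diff_eq:
  assumes "v \<in> H1 D" "w \<in> H1 D"
  shows "V_norm D (\<lambda>x. v x - w x) =
    L2_norm (lebesgue_on D) (\<lambda>x. weak_gradient D v x - weak_gradient D w x)"
  unfolding V_norm_def
proof (rule L2_norm_cong_AE[OF _ _ weak_gradient_diff(2)[OF D assms]])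
  have L: "weak_gradient D u \<in> L2 (lebesgue_on D)" if "u \<in> H1 D" for u
    using weak_gradient_H1(1)[OF D that] .
  show "weak_gradient D (\<lambda>x. v x - w x) \<in> borel_measurable (lebesgue_on D)"
    using L[OF weak_gradient_diff(1)[OF D assms]] by (simp add: L2_def)
  show "(\<lambda>x. weak_gradient D v x - weak_gradient D w x) \<in> borel_measurable (lebesgue_on D)"
    using L2_diff[OF L[OF assms(1)] L[OF assms(2)]] by (simp add: L2_def)
qed

lemma V_norm_triangle_diff:
  assumes "v \<in> H1 D" "w \<in> H1 D"
  shows "V_norm D (\<lambda>x. v x - w x) \<le> V_norm D v + V_norm D w"
  unfolding V_norm_diff_eq[OF assms] unfolding V_norm_def
  by (intro L2_norm_triangle_diff weak_gradient_H1[OF D] assms)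

lemma V_norm_minus_commute:
  assumes "v \<in> H1 D" "w \<in> H1 D"
  shows "V_norm D (\<lambda>x. v x - w x) = V_norm D (\<lambda>x. w x - v x)"
  unfolding V_norm_diff_eq[OF assms] V_norm_diff_eq[OF assms(2,1)] L2_norm_def
  by (simp only: norm_minus_commute)

text \<open>The reverse triangle inequality will carry norms through the limit of simple
  approximations.\<close>

lemma V_norm_abs_diff_le:
  assumes "v \<in> H1 D" "w \<in> H1 D"
  shows "\<bar>V_norm D v - V_norm D w\<bar> \<le> V_norm D (\<lambda>x. v x - w x)"
proof -
  have *: "V_norm D v \<le> V_norm D w + V_norm D (\<lambda>x. v x - w x)"
    if vw: "v \<in> H1 D" "w \<in> H1 D" for v w
  proof -
    note L = weak_gradient_H1(1)[OF D vw(1)] weak_gradient_H1(1)[OF D vw(2)]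
    have "V_norm D v = L2_norm (lebesgue_on D)
        (\<lambda>x. weak_gradient D w x + (weak_gradient D v x - weak_gradient D w x))"
      by (simp add: V_norm_def)
    also have "\<dots> \<le> L2_norm (lebesgue_on D) (weak_gradient D w) +
        L2_norm (lebesgue_on D) (\<lambda>x. weak_gradient D v x - weak_gradient D w x)"
      by (intro L2_norm_triangle_add L2_diff L)
    finally show ?thesis unfolding V_norm_diff_eq[OF vw] by (simp add: V_norm_def)
  qed
  show ?thesis using *[OF assms] *[OF assms(2,1)] V_norm_minus_commute[OF assms] by linarith
qed

text \<open>The factor 2 comes from bounding the root of a sum of squares by the sum of the two
  norms. It is harmless, as the bound serves only to show convergence to 0.\<close>

lemma H1_norm_diff_le:
  assumes "v \<in> H1 D" "w \<in> H1 D"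
  shows "H1_norm D (\<lambda>x. v x - w x) \<le> 2 * H1_norm D v + 2 * H1_norm D w"
proof -
  let ?N = "L2_norm (lebesgue_on D)"
  have "v \<in> L2 (lebesgue_on D)" "w \<in> L2 (lebesgue_on D)" using assms by (auto simp: H1_def)
  then have "?N (\<lambda>x. v x - w x) \<le> ?N v + ?N w" by (rule L2_norm_triangle_diff)
  moreover have "H1_norm D (\<lambda>x. v x - w x) \<le> ?N (\<lambda>x. v x - w x) + V_norm D (\<lambda>x. v x - w x)"
    using sqrt_sum_squares_le_sum[of "?N (\<lambda>x. v x - w x)" "V_norm D (\<lambda>x. v x - w x)"]
    by (simp add: H1_norm_def V_norm_def)
  ultimately show ?thesis
    using V_norm_triangle_diff[OF assms] H1_norm_ge[of D v] H1_norm_ge[of D w] by linarith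
qed

text \<open>The difference of two solutions has to be admissible as a test function.\<close>

lemma H10_diff:
  assumes "v \<in> H10 D" "w \<in> H10 D"
  shows "(\<lambda>x. v x - w x) \<in> H10 D"
proof -
  obtain \<theta> where t: "\<And>n::nat. test_function D (\<theta> n)" "(\<lambda>n. H1_norm D (\<lambda>x. v x - \<theta> n x)) \<longlonglongrightarrow> 0"
    using assms(1) by (auto simp: H10_def)
  obtain \<eta> where e: "\<And>n::nat. test_function D (\<eta> n)" "(\<lambda>n. H1_norm D (\<lambda>x. w x - \<eta> n x)) \<longlonglongrightarrow> 0"
    using assms(2) by (auto simp: H10_def)
  have "H1_norm D (\<lambda>x. (v x - w x) - (\<theta> n x - \<eta> n x)) \<le>
      2 * H1_norm D (\<lambda>x. v x - \<theta> n x) + 2 * H1_norm D (\<lambda>x. w x - \<eta> n x)" for n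
  proof -
    have "(\<lambda>x. v x - \<theta> n x) \<in> H1 D" "(\<lambda>x. w x - \<eta> n x) \<in> H1 D"
      using assms t(1) e(1) by (intro weak_gradient_diff(1)[OF D] test_function_H1[OF D] H10_D; simp)+
    from H1_norm_diff_le[OF this] show ?thesis by (simp add: algebra_simps)
  qed
  moreover have "0 \<le> H1_norm D f" for f by (simp add: H1_norm_def)
  ultimately have le: "\<forall>\<^sub>F n in sequentially. norm (H1_norm D (\<lambda>x. (v x - w x) - (\<theta> n x - \<eta> n x))) \<le>
      2 * H1_norm D (\<lambda>x. v x - \<theta> n x) + 2 * H1_norm D (\<lambda>x. w x - \<eta> n x)"
    by (intro always_eventually allI) simp
  have "(\<lambda>n. 2 * H1_norm D (\<lambda>x. v x - \<theta> n x) + 2 * H1_norm D (\<lambda>x. w x - \<eta> n x)) \<longlonglongrightarrow> 2 * 0 + 2 * 0"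
    by (intro tendsto_intros t e)
  then have "(\<lambda>n. H1_norm D (\<lambda>x. (v x - w x) - (\<theta> n x - \<eta> n x))) \<longlonglongrightarrow> 0"
    by (intro Lim_null_comparison[OF le]) simp
  moreover have "test_function D (\<lambda>x. \<theta> n x - \<eta> n x)" for n by (intro test_function_diff t e)
  moreover have "(\<lambda>x. v x - w x) \<in> H1 D" using assms by (intro weak_gradient_diff(1)[OF D] H10_D)
  ultimately show ?thesis unfolding H10_def by (auto intro!: exI[of _ "\<lambda>n x. \<theta> n x - \<eta> n x"])
qed

text \<open>The energy estimate: testing with the solution itself bounds m times the square of its
  norm by C times the norm. One division follows, unless the norm is 0.\<close>

lemma weak_solution_bound:
  assumes u: "weak_solution D a f u"
    and a: "AE x in lebesgue_on D. m \<le> a x" and m: "m > 0"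
    and C: "C \<ge> 0" and f: "\<And>v. v \<in> H10 D \<Longrightarrow> \<bar>f v\<bar> \<le> C * V_norm D v"
  shows "m * V_norm D u \<le> C"
proof -
  let ?g = "weak_gradient D u" and ?M = "lebesgue_on D"
  have uH: "u \<in> H10 D" using u by (simp add: weak_solution_def)
  have b: "has_bochner_integral ?M (\<lambda>x. a x * (?g x \<bullet> ?g x)) (f u)"
    using u uH by (simp add: weak_solution_def)
  have i: "integrable ?M (\<lambda>x. (norm (?g x))\<^sup>2)"
    using weak_gradient_H1(1)[OF D H10_D[OF uH]] by (simp add: L2_def)
  have "m * (V_norm D u)\<^sup>2 = (\<integral>x. m * (norm (?g x))\<^sup>2 \<partial>?M)"
    by (simp add: V_norm_def L2_norm_sq)
  also have "\<dots> \<le> (\<integral>x. a x * (?g x \<bullet> ?g x) \<partial>?M)"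
  proof (rule integral_mono_AE)
    show "AE x in ?M. m * (norm (?g x))\<^sup>2 \<le> a x * (?g x \<bullet> ?g x)"
      using a by eventually_elim (simp add: power2_norm_eq_inner mult_right_mono)
  qed (use i b in \<open>auto simp: has_bochner_integral_iff\<close>)
  also have "\<dots> = f u" using b by (simp add: has_bochner_integral_iff)
  also have "\<dots> \<le> C * V_norm D u" using f[OF uH] by linarith
  finally have *: "(m * V_norm D u) * V_norm D u \<le> C * V_norm D u" by (simp add: power2_eq_square)
  show ?thesis
  proof (cases "V_norm D u = 0")
    case False
    then have "V_norm D u > 0" using V_norm_nonneg[of D u] by linarith
    with * show ?thesis by (rule mult_right_le_imp_le)
  qed (use C in simp)
qed

text \<open>Test the difference of the two equations with the difference of the solutions; the mixed term
  is absorbed by Young's inequality.\<close>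

lemma weak_solution_diff_le:
  assumes u: "weak_solution D a f u" and w: "weak_solution D b f w"
    and a: "AE x in lebesgue_on D. m \<le> a x" and b: "AE x in lebesgue_on D. m \<le> b x" and m: "m > 0"
    and ab: "AE x in lebesgue_on D. \<bar>a x - b x\<bar> \<le> e"
    and C: "C \<ge> 0" and f: "\<And>v. v \<in> H10 D \<Longrightarrow> \<bar>f v\<bar> \<le> C * V_norm D v"
    and e: "e \<ge> 0"
  shows "V_norm D (\<lambda>x. u x - w x) \<le> C * e / m\<^sup>2"
proof -
  let ?v = "\<lambda>x. u x - w x" and ?M = "lebesgue_on D"
  let ?gu = "weak_gradient D u" and ?gw = "weak_gradient D w" and ?gv = "weak_gradient D ?v"
  have uH: "u \<in> H10 D" and wH: "w \<in> H10 D" using u w by (auto simp: weak_solution_def)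
  have vH: "?v \<in> H10 D" by (rule H10_diff[OF uH wH])
  have 1: "has_bochner_integral ?M (\<lambda>x. a x * (?gu x \<bullet> ?gv x)) (f ?v)"
    using u vH by (simp add: weak_solution_def)
  have 2: "has_bochner_integral ?M (\<lambda>x. b x * (?gw x \<bullet> ?gv x)) (f ?v)"
    using w vH by (simp add: weak_solution_def)
  have z: "has_bochner_integral ?M (\<lambda>x. a x * (?gu x \<bullet> ?gv x) - b x * (?gw x \<bullet> ?gv x)) 0"
    using has_bochner_integral_diff[OF 1 2] by simp
  have iu: "integrable ?M (\<lambda>x. (norm (?gu x))\<^sup>2)" and iv: "integrable ?M (\<lambda>x. (norm (?gv x))\<^sup>2)"
    using weak_gradient_H1(1)[OF D H10_D[OF uH]] weak_gradient_H1(1)[OF D H10_D[OF vH]]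
    by (auto simp: L2_def)
  \<comment> \<open>The last bracket has integral 0, because both equations are tested with
    \<open>?v\<close>. Adding it to the two quadratic terms turns a pointwise inequality into the
    estimate without ever integrating the mixed term by itself. The weights are those of Young's
    inequality that spend exactly half of the coercive term.\<close>
  have "0 \<le> (\<integral>x. (e\<^sup>2 / (2 * m)) * (norm (?gu x))\<^sup>2 - (m / 2) * (norm (?gv x))\<^sup>2
      + (a x * (?gu x \<bullet> ?gv x) - b x * (?gw x \<bullet> ?gv x)) \<partial>?M)"
  proof (rule integral_nonneg_AE)
    show "AE x in ?M. 0 \<le> (e\<^sup>2 / (2 * m)) * (norm (?gu x))\<^sup>2 - (m / 2) * (norm (?gv x))\<^sup>2
      + (a x * (?gu x \<bullet> ?gv x) - b x * (?gw x \<bullet> ?gv x))"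
      using b ab weak_gradient_diff(2)[OF D H10_D[OF uH] H10_D[OF wH]]
    proof eventually_elim
      case (elim x)
      have eq: "a x * (?gu x \<bullet> ?gv x) - b x * (?gw x \<bullet> ?gv x) =
        (a x - b x) * (?gu x \<bullet> ?gv x) + b x * (norm (?gv x))\<^sup>2"
      proof -
        have gu: "?gu x = ?gw x + ?gv x" using elim(3) by simp
        show ?thesis unfolding power2_norm_eq_inner gu by (simp add: inner_add_left algebra_simps)
      qed
      have "\<bar>(a x - b x) * (?gu x \<bullet> ?gv x)\<bar> \<le> e * (norm (?gu x) * norm (?gv x))"
        unfolding abs_mult by (intro mult_mono elim Cauchy_Schwarz_ineq2) (use e in auto)
      also have "\<dots> \<le> (e\<^sup>2 / (2 * m)) * (norm (?gu x))\<^sup>2 + (m / 2) * (norm (?gv x))\<^sup>2"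
      proof -
        have "0 \<le> (e * norm (?gu x) - m * norm (?gv x))\<^sup>2 / (2 * m)" using m by simp
        also have "\<dots> = (e\<^sup>2 / (2 * m)) * (norm (?gu x))\<^sup>2 + (m / 2) * (norm (?gv x))\<^sup>2
            - e * (norm (?gu x) * norm (?gv x))"
          using m by (simp add: field_simps power2_eq_square)
        finally show ?thesis by simp
      qed
      finally have 1: "(a x - b x) * (?gu x \<bullet> ?gv x) \<ge>
        - ((e\<^sup>2 / (2 * m)) * (norm (?gu x))\<^sup>2 + (m / 2) * (norm (?gv x))\<^sup>2)" by linarith
      have "m * (norm (?gv x))\<^sup>2 \<le> b x * (norm (?gv x))\<^sup>2"
        using elim(1) by (intro mult_right_mono) auto
      then have 2: "(m / 2) * (norm (?gv x))\<^sup>2 + (m / 2) * (norm (?gv x))\<^sup>2 \<le> b x * (norm (?gv x))\<^sup>2"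
        by (simp add: field_simps)
      show ?case unfolding eq using 1 2 by linarith
    qed
  qed
  also have "\<dots> = (e\<^sup>2 / (2 * m)) * (V_norm D u)\<^sup>2 - (m / 2) * (V_norm D ?v)\<^sup>2"
    using iu iv z by (simp add: V_norm_def L2_norm_sq has_bochner_integral_iff)
  finally have "(m * V_norm D ?v)\<^sup>2 \<le> (e * V_norm D u)\<^sup>2"
    using m by (simp add: field_simps power2_eq_square)
  then have "m * V_norm D ?v \<le> e * V_norm D u"
    by (rule power2_le_imp_le) (use e in auto)
  then have "m * (m * V_norm D ?v) \<le> m * (e * V_norm D u)" using m by (intro mult_left_mono) auto
  also have "\<dots> = e * (m * V_norm D u)" by simp
  also have "\<dots> \<le> e * C"
    by (intro mult_left_mono weak_solution_bound[OF u a m C f] e)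
  finally show ?thesis using m by (simp add: field_simps power2_eq_square)
qed

end

section \<open>Wavelets\<close>

lemma card_vec_box:
  fixes A :: "'n::finite \<Rightarrow> 'b set"
  assumes "\<And>c. finite (A c)"
  shows "finite {m::'b^'n. \<forall>c. m $ c \<in> A c}"
    "card {m::'b^'n. \<forall>c. m $ c \<in> A c} \<le> (\<Prod>c\<in>UNIV. card (A c))"
proof -
  have sub: "{m::'b^'n. \<forall>c. m $ c \<in> A c} \<subseteq> vec_lambda ` (PiE UNIV A)"
  proof
    fix m :: "'b^'n" assume "m \<in> {m. \<forall>c. m $ c \<in> A c}"
    then have "vec_nth m \<in> PiE UNIV A" by auto
    then have "vec_lambda (vec_nth m) \<in> vec_lambda ` (PiE UNIV A)" by (rule imageI)
    then show "m \<in> vec_lambda ` (PiE UNIV A)" by simp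
  qed
  have fin: "finite (PiE UNIV A)" using assms by (intro finite_PiE) auto
  show "finite {m::'b^'n. \<forall>c. m $ c \<in> A c}" by (rule finite_subset[OF sub]) (use fin in simp)
  have "card {m::'b^'n. \<forall>c. m $ c \<in> A c} \<le> card (vec_lambda ` (PiE UNIV A) :: ('b^'n) set)"
    by (rule card_mono[OF _ sub]) (use fin in simp)
  also have "\<dots> \<le> card (PiE UNIV A)" by (rule card_image_le[OF fin])
  also have "\<dots> = (\<Prod>c\<in>UNIV. card (A c))" by (simp add: card_PiE)
  finally show "card {m::'b^'n. \<forall>c. m $ c \<in> A c} \<le> (\<Prod>c\<in>UNIV. card (A c))" .
qed

lemma K_set_finite: "finite (K_set j :: (int^'d) set)" "card (K_set j :: (int^'d) set) \<le> (2 ^ j) ^ CARD('d)"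
proof -
  have eq: "(K_set j :: (int^'d) set) = {m. \<forall>c. m $ c \<in> {0..<2 ^ j}}" by (auto simp: K_set_def)
  show "finite (K_set j :: (int^'d) set)" unfolding eq by (rule card_vec_box) simp
  have "card (K_set j :: (int^'d) set) \<le> (\<Prod>c\<in>(UNIV::'d set). card {0..<2 ^ j :: int})"
    unfolding eq by (rule card_vec_box) simp
  then show "card (K_set j :: (int^'d) set) \<le> (2 ^ j) ^ CARD('d)" by (simp add: nat_power_eq)
qed

lemma L_set_finite: "finite (L_set j :: (nat^'d) set)" "card (L_set j :: (nat^'d) set) \<le> 2 ^ CARD('d)"
proof -
  have sub: "(L_set j :: (nat^'d) set) \<subseteq> {m. \<forall>c. m $ c \<in> {0, 1}}" by (auto simp: L_set_def)
  have fin: "finite {m::nat^'d. \<forall>c. m $ c \<in> {0, 1}}" by (rule card_vec_box) simp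
  show "finite (L_set j :: (nat^'d) set)" by (rule finite_subset[OF sub fin])
  have "card (L_set j :: (nat^'d) set) \<le> card {m::nat^'d. \<forall>c. m $ c \<in> {0, 1}}"
    by (rule card_mono[OF fin sub])
  also have "\<dots> \<le> (\<Prod>c\<in>(UNIV::'d set). card {0, 1 :: nat})" by (rule card_vec_box) simp
  also have "\<dots> = 2 ^ CARD('d)" by (simp add: numeral_2_eq_2)
  finally show "card (L_set j :: (nat^'d) set) \<le> 2 ^ CARD('d)" .
qed

lemma C_alpha_continuous:
  assumes "C_alpha \<alpha> f" "\<alpha> \<ge> 1"
  shows "continuous_on UNIV f"
proof -
  have "nat \<lfloor>\<alpha>\<rfloor> \<ge> 1" using assms(2) by (simp add: le_nat_floor le_floor_iff)
  then obtain k where "nat \<lfloor>\<alpha>\<rfloor> = Suc k" by (cases "nat \<lfloor>\<alpha>\<rfloor>") auto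
  then have "\<And>x. f differentiable (at x)" using assms by (auto simp: C_alpha_def)
  then show ?thesis
    by (auto simp: continuous_on_eq_continuous_at intro: differentiable_imp_continuous_within)
qed

text \<open>One natural number serves for height and radius, since the radius will also count
  integer translates.\<close>

lemma compactly_supported_box:
  fixes f :: "real \<Rightarrow> real"
  assumes "continuous_on UNIV f" "compactly_supported f"
  obtains R :: nat where "\<And>x. \<bar>f x\<bar> \<le> real R" "\<And>x. f x \<noteq> 0 \<Longrightarrow> \<bar>x\<bar> \<le> real R"
proof -
  have "bounded (closure {x. f x \<noteq> 0})"
    using assms(2) by (auto simp: compactly_supported_def compact_imp_bounded)
  then obtain r where r: "\<And>x. f x \<noteq> 0 \<Longrightarrow> \<bar>x\<bar> \<le> r"
    using closure_subset[of "{x. f x \<noteq> 0}"] by (auto simp: bounded_iff)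
  obtain B where B: "\<And>x. \<bar>f x\<bar> \<le> B" using compactly_supported_bounded[OF assms] by blast
  obtain R :: nat where "max r B \<le> real R" using real_arch_simple by blast
  then have "r \<le> real R" "B \<le> real R" by simp_all
  then show ?thesis using that[of R] order_trans[OF B] order_trans[OF r] by blast
qed

section \<open>Counting the periodised wavelets that are active at a point\<close>

context
  fixes \<phi> \<psi> :: "real \<Rightarrow> real" and B :: real and R :: nat
  assumes cont: "continuous_on UNIV \<phi>" "continuous_on UNIV \<psi>"
    and bnd: "\<And>x. \<bar>\<phi> x\<bar> \<le> B" "\<And>x. \<bar>\<psi> x\<bar> \<le> B" "0 \<le> B"
    and supp: "\<And>x. \<phi> x \<noteq> 0 \<Longrightarrow> \<bar>x\<bar> \<le> real R" "\<And>x. \<psi> x \<noteq> 0 \<Longrightarrow> \<bar>x\<bar> \<le> real R"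
begin

lemma psi1_bound: "\<bar>psi1 \<phi> \<psi> j k l x\<bar> \<le> B"
  using bnd by (auto simp: psi1_def)

lemma psi1_support: "psi1 \<phi> \<psi> j k l x \<noteq> 0 \<Longrightarrow> \<bar>2 ^ j * x - of_int k\<bar> \<le> real R"
  using supp by (auto simp: psi1_def split: if_splits)

lemma psi_tensor_bound:
  "\<bar>psi_tensor \<phi> \<psi> (j, k, l) (x :: real^'d)\<bar> \<le> 2 powr (real CARD('d) * real j / 2) * B ^ CARD('d)"
proof -
  have "(\<Prod>i\<in>(UNIV::'d set). \<bar>psi1 \<phi> \<psi> j (k $ i) (l $ i) (x $ i)\<bar>) \<le> (\<Prod>i\<in>(UNIV::'d set). B)"
    by (intro prod_mono) (auto intro: psi1_bound)
  then show ?thesis by (simp add: psi_tensor_def abs_mult abs_prod mult_left_mono)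
qed

lemma psi_tensor_support:
  "psi_tensor \<phi> \<psi> (j, k, l) (x :: real^'d) \<noteq> 0 \<Longrightarrow> \<bar>2 ^ j * x $ c - of_int (k $ c)\<bar> \<le> real R"
  by (rule psi1_support[of _ _ "l $ c"]) (auto simp: psi_tensor_def prod_zero_iff)

lemma continuous_psi_tensor: "continuous_on UNIV (psi_tensor \<phi> \<psi> (j, k, l) :: real^'d \<Rightarrow> real)"
proof -
  have "continuous_on UNIV (\<lambda>x::real^'d. psi1 \<phi> \<psi> j (k $ i) (l $ i) (x $ i))" for i
    unfolding psi1_def
    by (cases "l $ i = 0")
      (auto intro!: continuous_on_compose2[OF cont(1)] continuous_on_compose2[OF cont(2)] continuous_intros)
  then show ?thesis unfolding psi_tensor_def by (auto intro!: continuous_intros)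
qed

text \<open>Indices of those translates of level j on the whole space whose supports may contain x;
  their number is bounded independently of j and x.\<close>

definition active :: "nat \<Rightarrow> real^'d \<Rightarrow> (int^'d) set" where
  "active j x = {m. \<forall>c. \<bar>2 ^ j * x $ c - of_int (m $ c)\<bar> \<le> real R}"

lemma active_finite:
  "finite (active j (x :: real^'d))" "card (active j (x :: real^'d)) \<le> (2 * R + 1) ^ CARD('d)"
proof -
  let ?A = "\<lambda>c. {\<lceil>2 ^ j * x $ c - real R\<rceil>..\<lfloor>2 ^ j * x $ c + real R\<rfloor>}"
  have eq: "active j x = {m. \<forall>c. m $ c \<in> ?A c}"
  proof -
    have "\<bar>t - of_int m\<bar> \<le> real R \<longleftrightarrow> m \<in> {\<lceil>t - real R\<rceil>..\<lfloor>t + real R\<rfloor>}" for t :: real and m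
      unfolding atLeastAtMost_iff ceiling_le_iff le_floor_iff by linarith
    then show ?thesis unfolding active_def by blast
  qed
  show "finite (active j x)" unfolding eq by (rule card_vec_box) simp
  have c: "card (?A c) \<le> 2 * R + 1" for c
  proof -
    have "real_of_int (\<lfloor>2 ^ j * x $ c + real R\<rfloor> - \<lceil>2 ^ j * x $ c - real R\<rceil>) \<le> 2 * real R"
      using of_int_floor_le[of "2 ^ j * x $ c + real R"] le_of_int_ceiling[of "2 ^ j * x $ c - real R"]
      unfolding of_int_diff by linarith
    then have "\<lfloor>2 ^ j * x $ c + real R\<rfloor> - \<lceil>2 ^ j * x $ c - real R\<rceil> \<le> 2 * int R" by linarith
    then show ?thesis by simp
  qed
  have "card (active j x) \<le> (\<Prod>c\<in>(UNIV::'d set). card (?A c))" unfolding eq by (rule card_vec_box) simp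
  also have "\<dots> \<le> (\<Prod>c\<in>(UNIV::'d set). 2 * R + 1)" by (intro prod_mono) (use c in auto)
  finally show "card (active j x) \<le> (2 * R + 1) ^ CARD('d)" by simp
qed

text \<open>Shifting the wavelet with index k by the integer vector n gives the translate with index
  2^j n + k on the whole space. These are the terms of the periodisation that may be nonzero at
  x.\<close>

definition shifts :: "nat \<Rightarrow> int^'d \<Rightarrow> real^'d \<Rightarrow> (int^'d) set" where
  "shifts j k x = {n. (\<chi> c. 2 ^ j * n $ c + k $ c) \<in> active j x}"

lemma shifts_finite: "finite (shifts j k x)"
proof (rule inj_on_finite)
  show "inj_on (\<lambda>n. \<chi> c. 2 ^ j * n $ c + k $ c) (shifts j k x)" by (auto simp: inj_on_def vec_eq_iff)
  show "(\<lambda>n. \<chi> c. 2 ^ j * n $ c + k $ c) ` shifts j k x \<subseteq> active j x" by (auto simp: shifts_def)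
qed (rule active_finite)

lemma psi_tensor_shift:
  assumes "psi_tensor \<phi> \<psi> (j, k, l) (x - (\<chi> c. of_int (n $ c))) \<noteq> 0"
  shows "n \<in> shifts j k (x :: real^'d)"
  using psi_tensor_support[OF assms]
  by (auto simp: shifts_def active_def algebra_simps)

lemma psi_per_eq:
  assumes "finite F" "shifts j k (x :: real^'d) \<subseteq> F"
  shows "psi_per \<phi> \<psi> (j, k, l) x = (\<Sum>n\<in>F. psi_tensor \<phi> \<psi> (j, k, l) (x - (\<chi> c. of_int (n $ c))))"
proof -
  have "psi_per \<phi> \<psi> (j, k, l) x = (\<Sum>\<^sub>\<infinity>n\<in>F. psi_tensor \<phi> \<psi> (j, k, l) (x - (\<chi> c. of_int (n $ c))))"
    unfolding psi_per_def
    by (rule infsum_cong_neutral) (use psi_tensor_shift[of j k l x] assms in auto)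
  then show ?thesis using assms by simp
qed

lemma psi_per_bound:
  "\<bar>psi_per \<phi> \<psi> (j, k, l) (x :: real^'d)\<bar> \<le>
    real (card (shifts j k x)) * (2 powr (real CARD('d) * real j / 2) * B ^ CARD('d))"
proof -
  have "\<bar>psi_per \<phi> \<psi> (j, k, l) x\<bar> \<le>
      (\<Sum>n\<in>shifts j k x. \<bar>psi_tensor \<phi> \<psi> (j, k, l) (x - (\<chi> c. of_int (n $ c)))\<bar>)"
    unfolding psi_per_eq[OF shifts_finite order_refl] by (rule sum_abs)
  also have "\<dots> \<le> (\<Sum>n\<in>shifts j k x. 2 powr (real CARD('d) * real j / 2) * B ^ CARD('d))"
    by (intro sum_mono psi_tensor_bound)
  finally show ?thesis by simp
qed

text \<open>Division with remainder: the pairs \<open>(k, n)\<close> with \<open>k\<close> in \<open>K_set j\<close> are exactly the integer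
  vectors \<open>2 ^ j * n + k\<close>, so no active translate is counted twice.\<close>

lemma sum_card_shifts: "(\<Sum>k\<in>K_set j. card (shifts j k (x :: real^'d))) \<le> (2 * R + 1) ^ CARD('d)"
proof -
  let ?h = "\<lambda>(k, n). (\<chi> c. 2 ^ j * n $ c + k $ c) :: int^'d"
  have "(\<Sum>k\<in>K_set j. card (shifts j k x)) = card (SIGMA k:K_set j. shifts j k x)"
    by (simp add: card_SigmaI K_set_finite shifts_finite)
  also have "\<dots> = card (?h ` (SIGMA k:K_set j. shifts j k x))"
  proof (rule card_image[symmetric], rule inj_onI)
    fix u v assume u: "u \<in> (SIGMA k:K_set j. shifts j k x)" and v: "v \<in> (SIGMA k:K_set j. shifts j k x)"
      and eq: "?h u = ?h v"
    obtain k n where [simp]: "u = (k, n)" by force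
    obtain k' n' where [simp]: "v = (k', n')" by force
    have "n $ c = n' $ c \<and> k $ c = k' $ c" for c
    proof -
      have e: "2 ^ j * n $ c + k $ c = 2 ^ j * n' $ c + k' $ c" using eq by (simp add: vec_eq_iff)
      have r: "0 \<le> k $ c" "k $ c < 2 ^ j" "0 \<le> k' $ c" "k' $ c < 2 ^ j"
        using u v by (auto simp: K_set_def)
      have "(2 ^ j * n $ c + k $ c) div 2 ^ j = n $ c" "(2 ^ j * n' $ c + k' $ c) div 2 ^ j = n' $ c"
        using r by (auto simp: div_pos_pos_trivial)
      then show ?thesis using e by auto
    qed
    then show "u = v" by (simp add: vec_eq_iff)
  qed
  also have "\<dots> \<le> card (active j x)"
    by (intro card_mono active_finite) (auto simp: shifts_def)
  also have "\<dots> \<le> (2 * R + 1) ^ CARD('d)" by (rule active_finite)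
  finally show ?thesis .
qed

text \<open>Summed over a whole level, the periodised wavelets cost no more at a point than the
  active translates, times the number of types l. The growth 2^(d j / 2) is merely the L2
  normalisation and is cancelled later by the Besov weight.\<close>

lemma psi_per_level_bound:
  "(\<Sum>(k, l)\<in>K_set j \<times> L_set j. \<bar>psi_per \<phi> \<psi> (j, k, l) (x :: real^'d)\<bar>) \<le>
    (2 ^ CARD('d) * (2 * real R + 1) ^ CARD('d) * B ^ CARD('d)) * 2 powr (real CARD('d) * real j / 2)"
proof -
  let ?b = "2 powr (real CARD('d) * real j / 2) * B ^ CARD('d)"
  have b: "?b \<ge> 0" using bnd(3) by simp
  have "(\<Sum>(k, l)\<in>K_set j \<times> L_set j. \<bar>psi_per \<phi> \<psi> (j, k, l) x\<bar>) \<le>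
      (\<Sum>(k, l)\<in>K_set j \<times> (L_set j :: (nat^'d) set). real (card (shifts j k x)) * ?b)"
    by (intro sum_mono) (auto intro: psi_per_bound)
  also have "\<dots> = real (card (L_set j :: (nat^'d) set)) * (real (\<Sum>k\<in>K_set j. card (shifts j k x)) * ?b)"
    by (simp add: sum.cartesian_product[symmetric] sum_distrib_left sum_distrib_right mult_ac)
  also have "\<dots> \<le> 2 ^ CARD('d) * (real ((2 * R + 1) ^ CARD('d)) * ?b)"
  proof (intro mult_mono)
    show "real (card (L_set j :: (nat^'d) set)) \<le> 2 ^ CARD('d)"
      using of_nat_mono[OF L_set_finite(2)[of j, where 'd='d], where 'a=real] by simp
    show "real (\<Sum>k\<in>K_set j. card (shifts j k x)) \<le> real ((2 * R + 1) ^ CARD('d))"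
      by (rule of_nat_mono[OF sum_card_shifts])
  qed (use b bnd(3) in \<open>auto intro!: mult_nonneg_nonneg sum_nonneg\<close>)
  finally show ?thesis by (simp add: mult_ac add.commute)
qed

text \<open>On the unit cube the relevant shifts lie in one finite set, so there the periodisation
  is a finite sum of continuous functions.\<close>

lemma psi_per_measurable: "psi_per \<phi> \<psi> (j, k, l) \<in> borel_measurable (lebesgue_on (cbox 0 1 :: (real^'d) set))"
proof -
  \<comment> \<open>An active shift satisfies \<bar>x - n\<bar> \<le> 2^j \<bar>x - n\<bar> \<le> R
    + \<bar>k\<bar> in each coordinate, and x lies between 0 and 1. The sum over the coordinates
    gives one bound for all of them.\<close>
  define L where "L = 1 + int R + (\<Sum>c\<in>UNIV. \<bar>k $ c\<bar>)"
  define F where "F = {n :: int^'d. \<forall>c. n $ c \<in> {-L..L}}"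
  have F: "finite F" unfolding F_def by (rule card_vec_box) simp
  have sub: "shifts j k x \<subseteq> F" if x: "x \<in> cbox 0 1" for x :: "real^'d"
  proof
    fix n assume "n \<in> shifts j k x"
    then have n: "\<bar>2 ^ j * x $ c - (2 ^ j * of_int (n $ c) + of_int (k $ c))\<bar> \<le> real R" for c
      by (auto simp: shifts_def active_def)
    have "\<bar>n $ c\<bar> \<le> L" for c
    proof -
      have kc: "\<bar>k $ c\<bar> \<le> (\<Sum>c\<in>UNIV. \<bar>k $ c\<bar>)" by (rule member_le_sum) auto
      have xc: "0 \<le> x $ c" "x $ c \<le> 1" using x by (auto simp: mem_box_cart)
      have "2 ^ j * \<bar>x $ c - of_int (n $ c)\<bar> = \<bar>2 ^ j * x $ c - 2 ^ j * of_int (n $ c)\<bar>"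
        by (simp add: abs_mult flip: right_diff_distrib)
      also have "\<dots> \<le> real R + \<bar>of_int (k $ c)\<bar>" using n[of c] by linarith
      finally have "2 ^ j * \<bar>x $ c - of_int (n $ c)\<bar> \<le> real R + \<bar>of_int (k $ c)\<bar>" .
      moreover have "1 * \<bar>x $ c - of_int (n $ c)\<bar> \<le> 2 ^ j * \<bar>x $ c - of_int (n $ c)\<bar>"
        by (intro mult_right_mono) auto
      ultimately have "\<bar>x $ c - of_int (n $ c)\<bar> \<le> real R + \<bar>of_int (k $ c)\<bar>"
        by (metis (no_types) mult_1 order_trans)
      then have "\<bar>real_of_int (n $ c)\<bar> \<le> 1 + real R + \<bar>of_int (k $ c)\<bar>" using xc by linarith
      then have "\<bar>n $ c\<bar> \<le> 1 + int R + \<bar>k $ c\<bar>" by linarith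
      then show ?thesis using kc by (simp add: L_def)
    qed
    then show "n \<in> F" by (auto simp: F_def abs_le_iff minus_le_iff)
  qed
  have "continuous_on UNIV (\<lambda>x. \<Sum>n\<in>F. psi_tensor \<phi> \<psi> (j, k, l) (x - (\<chi> c. of_int (n $ c))))"
    by (intro continuous_on_sum continuous_on_compose2[OF continuous_psi_tensor] continuous_intros) auto
  then have "(\<lambda>x. \<Sum>n\<in>F. psi_tensor \<phi> \<psi> (j, k, l) (x - (\<chi> c. of_int (n $ c)))) \<in>
      borel_measurable (lebesgue_on (cbox 0 1))"
    by (intro measurable_restrict_space1 measurable_completion) (simp add: borel_measurable_continuous_onI)
  then show ?thesis
    by (rule measurable_cong[THEN iffD1, rotated]) (simp add: psi_per_eq[OF F sub, symmetric])
qed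

end

section \<open>Wavelet series\<close>

definition level :: "nat \<Rightarrow> 'd::finite windex set" where
  "level j = {i \<in> I_Psi. fst i = j}"

lemma level_eq: "level j = (\<lambda>(k, l). (j, k, l)) ` (K_set j \<times> L_set j)"
  by (auto simp: level_def I_Psi_def image_iff)

lemma level_finite: "finite (level j :: 'd::finite windex set)"
  unfolding level_eq by (intro finite_imageI finite_cartesian_product K_set_finite L_set_finite)

lemma sum_level: "(\<Sum>i\<in>level j. f i) = (\<Sum>(k, l)\<in>K_set j \<times> L_set j. f (j, k, l))"
  unfolding level_eq by (subst sum.reindex) (auto simp: inj_on_def intro!: sum.cong)

lemma I_Psi_upto: "{i \<in> I_Psi. fst i \<le> N} = (\<Union>j\<le>N. level j)"
  by (auto simp: level_def)

lemma I_Psi_upto_finite: "finite {i \<in> I_Psi :: 'd::finite windex set. fst i \<le> N}"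
  unfolding I_Psi_upto by (auto intro: level_finite)

text \<open>The closed form of the geometric series of 2^(-j \<epsilon>) over j \<ge> J.\<close>

definition level_tail :: "real \<Rightarrow> nat \<Rightarrow> real" where
  "level_tail \<epsilon> J = 2 powr (- (real J * \<epsilon>)) / (1 - 2 powr (- \<epsilon>))"

lemma two_powr_neg_less_1: "0 < \<epsilon> \<Longrightarrow> 2 powr (- \<epsilon>) < (1 :: real)"
  using powr_less_mono[of "- \<epsilon>" 0 2] by simp

lemma level_tail_nonneg: "\<epsilon> > 0 \<Longrightarrow> 0 \<le> level_tail \<epsilon> J"
  using two_powr_neg_less_1[of \<epsilon>] by (simp add: level_tail_def)

lemma level_tail_tendsto: "\<epsilon> > 0 \<Longrightarrow> (\<lambda>J. level_tail \<epsilon> J) \<longlonglongrightarrow> 0"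
proof -
  assume e: "\<epsilon> > 0"
  have p: "2 powr (- (real J * \<epsilon>)) = (2 powr (- \<epsilon>)) ^ J" for J
    by (subst powr_power) auto
  have "(\<lambda>J. (2 powr (- \<epsilon>)) ^ J / (1 - 2 powr (- \<epsilon>))) \<longlonglongrightarrow> 0 / (1 - 2 powr (- \<epsilon>))"
    using two_powr_neg_less_1[OF e] by (intro tendsto_divide LIMSEQ_realpow_zero tendsto_const) auto
  then show ?thesis unfolding level_tail_def p by simp
qed

context
  fixes e :: "'d::finite windex \<Rightarrow> real^'d \<Rightarrow> real" and C \<delta> :: real
  assumes lev: "\<And>j x. (\<Sum>i\<in>level j. \<bar>e i x\<bar>) \<le> C * 2 powr (- (real j * \<delta>))"
    and C: "0 \<le> C"
    and meas: "\<And>i. e i \<in> borel_measurable (lebesgue_on (cbox 0 1))"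
begin

text \<open>The sum always runs over the full index set; a tree enters only through coefficients
  that are set to 0 off it. Fields that belong to different trees or truncations can therefore be
  subtracted coefficient by coefficient.\<close>

definition field :: "('d windex \<Rightarrow> real) \<Rightarrow> real^'d \<Rightarrow> real" where
  "field y x = (\<Sum>\<^sub>\<infinity>i\<in>I_Psi. y i * e i x)"

text \<open>Growth 2^(j \<theta>) of the coefficients against decay 2^(-j \<delta>) of the atoms
  leaves a geometric series. With J = 0 this bounds a whole field, with J = N + 1 a truncation
  error. \<theta> may be negative, which is how rates above \<delta> arise.\<close>

lemma finite_sum_le:
  assumes y: "\<And>i. i \<in> I_Psi \<Longrightarrow> fst i < J \<Longrightarrow> y i = 0"
      "\<And>i. i \<in> I_Psi \<Longrightarrow> J \<le> fst i \<Longrightarrow> \<bar>y i\<bar> \<le> Z * 2 powr (real (fst i) * \<theta>)"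
    and Z: "0 \<le> Z" and th: "\<theta> < \<delta>" and F: "finite F" "F \<subseteq> I_Psi"
  shows "(\<Sum>i\<in>F. \<bar>y i * e i x\<bar>) \<le> C * Z * level_tail (\<delta> - \<theta>) J"
proof -
  define r where "r = 2 powr (- (\<delta> - \<theta>))"
  have r: "0 < r" "r < 1" using th two_powr_neg_less_1[of "\<delta> - \<theta>"] by (auto simp: r_def)
  obtain m where m: "J \<le> m" "\<And>i. i \<in> F \<Longrightarrow> fst i \<le> m"
  proof (rule that[of "max J (Max (fst ` F))"])
    show "fst i \<le> max J (Max (fst ` F))" if "i \<in> F" for i
      using Max_ge[of "fst ` F" "fst i"] F(1) that by (simp add: le_max_iff_disj)
  qed simp
  have "(\<Sum>i\<in>F. \<bar>y i * e i x\<bar>) = (\<Sum>i\<in>{i\<in>F. J \<le> fst i}. \<bar>y i * e i x\<bar>)"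
    by (rule sum.mono_neutral_right) (use F y(1) not_le in fastforce)+
  also have "\<dots> \<le> (\<Sum>i\<in>(\<Union>j\<in>{J..m}. level j). \<bar>y i * e i x\<bar>)"
  proof (rule sum_mono2)
    show "{i\<in>F. J \<le> fst i} \<subseteq> (\<Union>j\<in>{J..m}. level j)"
      using F(2) m(2) by (auto simp: level_def)
  qed (auto intro: level_finite)
  also have "\<dots> = (\<Sum>j\<in>{J..m}. \<Sum>i\<in>level j. \<bar>y i * e i x\<bar>)"
    by (rule sum.UNION_disjoint) (auto simp: level_finite, auto simp: level_def)
  also have "\<dots> \<le> (\<Sum>j\<in>{J..m}. C * Z * r ^ j)"
  proof (rule sum_mono)
    fix j assume j: "j \<in> {J..m}"
    have "(\<Sum>i\<in>level j. \<bar>y i * e i x\<bar>) \<le> (\<Sum>i\<in>level j. (Z * 2 powr (real j * \<theta>)) * \<bar>e i x\<bar>)"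
      unfolding abs_mult using j y(2) by (intro sum_mono mult_right_mono) (auto simp: level_def)
    also have "\<dots> = (Z * 2 powr (real j * \<theta>)) * (\<Sum>i\<in>level j. \<bar>e i x\<bar>)"
      by (simp add: sum_distrib_left)
    also have "\<dots> \<le> (Z * 2 powr (real j * \<theta>)) * (C * 2 powr (- (real j * \<delta>)))"
      using Z by (intro mult_left_mono lev) auto
    also have "\<dots> = C * Z * (2 powr (real j * \<theta>) * 2 powr (- (real j * \<delta>)))" by simp
    also have "2 powr (real j * \<theta>) * 2 powr (- (real j * \<delta>)) = r ^ j"
      unfolding r_def by (subst powr_power) (auto simp: powr_add[symmetric] algebra_simps)
    finally show "(\<Sum>i\<in>level j. \<bar>y i * e i x\<bar>) \<le> C * Z * r ^ j" .
  qed
  also have "\<dots> = C * Z * (\<Sum>j\<in>{J..m}. r ^ j)" by (simp add: sum_distrib_left)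
  also have "\<dots> \<le> C * Z * (r ^ J / (1 - r))"
  proof (rule mult_left_mono)
    have "(1 - r) * (\<Sum>j\<in>{J..m}. r ^ j) = r ^ J - r ^ Suc m" by (rule sum_gp_multiplied[OF m(1)])
    also have "\<dots> \<le> r ^ J" using r by simp
    finally show "(\<Sum>j\<in>{J..m}. r ^ j) \<le> r ^ J / (1 - r)" using r by (simp add: field_simps)
  qed (use C Z in simp)
  also have "r ^ J = 2 powr (- (real J * (\<delta> - \<theta>)))"
    unfolding r_def by (subst powr_power) (auto simp: algebra_simps)
  finally show ?thesis by (simp add: level_tail_def r_def)
qed

lemma field_summable_bound:
  assumes y: "\<And>i. i \<in> I_Psi \<Longrightarrow> fst i < J \<Longrightarrow> y i = 0"
      "\<And>i. i \<in> I_Psi \<Longrightarrow> J \<le> fst i \<Longrightarrow> \<bar>y i\<bar> \<le> Z * 2 powr (real (fst i) * \<theta>)"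
    and Z: "0 \<le> Z" and th: "\<theta> < \<delta>"
  shows "(\<lambda>i. norm (y i * e i x)) summable_on I_Psi"
    "\<bar>field y x\<bar> \<le> C * Z * level_tail (\<delta> - \<theta>) J"
proof -
  note le = finite_sum_le[OF y Z th, where x = x]
  show s: "(\<lambda>i. norm (y i * e i x)) summable_on I_Psi"
    by (rule nonneg_bdd_above_summable_on) (use le in \<open>auto simp: bdd_above_def\<close>)
  have "norm (field y x) \<le> (\<Sum>\<^sub>\<infinity>i\<in>I_Psi. norm (y i * e i x))"
    unfolding field_def by (rule norm_infsum_bound[OF s])
  also have "\<dots> \<le> C * Z * level_tail (\<delta> - \<theta>) J"
    by (rule infsum_le_finite_sums[OF s]) (use le in simp)
  finally show "\<bar>field y x\<bar> \<le> C * Z * level_tail (\<delta> - \<theta>) J" by simp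
qed

lemmas field_bound = field_summable_bound(2)

lemma field_summable:
  assumes "\<And>i. i \<in> I_Psi \<Longrightarrow> \<bar>y i\<bar> \<le> Z * 2 powr (real (fst i) * \<theta>)" "0 \<le> Z" "\<theta> < \<delta>"
  shows "(\<lambda>i. y i * e i x) summable_on I_Psi"
proof -
  have "(\<lambda>i. norm (y i * e i x)) summable_on I_Psi"
    by (rule field_summable_bound(1)[where J = 0, OF _ _ assms(2,3)]) (use assms(1) in auto)
  then show ?thesis by (rule abs_summable_summable)
qed

lemma field_finite:
  assumes "finite F" "F \<subseteq> I_Psi" "\<And>i. i \<in> I_Psi - F \<Longrightarrow> y i = 0"
  shows "field y x = (\<Sum>i\<in>F. y i * e i x)"
proof -
  have "field y x = (\<Sum>\<^sub>\<infinity>i\<in>F. y i * e i x)"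
    unfolding field_def by (rule infsum_cong_neutral) (use assms in auto)
  then show ?thesis using assms(1) by simp
qed

lemma field_add:
  assumes "(\<lambda>i. y i * e i x) summable_on I_Psi" "(\<lambda>i. z i * e i x) summable_on I_Psi"
  shows "field (\<lambda>i. y i + z i) x = field y x + field z x"
  unfolding field_def using infsum_add[OF assms] by (simp add: distrib_right)

lemma field_diff:
  assumes "(\<lambda>i. (y i - z i) * e i x) summable_on I_Psi" "(\<lambda>i. z i * e i x) summable_on I_Psi"
  shows "field y x - field z x = field (\<lambda>i. y i - z i) x"
  using field_add[OF assms] by simp

text \<open>The series converges uniformly, and on a space of finite measure uniform convergence
  implies convergence in L2.\<close>

lemma field_L2_has_sum:
  assumes y: "\<And>i. i \<in> I_Psi \<Longrightarrow> \<bar>y i\<bar> \<le> Z * 2 powr (real (fst i) * \<theta>)"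
    and Z: "0 \<le> Z" and th: "\<theta> < \<delta>"
    and I: "I \<subseteq> I_Psi" "\<And>i. i \<in> I_Psi - I \<Longrightarrow> y i = 0"
  shows "L2_has_sum (lebesgue_on (cbox 0 1)) (\<lambda>i x. y i * e i x) I (field y)"
proof -
  let ?M = "lebesgue_on (cbox 0 1 :: (real^'d) set)"
  interpret finite_measure ?M by (rule finite_measure_lebesgue_on) simp
  let ?t = "\<lambda>n. C * Z * level_tail (\<delta> - \<theta>) n"
  have t0: "?t \<longlonglongrightarrow> 0"
    using tendsto_mult_right_zero[OF level_tail_tendsto[of "\<delta> - \<theta>"], of "C * Z"] th by simp
  have tnn: "0 \<le> ?t n" for n using level_tail_nonneg[of "\<delta> - \<theta>" n] th C Z by simp
  have close: "\<bar>field y x - (\<Sum>i\<in>F. y i * e i x)\<bar> \<le> ?t n"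
    if F: "finite F" "F \<subseteq> I_Psi" "{i \<in> I. fst i < n} \<subseteq> F" for F n x
  proof -
    \<comment> \<open>\<open>?w\<close> is the part summed over F and \<open>?z\<close> the rest.
      Since F contains all indices of I below level n, and the coefficients vanish off I,
      \<open>?z\<close> starts at level n and its field is a geometric tail.\<close>
    let ?z = "\<lambda>i. if i \<in> F then 0 else y i" and ?w = "\<lambda>i. if i \<in> F then y i else 0"
    have "field ?w x = (\<Sum>i\<in>F. ?w i * e i x)" by (rule field_finite[OF F(1,2)]) auto
    also have "\<dots> = (\<Sum>i\<in>F. y i * e i x)" by (rule sum.cong) auto
    finally have w: "field ?w x = (\<Sum>i\<in>F. y i * e i x)" .
    have Z2: "0 \<le> Z * 2 powr (real j * \<theta>)" for j using Z by simp
    have "field y x = field (\<lambda>i. ?w i + ?z i) x" by (rule arg_cong[where f = "\<lambda>y. field y x"]) auto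
    also have "\<dots> = field ?w x + field ?z x"
      by (intro field_add field_summable[OF _ Z th]) (use y Z2 in auto)
    finally have "field y x - (\<Sum>i\<in>F. y i * e i x) = field ?z x" using w by simp
    moreover have "\<bar>field ?z x\<bar> \<le> ?t n"
    proof (rule field_bound[OF _ _ Z th])
      show "?z i = 0" if "i \<in> I_Psi" "fst i < n" for i
        using F(3) I(2)[of i] that by (cases "i \<in> I") auto
      show "\<bar>?z i\<bar> \<le> Z * 2 powr (real (fst i) * \<theta>)" if "i \<in> I_Psi" for i
        using y[OF that] Z2[of "fst i"] by auto
    qed
    ultimately show ?thesis by simp
  qed
  have sm: "(\<lambda>x. \<Sum>i\<in>F. y i * e i x) \<in> borel_measurable ?M" for F
    using meas by (intro borel_measurable_sum borel_measurable_times) auto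
  let ?I = "\<lambda>n. {i \<in> I_Psi :: 'd windex set. fst i \<le> n}"
  \<comment> \<open>Summation level by level exhibits \<open>field y\<close> as a pointwise limit of
    measurable functions.\<close>
  have lim: "(\<lambda>n. \<Sum>i\<in>?I n. y i * e i x) \<longlonglongrightarrow> field y x" for x
  proof (rule LIM_zero_cancel, rule Lim_null_comparison[OF _ t0], rule always_eventually, rule allI)
    show "norm ((\<Sum>i\<in>?I n. y i * e i x) - field y x) \<le> ?t n" for n
    proof -
      have "{i \<in> I. fst i < n} \<subseteq> ?I n" using I(1) by auto
      then show ?thesis
        using close[of "?I n" n x] I_Psi_upto_finite[of n] by (simp add: abs_minus_commute)
    qed
  qed
  have fm: "field y \<in> borel_measurable ?M"
    by (rule borel_measurable_LIMSEQ_real[OF lim sm])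
  have fb: "\<bar>field y x\<bar> \<le> ?t 0" for x by (rule field_bound[OF _ _ Z th]) (use y in auto)
  have L2: "field y \<in> L2 ?M"
    unfolding L2_def using fm
    by (auto intro!: integrable_const_bound[where B = "(?t 0)\<^sup>2"] AE_I2 power2_le_iff_abs_le[THEN iffD2] fb tnn)
  have nrm: "L2_norm ?M (\<lambda>x. field y x - (\<Sum>i\<in>F. y i * e i x)) \<le> ?t n * sqrt (measure ?M (space ?M))"
    if F: "finite F" "F \<subseteq> I_Psi" "{i \<in> I. fst i < n} \<subseteq> F" for F n
  proof -
    let ?g = "\<lambda>x. (field y x - (\<Sum>i\<in>F. y i * e i x))\<^sup>2"
    have g: "?g x \<le> (?t n)\<^sup>2" for x
      using close[OF F, of x] tnn by (simp add: power2_le_iff_abs_le)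
    have "integrable ?M ?g"
      using fm sm by (intro integrable_const_bound[where B = "(?t n)\<^sup>2"]) (auto simp: g intro!: AE_I2)
    then have "(\<integral>x. ?g x \<partial>?M) \<le> (\<integral>x. (?t n)\<^sup>2 \<partial>?M)" using g by (intro integral_mono) auto
    also have "\<dots> = (?t n)\<^sup>2 * measure ?M (space ?M)" by simp
    finally show ?thesis
      unfolding L2_norm_def using tnn[of n]
      by (simp add: real_sqrt_le_iff[symmetric, of _ "(?t n)\<^sup>2 * _"] real_sqrt_mult del: real_sqrt_le_iff)
  qed
  have "((\<lambda>F. L2_norm ?M (\<lambda>x. field y x - (\<Sum>i\<in>F. y i * e i x))) \<longlongrightarrow> 0) (finite_subsets_at_top I)"
  proof (rule tendstoI)
    fix \<epsilon> :: real assume eps: "\<epsilon> > 0"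
    have "(\<lambda>n. ?t n * sqrt (measure ?M (space ?M))) \<longlonglongrightarrow> 0"
      using tendsto_mult_left_zero[OF t0] by simp
    then obtain n where n: "?t n * sqrt (measure ?M (space ?M)) < \<epsilon>"
      using order_tendstoD(2)[OF _ eps] eventually_sequentially by (metis (no_types, lifting) order_refl)
    let ?G = "{i \<in> I. fst i < n}"
    have "?G \<subseteq> {i \<in> I_Psi. fst i \<le> n}" using I(1) by auto
    then have G: "finite ?G" "?G \<subseteq> I" using finite_subset[OF _ I_Psi_upto_finite] by auto
    show "\<forall>\<^sub>F F in finite_subsets_at_top I.
        dist (L2_norm ?M (\<lambda>x. field y x - (\<Sum>i\<in>F. y i * e i x))) 0 < \<epsilon>"
      unfolding eventually_finite_subsets_at_top
    proof (intro exI[of _ ?G] conjI allI impI G)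
      fix F assume F: "finite F \<and> ?G \<subseteq> F \<and> F \<subseteq> I"
      then have "L2_norm ?M (\<lambda>x. field y x - (\<Sum>i\<in>F. y i * e i x)) \<le> ?t n * sqrt (measure ?M (space ?M))"
        using I(1) by (intro nrm) auto
      then show "dist (L2_norm ?M (\<lambda>x. field y x - (\<Sum>i\<in>F. y i * e i x))) 0 < \<epsilon>" using n by simp
    qed
  qed
  then show ?thesis using L2 by (simp add: L2_has_sum_def)
qed

end

text \<open>Both candidates are approximated by the same partial sums. This identifies, up to a null
  set, the sum that \<open>L2_infsum\<close> picks.\<close>

lemma L2_has_sum_unique:
  assumes "L2_has_sum M e I b" "L2_has_sum M e I c" and e: "\<And>i. e i \<in> L2 M"
  shows "AE x in M. b x = c x"
proof -
  let ?S = "\<lambda>F x. \<Sum>i\<in>F. e i x"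
  have bc: "b \<in> L2 M" "c \<in> L2 M" using assms by (auto simp: L2_has_sum_def)
  have S0: "(\<lambda>_. 0 :: real) \<in> L2 M" by (simp add: L2_def)
  have S: "?S F \<in> L2 M" for F
  proof (induction F rule: infinite_finite_induct)
    case (insert i F)
    then show ?case using L2_add[OF e[of i] insert.IH] by simp
  qed (use S0 in simp_all)
  have "((\<lambda>F. L2_norm M (\<lambda>x. b x - ?S F x) + L2_norm M (\<lambda>x. c x - ?S F x)) \<longlongrightarrow> 0 + 0)
      (finite_subsets_at_top I)"
    using assms by (intro tendsto_add) (auto simp: L2_has_sum_def)
  moreover have "L2_norm M (\<lambda>x. b x - c x) \<le> L2_norm M (\<lambda>x. b x - ?S F x) + L2_norm M (\<lambda>x. c x - ?S F x)" for F
    using L2_norm_triangle_diff[OF L2_diff[OF bc(1) S] L2_diff[OF bc(2) S], of F F] by simp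
  ultimately have "L2_norm M (\<lambda>x. b x - c x) \<le> 0"
    by (intro tendsto_lowerbound[where F = "finite_subsets_at_top I"]) auto
  then have "(\<integral>x. (b x - c x)\<^sup>2 \<partial>M) = 0"
    by (intro antisym) (simp_all add: L2_norm_def)
  moreover have "integrable M (\<lambda>x. (b x - c x)\<^sup>2)" using L2_diff[OF bc] by (simp add: L2_def)
  ultimately show ?thesis by (simp add: integral_nonneg_eq_0_iff_AE)
qed

section \<open>Galton--Watson trees\<close>

lemma tree_sigma_space [simp]: "space tree_sigma = trees"
  unfolding tree_sigma_def
  by (rule space_measure_of) (auto simp: Metric_space.openin_mtopology[OF Metric_space_trees])

lemma tree_sigma_open:
  assumes "openin (Metric_space.mtopology trees tree_dist) U"
  shows "U \<in> sets tree_sigma"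
proof -
  have "{U. openin (Metric_space.mtopology trees tree_dist) U} \<subseteq> Pow trees"
    by (auto simp: Metric_space.openin_mtopology[OF Metric_space_trees])
  then show ?thesis unfolding tree_sigma_def using assms by (auto intro: sigma_sets.Basic)
qed

text \<open>A set that is decided by the first n generations contains a ball of radius 2^(-n) around
  each of its trees, hence is open.\<close>

lemma tree_sigma_trunc:
  assumes "U \<subseteq> trees" "\<And>t t'. t \<in> U \<Longrightarrow> t' \<in> trees \<Longrightarrow> tree_trunc n t = tree_trunc n t' \<Longrightarrow> t' \<in> U"
  shows "U \<in> sets tree_sigma"
proof (rule tree_sigma_open)
  interpret Metric_space trees tree_dist by (rule Metric_space_trees)
  have "mball t ((1 / 2) ^ n) \<subseteq> U" if "t \<in> U" for t
  proof
    fix t' assume "t' \<in> mball t ((1 / 2) ^ n)"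
    then have "t' \<in> trees" "tree_dist t t' \<le> (1 / 2) ^ n" "t \<in> trees" by auto
    then show "t' \<in> U" using assms(2)[OF that, of t'] tree_dist_le_iff[of t t' n] by simp
  qed
  moreover have "(1 / 2 :: real) ^ n > 0" by simp
  ultimately show "openin mtopology U" unfolding openin_mtopology using assms(1) by blast
qed

lemma tree_sigma_node: "{t \<in> trees. m \<in> t} \<in> sets tree_sigma"
proof (rule tree_sigma_trunc[where n = "length m"])
  fix t t' assume "t \<in> {t \<in> trees. m \<in> t}" "t' \<in> trees" "tree_trunc (length m) t = tree_trunc (length m) t'"
  then show "t' \<in> {t \<in> trees. m \<in> t}" unfolding tree_trunc_def by blast
qed auto

text \<open>\<open>offspring\<close> is a definite description. Its value is unique because an
  extended natural number is determined by the positive naturals below it.\<close>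

lemma offspring_iff:
  assumes t: "t \<in> trees" and n: "n \<in> t" and i: "i \<ge> 1"
  shows "n @ [i] \<in> t \<longleftrightarrow> enat i \<le> offspring n t"
proof -
  obtain K :: enat where K: "\<forall>i\<ge>1. n @ [i] \<in> t \<longleftrightarrow> enat i \<le> K"
    using t n unfolding trees_def is_tree_def by blast
  have "offspring n t = K"
    unfolding offspring_def
  proof (rule the_equality)
    fix K' :: enat assume K': "\<forall>i\<ge>1. n @ [i] \<in> t \<longleftrightarrow> enat i \<le> K'"
    have le: "A \<le> B" if "\<forall>i\<ge>1. n @ [i] \<in> t \<longleftrightarrow> enat i \<le> A" "\<forall>i\<ge>1. n @ [i] \<in> t \<longleftrightarrow> enat i \<le> B" for A B :: enat
    proof (rule ccontr)
      assume "\<not> A \<le> B"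
      then have "B < A" by simp
      then obtain b where b: "B = enat b" "enat (Suc b) \<le> A"
        by (cases B) (auto simp: Suc_ile_eq)
      then have "n @ [Suc b] \<in> t" using that(1) by auto
      then have "enat (Suc b) \<le> B" using that(2) by auto
      then show False using b by simp
    qed
    show "K' = K" using le[OF K K'] le[OF K' K] by simp
  qed (rule K)
  then show ?thesis using K i by simp
qed

lemma the_enat_offspring:
  "t \<in> trees \<Longrightarrow> n \<in> t \<Longrightarrow> the_enat (offspring n t) = k \<longleftrightarrow> offspring n t = enat k"
  by (cases "offspring n t") (auto simp: trees_def)

lemma root_in_tree: "t \<in> trees \<Longrightarrow> [] \<in> t"
  by (simp add: trees_def is_tree_def)

lemma tree_sigma_offspring: "{t \<in> trees. offspring [] t = enat n} \<in> sets tree_sigma"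
proof (rule tree_sigma_trunc[where n = 1])
  fix t t' assume t: "t \<in> {t \<in> trees. offspring [] t = enat n}" "t' \<in> trees" "tree_trunc 1 t = tree_trunc 1 t'"
  have "[i] \<in> t \<longleftrightarrow> [i] \<in> t'" for i
  proof -
    have "[i] \<in> tree_trunc 1 t \<longleftrightarrow> [i] \<in> tree_trunc 1 t'" using t(3) by simp
    then show ?thesis by (simp add: tree_trunc_def)
  qed
  then have "offspring [] t = offspring [] t'" unfolding offspring_def by simp
  then show "t' \<in> {t \<in> trees. offspring [] t = enat n}" using t by simp
qed auto

lemma tree_event_measurable:
  assumes T: "T \<in> measurable M tree_sigma" and P: "{t \<in> trees. P t} \<in> sets tree_sigma"
  shows "{w \<in> space M. P (T w)} \<in> sets M"
proof -
  have "T -` {t \<in> trees. P t} \<inter> space M = {w \<in> space M. P (T w)}" using measurable_space[OF T] by auto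
  then show ?thesis using measurable_sets[OF T P] by simp
qed

lemmas tree_node_measurable = tree_event_measurable[OF _ tree_sigma_node]
lemmas tree_offspring_measurable = tree_event_measurable[OF _ tree_sigma_offspring]

text \<open>The word i m is a node exactly when m is a node of the i-th sub-tree, and given n \<ge>
  i children that sub-tree has the law of T. All expected node counts come from this
  recursion.\<close>

lemma GW_tree_cond_node:
  assumes "prob_space M" and GW: "GW_tree M Q T" and i: "1 \<le> i" and m: "m \<in> words"
  shows "measure M {w \<in> space M. offspring [] (T w) = enat n \<and> i # m \<in> T w} =
    (if i \<le> n then pmf Q n * measure M {w \<in> space M. m \<in> T w} else 0)"
proof -
  interpret prob_space M by fact
  have T: "T \<in> measurable M tree_sigma" using GW by (simp add: GW_tree_def)
  define A where "A = {w \<in> space M. offspring [] (T w) = enat n}"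
  have A: "A \<in> sets M" unfolding A_def by (rule tree_offspring_measurable[OF T])
  have tr: "T w \<in> trees" if "w \<in> space M" for w using measurable_space[OF T that] by simp
  let ?K = "\<lambda>w. the_enat (offspring [] (T w))"
  have PA: "prob A = pmf Q n"
  proof -
    have "pmf Q n = measure (distr M (count_space UNIV) ?K) {n}"
      using GW by (simp add: GW_tree_def measure_pmf_single)
    also have "\<dots> = prob (?K -` {n} \<inter> space M)"
    proof (rule measure_distr)
      show "?K \<in> measurable M (count_space UNIV)"
      proof (rule measurable_count_space_eq2_countable[THEN iffD2], intro conjI ballI)
        fix k :: nat
        have "?K -` {k} \<inter> space M =
            {w \<in> space M. offspring [] (T w) = enat k}"
          using the_enat_offspring[OF tr root_in_tree[OF tr]] by auto
        then show "?K -` {k} \<inter> space M \<in> sets M"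
          using tree_offspring_measurable[OF T] by simp
      qed auto
    qed simp
    also have "?K -` {n} \<inter> space M = A"
      unfolding A_def using the_enat_offspring[OF tr root_in_tree[OF tr]] by auto
    finally show ?thesis by simp
  qed
  let ?B = "{w \<in> space M. offspring [] (T w) = enat n \<and> i # m \<in> T w}"
  show ?thesis
  proof (cases "i \<le> n")
    case False
    have "?B = {}"
    proof (rule ccontr)
      assume "?B \<noteq> {}"
      then obtain w where w: "w \<in> space M" "offspring [] (T w) = enat n" "i # m \<in> T w" by auto
      have "[i] @ m \<in> T w" using w(3) by simp
      then have "[i] \<in> T w" using tr[OF w(1)] unfolding trees_def is_tree_def by blast
      then have "enat i \<le> enat n"
        using offspring_iff[OF tr[OF w(1)] root_in_tree[OF tr[OF w(1)]] i] w(2) by simp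
      then show False using False by simp
    qed
    then have "prob ?B = 0" by (simp only: measure_empty)
    then show ?thesis using False by simp
  next
    case True
    show ?thesis
    proof (cases "prob A > 0")
      \<comment> \<open>Conditioning on a null event is impossible, but then \<open>pmf Q n\<close>
        is 0 and both sides vanish.\<close>
      case False
      then have "prob A = 0" using measure_nonneg[of M A] by linarith
      moreover have "prob ?B \<le> prob A" using A by (intro finite_measure_mono) (auto simp: A_def)
      ultimately have "prob ?B = 0" using measure_nonneg[of M ?B] by linarith
      then show ?thesis using True PA \<open>prob A = 0\<close> by simp
    next
      case pos: True
      let ?S = "\<lambda>i w. subtree i (T w)"
      let ?N = "cond_measure M A"
      have spA: "A \<inter> space M = A" using sets.sets_into_space[OF A] by blast
      have emA: "emeasure (restrict_space M A) A = emeasure M A"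
        using A by (simp add: emeasure_restrict_space spA)
      have A': "A \<in> sets (restrict_space M A)" using A by (auto simp: sets_restrict_space_iff spA)
      interpret N: prob_space ?N
        unfolding cond_measure_def
        by (rule prob_space_uniform_measure) (use pos emA in \<open>auto simp: emeasure_eq_measure\<close>)
      have GW2: "N.indep_vars (\<lambda>_. tree_sigma) ?S {1..n}"
        "\<forall>i\<in>{1..n}. distr ?N tree_sigma (?S i) = distr M tree_sigma T"
      proof -
        have "\<forall>n A. A = {w \<in> space M. offspring [] (T w) = enat n} \<and> measure M A > 0 \<longrightarrow>
          prob_space.indep_vars (cond_measure M A) (\<lambda>_. tree_sigma) ?S {1..n} \<and>
          (\<forall>i\<in>{1..n}. distr (cond_measure M A) tree_sigma (?S i) = distr M tree_sigma T)"
          using GW unfolding GW_tree_def by simp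
        from this[rule_format, OF conjI, OF A_def pos]
        show "N.indep_vars (\<lambda>_. tree_sigma) ?S {1..n}"
          "\<forall>i\<in>{1..n}. distr ?N tree_sigma (?S i) = distr M tree_sigma T"
          by simp_all
      qed
      have iN: "i \<in> {1..n}" using i True by simp
      \<comment> \<open>Where the root has fewer than i children the sub-tree is the empty set,
        which is not a tree. Hence measurability is available on the conditioned space only, from
        the clause on independent sub-trees.\<close>
      have sm: "(?S i) \<in> measurable ?N tree_sigma"
        using GW2(1) iN unfolding N.indep_vars_def by blast
      let ?E = "{t \<in> trees. m \<in> t}"
      have "measure (distr ?N tree_sigma (?S i)) ?E =
          measure ?N ((?S i) -` ?E \<inter> space ?N)"
        by (rule measure_distr[OF sm tree_sigma_node])
      also have "(?S i) -` ?E \<inter> space ?N = ?B"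
      proof -
        have sp: "space ?N = A" by (simp add: cond_measure_def space_restrict_space spA)
        have "subtree i (T w) \<in> trees" if "w \<in> A" for w
          using measurable_space[OF sm, of w] that sp by simp
        then have "(?S i) -` ?E \<inter> A = ?B" using m by (auto simp: subtree_def A_def)
        then show ?thesis unfolding sp .
      qed
      also have "measure ?N ?B = prob ?B / prob A"
      proof -
        have B: "?B \<in> sets (restrict_space M A)"
        proof -
          have "?B = A \<inter> {w \<in> space M. i # m \<in> T w}" by (auto simp: A_def)
          then show ?thesis using A tree_node_measurable[OF T] by (auto simp: sets_restrict_space_iff spA)
        qed
        have AB: "A \<inter> ?B = ?B" by (auto simp: A_def)
        have "measure ?N ?B = measure (restrict_space M A) (A \<inter> ?B) / measure (restrict_space M A) A"
          unfolding cond_measure_def using pos emA A' B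
          by (intro measure_uniform_measure) (auto simp: emeasure_eq_measure)
        also have "\<dots> = prob ?B / prob A"
        proof -
          have "A \<inter> space M \<in> sets M" "?B \<subseteq> A" using A spA by (simp, auto simp: A_def)
          then show ?thesis unfolding AB by (simp add: measure_restrict_space)
        qed
        finally show ?thesis .
      qed
      also have "measure (distr ?N tree_sigma (?S i)) ?E = measure (distr M tree_sigma T) ?E"
        using GW2(2) iN by simp
      also have "\<dots> = prob {w \<in> space M. m \<in> T w}"
      proof -
        have "T -` ?E \<inter> space M = {w \<in> space M. m \<in> T w}" using tr by auto
        then show ?thesis by (simp add: measure_distr[OF T tree_sigma_node])
      qed
      finally show ?thesis using True pos PA by (simp add: field_simps)
    qed
  qed
qed

text \<open>The possible nodes of generation j when nobody has more than d children. The set is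
  finite and deterministic, so sums over a random generation become finite sums of node
  probabilities.\<close>

definition words_upto :: "nat \<Rightarrow> nat \<Rightarrow> nat list set" where
  "words_upto d j = {n. set n \<subseteq> {1..d} \<and> length n = j}"

lemma words_upto_finite: "finite (words_upto d j)"
  unfolding words_upto_def by (rule finite_lists_length_eq) simp

lemma words_upto_words: "n \<in> words_upto d j \<Longrightarrow> n \<in> words"
  by (auto simp: words_upto_def words_def)

context
  fixes M :: "'w measure" and Q :: "nat pmf" and T :: "'w \<Rightarrow> nat list set" and d :: nat
  assumes M: "prob_space M" and GW: "GW_tree M Q T" and Q: "\<And>n. d < n \<Longrightarrow> pmf Q n = 0"
begin

lemma GW_measurable: "T \<in> measurable M tree_sigma"
  using GW by (simp add: GW_tree_def)

lemma GW_trees: "w \<in> space M \<Longrightarrow> T w \<in> trees"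
  using measurable_space[OF GW_measurable] by simp

text \<open>The factor is the probability that the root has at least i children.\<close>

lemma GW_node_Cons:
  assumes "1 \<le> i" "m \<in> words"
  shows "measure M {w \<in> space M. i # m \<in> T w} =
    (\<Sum>n\<in>{..d}. if i \<le> n then pmf Q n else 0) * measure M {w \<in> space M. m \<in> T w}"
proof -
  interpret prob_space M by (rule M)
  let ?B = "\<lambda>n. {w \<in> space M. offspring [] (T w) = enat n \<and> i # m \<in> T w}"
  have B: "?B n \<in> sets M" for n
  proof -
    have "?B n = {w \<in> space M. offspring [] (T w) = enat n} \<inter> {w \<in> space M. i # m \<in> T w}" by auto
    then show ?thesis
      using tree_offspring_measurable[OF GW_measurable] tree_node_measurable[OF GW_measurable] by auto
  qed
  have un: "(\<Union>n. ?B n) = {w \<in> space M. i # m \<in> T w}"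
  proof -
    have "\<exists>n. offspring [] (T w) = enat n" if "w \<in> space M" for w
      using the_enat_offspring[OF GW_trees[OF that] root_in_tree[OF GW_trees[OF that]]] by blast
    then show ?thesis by blast
  qed
  have "(\<lambda>n. prob (?B n)) sums prob (\<Union>n. ?B n)"
    by (rule finite_measure_UNION) (use B in \<open>auto simp: disjoint_family_on_def\<close>)
  moreover have "(\<lambda>n. prob (?B n)) sums (\<Sum>n\<in>{..d}. prob (?B n))"
    by (rule sums_finite) (use Q in \<open>auto simp: GW_tree_cond_node[OF M GW assms]\<close>)
  ultimately have "prob (\<Union>n. ?B n) = (\<Sum>n\<in>{..d}. prob (?B n))" by (rule sums_unique2)
  also have "\<dots> = (\<Sum>n\<in>{..d}. (if i \<le> n then pmf Q n else 0) * prob {w \<in> space M. m \<in> T w})"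
    by (rule sum.cong) (auto simp: GW_tree_cond_node[OF M GW assms])
  finally show ?thesis unfolding un by (simp add: sum_distrib_right)
qed

lemma GW_node_outside:
  "m \<in> words \<Longrightarrow> \<not> set m \<subseteq> {1..d} \<Longrightarrow> measure M {w \<in> space M. m \<in> T w} = 0"
proof (induction m)
  case (Cons i m)
  have i: "1 \<le> i" and m: "m \<in> words" using Cons.prems(1) by (auto simp: words_def)
  show ?case
  proof (cases "i \<le> d")
    case True
    then have "\<not> set m \<subseteq> {1..d}" using Cons.prems(2) i by auto
    then show ?thesis using Cons.IH[OF m] by (simp add: GW_node_Cons[OF i m])
  next
    case False
    then have "(\<Sum>n\<in>{..d}. if i \<le> n then pmf Q n else 0) = 0" by (intro sum.neutral) auto
    then show ?thesis by (simp add: GW_node_Cons[OF i m])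
  qed
qed simp

text \<open>A value of T may be any locally finite tree; words with a letter above d are excluded
  only with probability one. There are countably many words, so the exceptional events unite to a
  null event.\<close>

lemma GW_words_upto: "AE w in M. \<forall>n\<in>T w. n \<in> words_upto d (length n)"
proof -
  interpret prob_space M by (rule M)
  have "AE w in M. n \<in> T w \<longrightarrow> n \<in> words_upto d (length n)" for n
  proof (cases "n \<in> words \<and> \<not> set n \<subseteq> {1..d}")
    case True
    have "{w \<in> space M. n \<in> T w} \<in> null_sets M"
      using GW_node_outside[of n] True tree_node_measurable[OF GW_measurable, of n]
      by (auto simp: null_sets_def emeasure_eq_measure)
    from AE_not_in[OF this] show ?thesis by (rule AE_mp) (auto intro!: AE_I2)
  next
    case False
    have "n \<in> words" if "w \<in> space M" "n \<in> T w" for w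
      using GW_trees[OF that(1)] that(2) unfolding trees_def is_tree_def by blast
    then show ?thesis using False by (auto simp: words_upto_def intro!: AE_I2)
  qed
  then show ?thesis by (simp add: Ball_def AE_all_countable)
qed

text \<open>The first letter of a word selects a sub-tree of the root, so each generation
  contributes the factor obtained by summing over i the probability of at least i children. That sum
  is the mean offspring number.\<close>

lemma GW_expected_level_size:
  "(\<Sum>n\<in>words_upto d j. measure M {w \<in> space M. n \<in> T w}) = (\<Sum>n\<in>{..d}. real n * pmf Q n) ^ j"
proof (induction j)
  case 0
  interpret prob_space M by (rule M)
  have "{w \<in> space M. [] \<in> T w} = space M" using GW_trees root_in_tree by auto
  moreover have "words_upto d 0 = {[]}" by (auto simp: words_upto_def)
  ultimately show ?case by (simp add: prob_space)
next
  case (Suc j)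
  let ?P = "\<lambda>n. measure M {w \<in> space M. n \<in> T w}"
  let ?t = "\<lambda>i. \<Sum>n\<in>{..d}. if i \<le> n then pmf Q n else 0"
  have W: "words_upto d (Suc j) = (\<lambda>(i, m). i # m) ` ({1..d} \<times> words_upto d j)"
  proof (intro equalityI subsetI)
    fix n assume n: "n \<in> words_upto d (Suc j)"
    then obtain i m where "n = i # m" by (cases n) (auto simp: words_upto_def)
    then show "n \<in> (\<lambda>(i, m). i # m) ` ({1..d} \<times> words_upto d j)"
      using n by (intro image_eqI[of _ _ "(i, m)"]) (auto simp: words_upto_def)
  qed (auto simp: words_upto_def)
  have "(\<Sum>n\<in>words_upto d (Suc j). ?P n) = (\<Sum>(i, m)\<in>{1..d} \<times> words_upto d j. ?P (i # m))"
    unfolding W by (subst sum.reindex) (auto simp: inj_on_def intro!: sum.cong)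
  also have "\<dots> = (\<Sum>(i, m)\<in>{1..d} \<times> words_upto d j. ?t i * ?P m)"
    by (rule sum.cong) (auto intro!: GW_node_Cons dest: words_upto_words)
  also have "\<dots> = (\<Sum>i\<in>{1..d}. ?t i) * (\<Sum>m\<in>words_upto d j. ?P m)"
    by (simp add: sum.cartesian_product[symmetric] sum_product)
  also have "(\<Sum>i\<in>{1..d}. ?t i) = (\<Sum>n\<in>{..d}. real n * pmf Q n)"
  proof -
    have "(\<Sum>i\<in>{1..d}. ?t i) = (\<Sum>n\<in>{..d}. \<Sum>i\<in>{1..d}. if i \<le> n then pmf Q n else 0)"
      by (rule sum.swap)
    also have "\<dots> = (\<Sum>n\<in>{..d}. real n * pmf Q n)"
    proof (rule sum.cong[OF refl])
      fix n assume n: "n \<in> {..d}"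
      have "(\<Sum>i\<in>{1..d}. if i \<le> n then pmf Q n else 0) = (\<Sum>i\<in>{i \<in> {1..d}. i \<le> n}. pmf Q n)"
        by (rule sum.inter_filter[symmetric]) simp
      also have "{i \<in> {1..d}. i \<le> n} = {1..n}" using n by auto
      finally show "(\<Sum>i\<in>{1..d}. if i \<le> n then pmf Q n else 0) = real n * pmf Q n" by simp
    qed
    finally show ?thesis .
  qed
  finally show ?case by (simp add: Suc.IH)
qed

end

text \<open>Binomial weights are Bernstein polynomials, and the mean is their first moment.\<close>

lemma binomial_pmf_mean:
  assumes "0 \<le> b" "b \<le> 1"
  shows "(\<Sum>n\<in>{..d}. real n * pmf (binomial_pmf d b) n) = real d * b"
proof -
  have "(\<Sum>n\<in>{..d}. real n * pmf (binomial_pmf d b) n) = (\<Sum>n\<le>d. real n * Bernstein d n b)"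
    using assms by (intro sum.cong) (auto simp: Bernstein_def)
  then show ?thesis by (simp add: sum_k_Bernstein)
qed

section \<open>Moments of the coefficients\<close>

lemma power_le_fact_exp:
  fixes x :: real
  assumes "0 \<le> x"
  shows "x ^ m \<le> fact m * exp x"
proof -
  have s: "(\<lambda>n. x ^ n / fact n) sums exp x"
    using exp_converges[of x] by (simp add: scaleR_conv_of_real field_simps)
  have "(\<Sum>n\<in>{m}. x ^ n / fact n) \<le> exp x"
    by (rule sum_le_suminf[of "\<lambda>n. x ^ n / fact n" "{m}", unfolded sums_unique[OF s, symmetric]])
      (use s assms in \<open>auto simp: sums_iff\<close>)
  then show ?thesis by (simp add: field_simps)
qed

text \<open>Trades a small factor w in the exponent for the small prefactor w^m, at the cost of one
  more unit in the exponent. Where w x > 1, the factor (w x)^m \<ge> 1 can be inserted and x^m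
  absorbed by the exponential; elsewhere exp c suffices.\<close>

lemma exp_scaled_le:
  fixes c w x :: real
  assumes "0 \<le> x" "0 < w" "w \<le> 1" "0 \<le> c"
  shows "exp (c * (w * x)) \<le> exp c + fact m * w ^ m * exp ((c + 1) * x)"
proof (cases "w * x \<le> 1")
  case True
  then have "c * (w * x) \<le> c * 1" using assms by (intro mult_left_mono) auto
  then have "exp (c * (w * x)) \<le> exp c" by simp
  moreover have "0 \<le> fact m * w ^ m * exp ((c + 1) * x)" using assms by simp
  ultimately show ?thesis by linarith
next
  case False
  then have 1: "1 \<le> (w * x) ^ m" by (intro one_le_power) simp
  have "c * (w * x) \<le> c * (1 * x)" using assms by (intro mult_left_mono mult_right_mono) auto
  then have "exp (c * (w * x)) \<le> 1 * exp (c * x)" by simp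
  also have "\<dots> \<le> (w * x) ^ m * exp (c * x)" using 1 by (intro mult_right_mono) auto
  also have "\<dots> = w ^ m * (x ^ m * exp (c * x))" by (simp add: power_mult_distrib)
  also have "\<dots> \<le> w ^ m * ((fact m * exp x) * exp (c * x))"
    using assms by (intro mult_left_mono mult_right_mono power_le_fact_exp) auto
  also have "\<dots> = fact m * w ^ m * exp ((c + 1) * x)" by (simp add: exp_add distrib_right)
  finally have "exp (c * (w * x)) \<le> fact m * w ^ m * exp ((c + 1) * x)" .
  then show ?thesis using exp_gt_zero[of c] by linarith
qed

text \<open>The integrand is at most the standard exponential density plus its reflection.\<close>

lemma nn_integral_exp_neg_abs: "(\<integral>\<^sup>+x. ennreal (exp (- \<bar>x :: real\<bar>)) \<partial>lborel) < \<infinity>"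
proof -
  let ?e = "\<lambda>x. ennreal (exponential_density 1 x)"
  interpret prob_space "density lborel ?e" by (rule prob_space_exponential_density) simp
  have m: "?e \<in> borel_measurable borel" by measurable
  have 1: "(\<integral>\<^sup>+x. ?e x \<partial>lborel) = 1"
    using emeasure_space_1 by (simp add: emeasure_density)
  then have 2: "(\<integral>\<^sup>+x. ?e (- x) \<partial>lborel) = 1"
    using nn_integral_real_affine[OF m, of "-1" 0] by simp
  have "ennreal (exp (- \<bar>x\<bar>)) \<le> ?e x + ?e (- x)" for x
    by (auto simp: exponential_density_def ennreal_plus[symmetric] simp del: ennreal_plus intro!: ennreal_leI)
  then have "(\<integral>\<^sup>+x. ennreal (exp (- \<bar>x\<bar>)) \<partial>lborel) \<le> (\<integral>\<^sup>+x. ?e x + ?e (- x) \<partial>lborel)"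
    by (intro nn_integral_mono)
  also have "\<dots> = 2" using 1 2 by (subst nn_integral_add) auto
  also have "\<dots> < \<infinity>" by simp
  finally show ?thesis .
qed

text \<open>\<open>x0\<close> is the point where \<bar>x\<bar>^p / \<kappa> overtakes (c + 1)
  \<bar>x\<bar>; it exists because p > 1. Beyond it the linear term loses with one unit of slope to
  spare, and that unit makes the exponential integrable.\<close>

lemma exp_linear_minus_powr_le:
  fixes p \<kappa> c x :: real
  assumes "1 < p" "0 < \<kappa>" "0 \<le> c"
  defines "x0 \<equiv> ((c + 1) * \<kappa>) powr (1 / (p - 1))"
  shows "c * \<bar>x\<bar> - (\<bar>x\<bar> powr p) / \<kappa> \<le> (c + 1) * x0 - \<bar>x\<bar>"
proof (cases "\<bar>x\<bar> \<le> x0")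
  case True
  have "(c + 1) * \<bar>x\<bar> \<le> (c + 1) * x0" using True assms by (intro mult_left_mono) auto
  moreover have "0 \<le> (\<bar>x\<bar> powr p) / \<kappa>" using assms by simp
  ultimately show ?thesis by (simp add: algebra_simps)
next
  case False
  have x0: "0 \<le> x0" by (simp add: x0_def)
  have "(c + 1) * \<kappa> = x0 powr (p - 1)" using assms by (simp add: x0_def powr_powr)
  also have "\<dots> \<le> \<bar>x\<bar> powr (p - 1)" using False x0 assms by (intro powr_mono2) auto
  finally have "(c + 1) * \<kappa> * \<bar>x\<bar> \<le> \<bar>x\<bar> powr (p - 1) * \<bar>x\<bar>" by (intro mult_right_mono) auto
  also have "\<dots> = \<bar>x\<bar> powr p" using False x0 by (simp add: powr_diff)
  finally have "(c + 1) * \<bar>x\<bar> \<le> (\<bar>x\<bar> powr p) / \<kappa>" using assms by (simp add: field_simps)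
  moreover have "0 \<le> (c + 1) * x0" using x0 assms by simp
  ultimately show ?thesis by (simp add: algebra_simps)
qed

text \<open>All coefficients share one density, so one constant bounds the moments for every
  index.\<close>

lemma besov_exp_moment:
  assumes B: "besov_coefficients M p \<kappa> (X :: 'd::finite windex \<Rightarrow> 'w \<Rightarrow> real)"
    and p: "1 < p" "0 < \<kappa>" and c: "0 \<le> c"
  obtains K :: real where "0 \<le> K" "\<And>i. i \<in> I_Psi \<Longrightarrow> (\<integral>\<^sup>+w. ennreal (exp (c * \<bar>X i w\<bar>)) \<partial>M) \<le> ennreal K"
proof -
  define cp where "cp = (\<integral>y. exp (- (\<bar>y\<bar> powr p) / \<kappa>) \<partial>lborel)"
  define x0 where "x0 = ((c + 1) * \<kappa>) powr (1 / (p - 1))"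
  have cp: "0 \<le> cp" unfolding cp_def by (intro integral_nonneg_AE) auto
  define A where "A = exp ((c + 1) * x0) / cp"
  have A: "0 \<le> A" using cp by (simp add: A_def)
  obtain J where J: "0 \<le> J" "(\<integral>\<^sup>+x. ennreal (exp (- \<bar>x :: real\<bar>)) \<partial>lborel) = ennreal J"
    using nn_integral_exp_neg_abs by (metis infinity_ennreal_def less_top_ennreal)
  show ?thesis
  proof (rule that[of "A * J"])
    fix i :: "'d windex" assume i: "i \<in> I_Psi"
    let ?f = "\<lambda>x. ennreal (exp (- (\<bar>x\<bar> powr p) / \<kappa>) / cp)"
    have D: "distributed M lborel (X i) ?f"
      using B i by (simp add: besov_coefficients_def cp_def)
    have "(\<integral>\<^sup>+w. ennreal (exp (c * \<bar>X i w\<bar>)) \<partial>M) = (\<integral>\<^sup>+x. ?f x * ennreal (exp (c * \<bar>x\<bar>)) \<partial>lborel)"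
      by (rule distributed_nn_integral[OF D, symmetric]) simp
    also have "\<dots> \<le> (\<integral>\<^sup>+x. ennreal A * ennreal (exp (- \<bar>x\<bar>)) \<partial>lborel)"
    proof (rule nn_integral_mono)
      fix x :: real
      have "exp (- (\<bar>x\<bar> powr p) / \<kappa>) * exp (c * \<bar>x\<bar>) \<le> exp ((c + 1) * x0) * exp (- \<bar>x\<bar>)"
        using exp_linear_minus_powr_le[OF p c, of x] by (simp add: exp_add[symmetric] x0_def)
      then have "exp (- (\<bar>x\<bar> powr p) / \<kappa>) * exp (c * \<bar>x\<bar>) / cp \<le> exp ((c + 1) * x0) * exp (- \<bar>x\<bar>) / cp"
        using cp by (rule divide_right_mono)
      then show "?f x * ennreal (exp (c * \<bar>x\<bar>)) \<le> ennreal A * ennreal (exp (- \<bar>x\<bar>))"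
        using cp A by (simp add: ennreal_mult[symmetric] A_def)
    qed
    also have "\<dots> = ennreal (A * J)"
      using A J by (simp add: nn_integral_cmult ennreal_mult)
    finally show "(\<integral>\<^sup>+w. ennreal (exp (c * \<bar>X i w\<bar>)) \<partial>M) \<le> ennreal (A * J)" .
  qed (use A J in simp)
qed

lemma besov_measurable:
  assumes "besov_coefficients M p \<kappa> X" "i \<in> I_Psi"
  shows "X i \<in> borel_measurable M"
proof -
  have "distributed M lborel (X i)
      (\<lambda>x. ennreal (exp (- (\<bar>x\<bar> powr p) / \<kappa>) / (\<integral>y. exp (- (\<bar>y\<bar> powr p) / \<kappa>) \<partial>lborel)))"
    using assms unfolding besov_coefficients_def by (elim conjE bspec)
  then have "X i \<in> measurable M lborel" by (rule distributed_measurable)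
  then show ?thesis by simp
qed

lemma suminf_ennreal_geometric:
  fixes a r :: real
  assumes "0 \<le> a" "0 \<le> r" "r < 1"
  shows "(\<Sum>j. ennreal (a * r ^ j)) < \<infinity>"
  unfolding infinity_ennreal_def less_top[symmetric]
  by (rule ennreal_suminf_neq_top) (use assms in \<open>auto intro: summable_mult summable_geometric\<close>)

text \<open>A supremum is replaced by a sum: the total over all levels has finite expectation by
  comparison with a geometric series, and it dominates each single member.\<close>

lemma summable_family_bound:
  fixes h :: "nat \<Rightarrow> 'a \<Rightarrow> 'w \<Rightarrow> ennreal"
  assumes fin: "\<And>j. finite (A j)" and h: "\<And>j a. a \<in> A j \<Longrightarrow> h j a \<in> borel_measurable M"
    and le: "\<And>j. (\<Sum>a\<in>A j. \<integral>\<^sup>+w. h j a w \<partial>M) \<le> ennreal (c * q ^ j)"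
    and c: "0 \<le> c" "0 \<le> q" "q < 1"
  obtains Y where "integrable M Y" "\<And>w. 0 \<le> Y w" "AE w in M. \<forall>j. \<forall>a\<in>A j. h j a w \<le> ennreal (Y w)"
proof -
  define G where "G w = (\<Sum>j. \<Sum>a\<in>A j. h j a w)" for w
  have Gj: "(\<lambda>w. \<Sum>a\<in>A j. h j a w) \<in> borel_measurable M" for j by (rule borel_measurable_sum[OF h])
  then have Gm[measurable]: "G \<in> borel_measurable M" unfolding G_def by (rule borel_measurable_suminf_order)
  have "(\<integral>\<^sup>+w. G w \<partial>M) = (\<Sum>j. \<integral>\<^sup>+w. (\<Sum>a\<in>A j. h j a w) \<partial>M)"
    unfolding G_def by (rule nn_integral_suminf[OF Gj])
  also have "\<dots> = (\<Sum>j. \<Sum>a\<in>A j. \<integral>\<^sup>+w. h j a w \<partial>M)" by (subst nn_integral_sum[OF h]) auto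
  also have "\<dots> \<le> (\<Sum>j. ennreal (c * q ^ j))" by (intro suminf_le le) auto
  also have "\<dots> < \<infinity>" by (rule suminf_ennreal_geometric[OF c])
  finally have fin_int: "(\<integral>\<^sup>+w. G w \<partial>M) < \<infinity>" .
  show ?thesis
  proof (rule that[of "\<lambda>w. enn2real (G w)"])
    have "(\<integral>\<^sup>+w. ennreal (norm (enn2real (G w))) \<partial>M) \<le> (\<integral>\<^sup>+w. G w \<partial>M)"
      by (intro nn_integral_mono) (simp add: ennreal_enn2real_if)
    then show "integrable M (\<lambda>w. enn2real (G w))" using fin_int by (intro integrableI_bounded) auto
    \<comment> \<open>\<open>enn2real\<close> sends infinity to 0, so the domination survives only
      where \<open>G\<close> is finite, which is almost everywhere.\<close>
    have "AE w in M. G w \<noteq> \<infinity>" using fin_int by (intro nn_integral_PInf_AE) auto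
    then show "AE w in M. \<forall>j. \<forall>a\<in>A j. h j a w \<le> ennreal (enn2real (G w))"
    proof (rule eventually_mono, intro allI ballI)
      fix w j a assume G: "G w \<noteq> \<infinity>" and a: "a \<in> A j"
      have "h j a w \<le> (\<Sum>a\<in>A j. h j a w)" by (rule member_le_sum[OF a]) (auto intro: fin)
      also have "\<dots> \<le> G w"
        unfolding G_def using sum_le_suminf[of "\<lambda>j. \<Sum>a\<in>A j. h j a w" "{j}"] by simp
      also have "\<dots> = ennreal (enn2real (G w))" using G by (simp add: less_top)
      finally show "h j a w \<le> ennreal (enn2real (G w))" .
    qed
  qed simp
qed

lemma card_level: "card (level j :: 'd::finite windex set) \<le> (2 ^ j) ^ CARD('d) * 2 ^ CARD('d)"
proof -
  have "card (level j :: 'd windex set) \<le> card ((K_set j :: (int^'d) set) \<times> (L_set j :: (nat^'d) set))"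
    unfolding level_eq by (rule card_image_le) (intro finite_cartesian_product K_set_finite L_set_finite)
  also have "\<dots> \<le> (2 ^ j) ^ CARD('d) * 2 ^ CARD('d)"
    unfolding card_cartesian_product by (intro mult_mono K_set_finite L_set_finite) auto
  finally show ?thesis .
qed

text \<open>No independence is needed: the union over the \<open>2 ^ (j d)\<close> coefficients of level \<open>j\<close> is beaten by
  a high power of \<open>2 powr (- j * \<theta>)\<close>.\<close>

lemma besov_uniform_bound:
  assumes M: "prob_space M" and B: "besov_coefficients M p \<kappa> (X :: 'd::finite windex \<Rightarrow> 'w \<Rightarrow> real)"
    and p: "1 < p" "0 < \<kappa>" and c: "0 < c" and th: "0 < \<theta>"
  obtains Z where "Z \<in> borel_measurable M" "\<And>w. 0 \<le> Z w" "integrable M (\<lambda>w. exp (c * Z w))"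
    "AE w in M. \<forall>i\<in>I_Psi. \<bar>X i w\<bar> \<le> Z w * 2 powr (real (fst i) * \<theta>)"
proof -
  interpret prob_space M by (rule M)
  obtain K where K: "0 \<le> K" "\<And>i. i \<in> I_Psi \<Longrightarrow> (\<integral>\<^sup>+w. ennreal (exp ((c + 1) * \<bar>X i w\<bar>)) \<partial>M) \<le> ennreal K"
    using besov_exp_moment[OF B p, of "c + 1"] c by auto
  \<comment> \<open>With m \<theta> \<ge> d + 1 the factor \<open>b j ^ m\<close> beats the 2^(j d)
    positions of level j and still leaves 2^(-j) for the summation over j.\<close>
  obtain m :: nat where m: "(real CARD('d) + 1) / \<theta> \<le> real m" using real_arch_simple by blast
  define b where "b j = 2 powr (- (real j * \<theta>))" for j
  have b: "0 < b j" "b j \<le> 1" for j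
    using th powr_mono[of "- (real j * \<theta>)" 0 2] by (auto simp: b_def)
  have bm: "b j ^ m * (2 ^ j) ^ CARD('d) \<le> (1 / 2) ^ j" for j
  proof -
    have "(real CARD('d) + 1) * real j \<le> (real m * \<theta>) * real j"
      using m th by (intro mult_right_mono) (auto simp: field_simps)
    then have "2 powr (- (real j * \<theta>) * real m + real j * real CARD('d)) \<le> (2::real) powr (- real j)"
      by (intro powr_mono) (auto simp: algebra_simps)
    moreover have "b j ^ m = 2 powr (- (real j * \<theta>) * real m)"
      unfolding b_def by (subst powr_power) (auto simp: mult_ac)
    moreover have "((2::real) ^ j) ^ CARD('d) = 2 powr (real j * real CARD('d))"
      by (simp add: powr_realpow[symmetric] powr_powr)
    moreover have "(2::real) powr (- real j) = (1 / 2) ^ j"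
      by (simp add: powr_minus powr_realpow power_one_over inverse_eq_divide)
    ultimately show ?thesis by (simp only: powr_add)
  qed
  \<comment> \<open>The second summand of \<open>exp_scaled_le\<close> for w = \<open>b j\<close>.
    The first is the constant exp c, which joins \<open>Y\<close> in the definition of
    \<open>Z\<close>.\<close>
  let ?g = "\<lambda>j i w. ennreal (fact m * b j ^ m) * ennreal (exp ((c + 1) * \<bar>X i w\<bar>))"
  have Xm: "X i \<in> borel_measurable M" if "i \<in> level j" for i j
    by (rule besov_measurable[OF B]) (use that in \<open>simp add: level_def\<close>)
  have gm: "?g j i \<in> borel_measurable M" if "i \<in> level j" for j i
  proof -
    from Xm[OF that] have [measurable]: "X i \<in> borel_measurable M" .
    show ?thesis by measurable
  qed
  have lvl: "(\<Sum>i\<in>level j. \<integral>\<^sup>+w. ?g j i w \<partial>M) \<le> ennreal ((fact m * 2 ^ CARD('d) * K) * (1 / 2) ^ j)" for j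
  proof -
    have "(\<Sum>i\<in>level j. \<integral>\<^sup>+w. ?g j i w \<partial>M) \<le> (\<Sum>i\<in>(level j :: 'd windex set). ennreal (fact m * b j ^ m * K))"
    proof (rule sum_mono)
      fix i :: "'d windex" assume i: "i \<in> level j"
      from Xm[OF this] have [measurable]: "X i \<in> borel_measurable M" .
      have "(\<integral>\<^sup>+w. ?g j i w \<partial>M) = ennreal (fact m * b j ^ m) * (\<integral>\<^sup>+w. ennreal (exp ((c + 1) * \<bar>X i w\<bar>)) \<partial>M)"
        using i by (subst nn_integral_cmult) (auto simp: level_def)
      also have "\<dots> \<le> ennreal (fact m * b j ^ m) * ennreal K"
        using K(2)[of i] i by (intro mult_left_mono) (auto simp: level_def)
      also have "\<dots> = ennreal (fact m * b j ^ m * K)"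
        using b K(1) by (subst ennreal_mult[symmetric]) (auto simp: less_imp_le)
      finally show "(\<integral>\<^sup>+w. ?g j i w \<partial>M) \<le> ennreal (fact m * b j ^ m * K)" .
    qed
    also have "\<dots> = ennreal (real (card (level j :: 'd windex set)) * (fact m * b j ^ m * K))"
      by (simp add: ennreal_mult'' ennreal_of_nat_eq_real_of_nat[symmetric] ennreal_mult' )
    also have "\<dots> \<le> ennreal ((fact m * 2 ^ CARD('d) * K) * (1 / 2) ^ j)"
    proof (rule ennreal_leI)
      have "real (card (level j :: 'd windex set)) * (fact m * b j ^ m * K) \<le>
          real ((2 ^ j) ^ CARD('d) * 2 ^ CARD('d)) * (fact m * b j ^ m * K)"
        using b[of j] K(1) by (intro mult_right_mono of_nat_mono card_level) auto
      also have "\<dots> = (fact m * 2 ^ CARD('d) * K) * (b j ^ m * (2 ^ j) ^ CARD('d))" by simp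
      also have "\<dots> \<le> (fact m * 2 ^ CARD('d) * K) * (1 / 2) ^ j"
        using K(1) by (intro mult_left_mono bm) auto
      finally show "real (card (level j :: 'd windex set)) * (fact m * b j ^ m * K) \<le>
        (fact m * 2 ^ CARD('d) * K) * (1 / 2) ^ j" .
    qed
    finally show ?thesis .
  qed
  obtain Y where Y: "integrable M Y" "\<And>w. 0 \<le> Y w"
    and Yb: "AE w in M. \<forall>j. \<forall>i\<in>(level j :: 'd windex set). ?g j i w \<le> ennreal (Y w)"
    by (rule summable_family_bound[OF level_finite gm lvl]) (use K(1) in auto)
  have [measurable]: "Y \<in> borel_measurable M" using Y(1) by (rule borel_measurable_integrable)
  have Y1: "1 < exp c + Y w" for w using c Y(2)[of w] one_less_exp_iff[of c] by linarith
  \<comment> \<open>Chosen to solve exp (c Z) = exp c + Y, so that integrability of the exponential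
    is that of \<open>Y\<close>. Since exp c exceeds 1, \<open>Z\<close> is nonnegative.\<close>
  define Z where "Z w = ln (exp c + Y w) / c" for w
  show ?thesis
  proof (rule that)
    show "Z \<in> borel_measurable M" unfolding Z_def by measurable
    show "0 \<le> Z w" for w using Y1[of w] c by (simp add: Z_def)
    have "exp (c * Z w) = exp c + Y w" for w using Y1[of w] c by (simp add: Z_def)
    then show "integrable M (\<lambda>w. exp (c * Z w))" using Y(1) by simp
    show "AE w in M. \<forall>i\<in>I_Psi. \<bar>X i w\<bar> \<le> Z w * 2 powr (real (fst i) * \<theta>)"
    proof (rule eventually_mono[OF Yb], rule ballI)
      fix w and i :: "'d windex"
      assume Yw: "\<forall>j. \<forall>i\<in>(level j :: 'd windex set). ?g j i w \<le> ennreal (Y w)" and i: "i \<in> I_Psi"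
      let ?j = "fst i"
      have "i \<in> level ?j" using i by (simp add: level_def)
      with Yw have "?g ?j i w \<le> ennreal (Y w)" by blast
      then have g: "fact m * b ?j ^ m * exp ((c + 1) * \<bar>X i w\<bar>) \<le> Y w"
        using b[of ?j] Y(2)[of w] by (simp add: ennreal_mult[symmetric] less_imp_le)
      have "exp (c * (b ?j * \<bar>X i w\<bar>)) \<le> exp c + fact m * b ?j ^ m * exp ((c + 1) * \<bar>X i w\<bar>)"
        using b[of ?j] c by (intro exp_scaled_le) auto
      also have "\<dots> \<le> exp c + Y w" using g by simp
      finally have "c * (b ?j * \<bar>X i w\<bar>) \<le> ln (exp c + Y w)"
        using Y1[of w] by (subst ln_ge_iff) auto
      then have "b ?j * \<bar>X i w\<bar> \<le> Z w" using c by (simp add: Z_def pos_le_divide_eq mult.commute)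
      then have "2 powr (real ?j * \<theta>) * (b ?j * \<bar>X i w\<bar>) \<le> 2 powr (real ?j * \<theta>) * Z w"
        by (intro mult_left_mono) auto
      moreover have "2 powr (real ?j * \<theta>) * (b ?j * \<bar>X i w\<bar>) = \<bar>X i w\<bar>"
        by (simp add: b_def powr_minus)
      ultimately show "\<bar>X i w\<bar> \<le> Z w * 2 powr (real ?j * \<theta>)" by (metis mult.commute)
    qed
  qed
qed

text \<open>Replacing x by 1 + x first allows the exponent to be rounded up to a natural
  number.\<close>

lemma powr_le_const_exp:
  fixes r x :: real
  assumes "0 \<le> x" "0 < r"
  shows "x powr r \<le> (fact (nat \<lceil>r\<rceil>) * exp 1) * exp x"
proof -
  have "x powr r \<le> (1 + x) powr r" using assms by (intro powr_mono2) auto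
  also have "\<dots> \<le> (1 + x) powr (real (nat \<lceil>r\<rceil>))" using assms by (intro powr_mono) linarith+
  also have "\<dots> = (1 + x) ^ nat \<lceil>r\<rceil>" using assms by (intro powr_realpow) auto
  also have "\<dots> \<le> fact (nat \<lceil>r\<rceil>) * exp (1 + x)" using assms by (intro power_le_fact_exp) auto
  finally show ?thesis by (simp add: exp_add mult.assoc)
qed

section \<open>Coefficients along the tree\<close>

lemma tree_index_K_set: "tree_index coord n \<in> K_set (length n)"
  by (auto simp: tree_index_def idx2_def K_set_def)

lemma I_tree_subset: "I_tree coord t \<subseteq> I_Psi"
  using tree_index_K_set by (auto simp: I_tree_def I_Psi_def)

text \<open>Independence is a product rule for events. Read as an identity of measures, it says that
  the coefficient, restricted to the event of a node, has its own law scaled by the probability of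
  that event; integrating \<open>g\<close> against both laws covers unbounded \<open>g\<close> at
  once.\<close>

lemma tree_node_independent:
  assumes M: "prob_space M" and B: "besov_tree_data M p \<kappa> \<beta> (X :: 'd::finite windex \<Rightarrow> 'w \<Rightarrow> real) T"
    and i: "i \<in> I_Psi" and g: "g \<in> borel_measurable borel"
  shows "(\<integral>\<^sup>+w. g (X i w) * indicator {w \<in> space M. n \<in> T w} w \<partial>M) =
    ennreal (measure M {w \<in> space M. n \<in> T w}) * (\<integral>\<^sup>+w. g (X i w) \<partial>M)"
proof -
  interpret prob_space M by (rule M)
  define N where "N = {w \<in> space M. n \<in> T w}"
  have T: "T \<in> measurable M tree_sigma" using B by (simp add: besov_tree_data_def GW_tree_def)
  have N[measurable]: "N \<in> sets M" unfolding N_def by (rule tree_node_measurable[OF T])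
  have Xi[measurable]: "X i \<in> borel_measurable M"
    using B i by (intro besov_measurable[of M p \<kappa>]) (auto simp: besov_tree_data_def)
  have ind: "indep_set
      {(\<lambda>w. \<lambda>i\<in>I_Psi. X i w) -` A \<inter> space M | A. A \<in> sets (PiM I_Psi (\<lambda>_. borel))}
      {T -` B \<inter> space M | B. B \<in> sets tree_sigma}"
    using B by (simp add: besov_tree_data_def)
  have prod: "prob (N \<inter> (X i -` A \<inter> space M)) = prob N * prob (X i -` A \<inter> space M)"
    if A: "A \<in> sets borel" for A
  proof -
    let ?E = "{f \<in> space (PiM I_Psi (\<lambda>_. borel :: real measure)). f i \<in> A}"
    have E: "?E \<in> sets (PiM I_Psi (\<lambda>_. borel))"
      using measurable_sets[OF measurable_component_singleton[OF i] A]
      by (simp add: vimage_def Int_def conj_commute)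
    have e1: "X i -` A \<inter> space M = (\<lambda>w. \<lambda>i\<in>I_Psi. X i w) -` ?E \<inter> space M"
      using i by (auto simp: space_PiM)
    have e2: "N = T -` {t \<in> trees. n \<in> t} \<inter> space M"
      using measurable_space[OF T] by (auto simp: N_def)
    have "prob ((X i -` A \<inter> space M) \<inter> N) = prob (X i -` A \<inter> space M) * prob N"
      by (rule indep_setD[OF ind]) (use e1 e2 E tree_sigma_node in blast)+
    then show ?thesis by (simp add: Int_commute mult.commute)
  qed
  have eq: "distr (density M (indicator N)) borel (X i) = scale_measure (ennreal (prob N)) (distr M borel (X i))"
  proof (rule measure_eqI)
    fix A assume "A \<in> sets (distr (density M (indicator N)) borel (X i))"
    then have A: "A \<in> sets borel" by simp
    have m: "X i -` A \<inter> space M \<in> sets M" using measurable_sets[OF Xi A] .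
    have "emeasure (distr (density M (indicator N)) borel (X i)) A = emeasure (density M (indicator N)) (X i -` A \<inter> space M)"
      using A by (subst emeasure_distr) auto
    also have "\<dots> = (\<integral>\<^sup>+w. indicator N w * indicator (X i -` A \<inter> space M) w \<partial>M)"
      using m by (subst emeasure_density) auto
    also have "\<dots> = emeasure M (N \<inter> (X i -` A \<inter> space M))"
      using m by (subst indicator_inter_arith[symmetric]) simp
    also have "\<dots> = ennreal (prob N) * ennreal (prob (X i -` A \<inter> space M))"
      by (simp add: emeasure_eq_measure prod[OF A] ennreal_mult)
    also have "\<dots> = emeasure (scale_measure (ennreal (prob N)) (distr M borel (X i))) A"
      using A by (simp add: emeasure_distr emeasure_eq_measure)
    finally show "emeasure (distr (density M (indicator N)) borel (X i)) A =
      emeasure (scale_measure (ennreal (prob N)) (distr M borel (X i))) A" .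
  qed simp
  have "(\<integral>\<^sup>+w. g (X i w) * indicator N w \<partial>M) = (\<integral>\<^sup>+w. g (X i w) \<partial>density M (indicator N))"
    using g by (subst nn_integral_density) (auto simp: mult.commute)
  also have "\<dots> = (\<integral>\<^sup>+x. g x \<partial>distr (density M (indicator N)) borel (X i))"
    using g by (subst nn_integral_distr) auto
  also have "\<dots> = ennreal (prob N) * (\<integral>\<^sup>+x. g x \<partial>distr M borel (X i))"
    unfolding eq using g by (subst nn_integral_scale_measure) auto
  also have "(\<integral>\<^sup>+x. g x \<partial>distr M borel (X i)) = (\<integral>\<^sup>+w. g (X i w) \<partial>M)"
    using g by (subst nn_integral_distr) auto
  finally show ?thesis unfolding N_def .
qed

text \<open>Along the tree the union runs over \<open>2 powr (j * \<gamma>)\<close> coefficients in expectation only.\<close>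

lemma besov_tree_bound:
  assumes M: "prob_space M" and B: "besov_tree_data M p \<kappa> \<beta> (X :: 'd::finite windex \<Rightarrow> 'w \<Rightarrow> real) T"
    and p: "1 < p" "0 < \<kappa>" and \<beta>: "\<beta> = 2 powr (\<gamma> - real CARD('d))" "\<gamma> \<le> real CARD('d)"
    and r: "0 < r" "r * \<theta> + \<gamma> < 0"
  obtains W where "W \<in> borel_measurable M" "\<And>w. 0 \<le> W w" "integrable M (\<lambda>w. W w powr r)"
    "AE w in M. \<forall>i\<in>I_tree coord (T w). \<bar>X i w\<bar> \<le> W w * 2 powr (- (real (fst i) * \<theta>))"
proof -
  interpret prob_space M by (rule M)
  define b :: nat where "b = 2 ^ CARD('d)"
  have BC: "besov_coefficients M p \<kappa> X" and GW: "GW_tree M (binomial_pmf b \<beta>) T"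
    using B by (auto simp: besov_tree_data_def b_def)
  have \<beta>01: "0 \<le> \<beta>" "\<beta> \<le> 1" using \<beta> powr_mono[of "\<gamma> - real CARD('d)" 0 2] by auto
  have Q: "pmf (binomial_pmf b \<beta>) n = 0" if "b < n" for n using that \<beta>01 by simp
  have T: "T \<in> measurable M tree_sigma" using GW by (simp add: GW_tree_def)
  let ?N = "\<lambda>n. {w \<in> space M. n \<in> T w}"
  have size: "(\<Sum>n\<in>words_upto b j. prob (?N n)) = (2 powr \<gamma>) ^ j" for j
  proof -
    have "real b * \<beta> = 2 powr \<gamma>"
      by (simp add: b_def \<beta> powr_diff powr_realpow)
    then show ?thesis
      using GW_expected_level_size[OF M GW Q, where j = j] binomial_pmf_mean[OF \<beta>01, of b] by simp
  qed
  obtain K0 where K0: "0 \<le> K0" "\<And>i. i \<in> I_Psi \<Longrightarrow> (\<integral>\<^sup>+w. ennreal (exp (1 * \<bar>X i w\<bar>)) \<partial>M) \<le> ennreal K0"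
    using besov_exp_moment[OF BC p, of 1] by auto
  define A where "A = fact (nat \<lceil>r\<rceil>) * exp (1::real)"
  have A: "0 \<le> A" by (simp add: A_def)
  have mom: "(\<integral>\<^sup>+w. ennreal (\<bar>X i w\<bar> powr r) \<partial>M) \<le> ennreal (A * K0)" if i: "i \<in> I_Psi" for i
  proof -
    have [measurable]: "X i \<in> borel_measurable M" by (rule besov_measurable[OF BC i])
    have "(\<integral>\<^sup>+w. ennreal (\<bar>X i w\<bar> powr r) \<partial>M) \<le> (\<integral>\<^sup>+w. ennreal A * ennreal (exp (1 * \<bar>X i w\<bar>)) \<partial>M)"
    proof (rule nn_integral_mono)
      fix w
      have "\<bar>X i w\<bar> powr r \<le> A * exp (1 * \<bar>X i w\<bar>)"
        using powr_le_const_exp[OF abs_ge_zero r(1), of "X i w"] by (simp add: A_def)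
      then show "ennreal (\<bar>X i w\<bar> powr r) \<le> ennreal A * ennreal (exp (1 * \<bar>X i w\<bar>))"
        using A by (simp add: ennreal_mult[symmetric] ennreal_leI)
    qed
    also have "\<dots> = ennreal A * (\<integral>\<^sup>+w. ennreal (exp (1 * \<bar>X i w\<bar>)) \<partial>M)"
      by (rule nn_integral_cmult) measurable
    also have "\<dots> \<le> ennreal A * ennreal K0" by (intro mult_left_mono K0(2) i) simp
    finally show ?thesis using A K0(1) by (simp add: ennreal_mult)
  qed
  let ?i = "\<lambda>n l. (length n, tree_index coord n, l) :: 'd windex"
  \<comment> \<open>Powers of the rescaled coefficients, switched off where the node is absent. The
    scaling contributes 2^(j r \<theta>) and the expected number of nodes 2^(j \<gamma>); their
    product is \<open>q ^ j\<close> with q < 1.\<close>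
  let ?h = "\<lambda>j (n, l) w. ennreal (2 powr (real j * (r * \<theta>)) * \<bar>X (?i n l) w\<bar> powr r) * indicator (?N n) w"
  let ?A = "\<lambda>j. words_upto b j \<times> (L_set j :: (nat^'d) set)"
  have iI: "?i n l \<in> I_Psi" if "(n, l) \<in> ?A j" for n l j
    using that tree_index_K_set[of coord n] by (auto simp: I_Psi_def words_upto_def)
  have hm: "?h j a \<in> borel_measurable M" if a: "a \<in> ?A j" for j a
  proof -
    obtain n l where [simp]: "a = (n, l)" by (cases a)
    have [measurable]: "X (?i n l) \<in> borel_measurable M" using a iI by (intro besov_measurable[OF BC]) auto
    have [measurable]: "?N n \<in> sets M" by (rule tree_node_measurable[OF T])
    show ?thesis by simp
  qed
  define q where "q = 2 powr (r * \<theta> + \<gamma>)"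
  have q: "0 \<le> q" "q < 1"
    using two_powr_neg_less_1[of "- (r * \<theta> + \<gamma>)"] r by (auto simp: q_def add.commute)
  have hint: "(\<integral>\<^sup>+w. ?h j (n, l) w \<partial>M) \<le> ennreal (2 powr (real j * (r * \<theta>)) * (A * K0) * prob (?N n))"
    if nl: "(n, l) \<in> ?A j" for n l j
  proof -
    note i = iI[OF nl]
    have "(\<integral>\<^sup>+w. ?h j (n, l) w \<partial>M) = ennreal (prob (?N n)) *
        (\<integral>\<^sup>+w. ennreal (2 powr (real j * (r * \<theta>)) * \<bar>X (?i n l) w\<bar> powr r) \<partial>M)"
      unfolding prod.case
      by (rule tree_node_independent[OF M B i, where g = "\<lambda>x. ennreal (2 powr (real j * (r * \<theta>)) * \<bar>x\<bar> powr r)"])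
        simp
    also have "(\<integral>\<^sup>+w. ennreal (2 powr (real j * (r * \<theta>)) * \<bar>X (?i n l) w\<bar> powr r) \<partial>M) =
        ennreal (2 powr (real j * (r * \<theta>))) * (\<integral>\<^sup>+w. ennreal (\<bar>X (?i n l) w\<bar> powr r) \<partial>M)"
      using besov_measurable[OF BC i] by (subst nn_integral_cmult[symmetric]) (auto simp: ennreal_mult)
    also have "ennreal (prob (?N n)) * \<dots> \<le> ennreal (prob (?N n)) * (ennreal (2 powr (real j * (r * \<theta>))) * ennreal (A * K0))"
      by (intro mult_left_mono mom i) auto
    also have "\<dots> = ennreal (2 powr (real j * (r * \<theta>)) * (A * K0) * prob (?N n))"
      using A K0(1) by (simp add: ennreal_mult[symmetric] mult_ac)
    finally show ?thesis .
  qed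
  have lvl: "(\<Sum>a\<in>?A j. \<integral>\<^sup>+w. ?h j a w \<partial>M) \<le> ennreal ((2 ^ CARD('d) * (A * K0)) * q ^ j)" for j
  proof -
    let ?c = "2 powr (real j * (r * \<theta>)) * (A * K0)"
    have c: "0 \<le> ?c" using A K0(1) by simp
    have "(\<Sum>a\<in>?A j. \<integral>\<^sup>+w. ?h j a w \<partial>M) \<le> (\<Sum>a\<in>?A j. ennreal (?c * prob (?N (fst a))))"
      using hint by (intro sum_mono) (auto simp: split_beta)
    also have "\<dots> = ennreal (\<Sum>a\<in>?A j. ?c * prob (?N (fst a)))" using c by (intro sum_ennreal) auto
    also have "(\<Sum>a\<in>?A j. ?c * prob (?N (fst a))) = (\<Sum>n\<in>words_upto b j. \<Sum>l\<in>(L_set j :: (nat^'d) set). ?c * prob (?N n))"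
      unfolding sum.cartesian_product split_beta ..
    also have "\<dots> = real (card (L_set j :: (nat^'d) set)) * (?c * (2 powr \<gamma>) ^ j)"
      unfolding size[symmetric] by (simp add: sum_distrib_left)
    also have "ennreal \<dots> \<le> ennreal ((2 ^ CARD('d) * (A * K0)) * q ^ j)"
    proof (rule ennreal_leI)
      have qj: "2 powr (real j * (r * \<theta>)) * (2 powr \<gamma>) ^ j = q ^ j"
        unfolding q_def by (simp add: powr_power powr_add[symmetric] algebra_simps)
      have "real (card (L_set j :: (nat^'d) set)) * (?c * (2 powr \<gamma>) ^ j) \<le> real (2 ^ CARD('d)) * (?c * (2 powr \<gamma>) ^ j)"
        using c by (intro mult_right_mono of_nat_mono L_set_finite) auto
      also have "\<dots> = (2 ^ CARD('d) * (A * K0)) * (2 powr (real j * (r * \<theta>)) * (2 powr \<gamma>) ^ j)" by simp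
      finally show "real (card (L_set j :: (nat^'d) set)) * (?c * (2 powr \<gamma>) ^ j) \<le> (2 ^ CARD('d) * (A * K0)) * q ^ j"
        unfolding qj .
    qed
    finally show ?thesis .
  qed
  obtain Y where Y: "integrable M Y" "\<And>w. 0 \<le> Y w"
    and Yb: "AE w in M. \<forall>j. \<forall>a\<in>?A j. ?h j a w \<le> ennreal (Y w)"
    by (rule summable_family_bound[OF _ hm lvl])
      (use A K0(1) q in \<open>auto intro: words_upto_finite L_set_finite\<close>)
  have [measurable]: "Y \<in> borel_measurable M" using Y(1) by (rule borel_measurable_integrable)
  \<comment> \<open>The root of order r undoes the powers in \<open>?h\<close>, and
    \<open>W powr r\<close> is the integrable \<open>Y\<close>.\<close>
  define W where "W w = Y w powr (1 / r)" for w
  have words: "AE w in M. \<forall>n\<in>T w. n \<in> words_upto b (length n)"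
    by (rule GW_words_upto[OF M GW]) (use Q in simp)
  show ?thesis
  proof (rule that)
    show "W \<in> borel_measurable M" unfolding W_def by measurable
    show "0 \<le> W w" for w by (simp add: W_def)
    have "W w powr r = Y w" for w using r(1) Y(2) by (simp add: W_def powr_powr)
    then show "integrable M (\<lambda>w. W w powr r)" using Y(1) by simp
    have bound: "\<bar>X i w\<bar> \<le> W w * 2 powr (- (real (fst i) * \<theta>))"
      if w: "w \<in> space M" "\<forall>n\<in>T w. n \<in> words_upto b (length n)"
        and Yw: "\<forall>j. \<forall>a\<in>?A j. ?h j a w \<le> ennreal (Y w)" and i: "i \<in> I_tree coord (T w)" for w i
    proof -
      obtain n l where n: "n \<in> T w" and l: "l \<in> L_set (length n)" and ie: "i = ?i n l"
        using i by (auto simp: I_tree_def)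
      let ?j = "length n"
      have "(n, l) \<in> ?A ?j" using w(2) n l by simp
      then have "?h ?j (n, l) w \<le> ennreal (Y w)" using Yw by blast
      then have "2 powr (real ?j * (r * \<theta>)) * \<bar>X i w\<bar> powr r \<le> Y w"
        using n w(1) Y(2)[of w] by (simp add: ie)
      then have "(2 powr (real ?j * (r * \<theta>)) * \<bar>X i w\<bar> powr r) powr (1 / r) \<le> W w"
        unfolding W_def using r(1) by (intro powr_mono2) auto
      also have "(2 powr (real ?j * (r * \<theta>)) * \<bar>X i w\<bar> powr r) powr (1 / r) = 2 powr (real ?j * \<theta>) * \<bar>X i w\<bar>"
        using r(1) by (simp add: powr_mult powr_powr)
      finally show ?thesis by (simp add: ie powr_minus field_simps)
    qed
    show "AE w in M. \<forall>i\<in>I_tree coord (T w). \<bar>X i w\<bar> \<le> W w * 2 powr (- (real (fst i) * \<theta>))"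
      using Yb words AE_space[of M] by eventually_elim (blast intro: bound)
  qed
qed

section \<open>Stability and strong measurability\<close>

lemma L2_has_sum_cong:
  assumes "\<And>i. i \<in> I \<Longrightarrow> e i = e' i"
  shows "L2_has_sum M e I b \<longleftrightarrow> L2_has_sum M e' I b"
proof -
  have "((\<lambda>F. L2_norm M (\<lambda>x. b x - (\<Sum>i\<in>F. e i x))) \<longlongrightarrow> 0) (finite_subsets_at_top I) \<longleftrightarrow>
      ((\<lambda>F. L2_norm M (\<lambda>x. b x - (\<Sum>i\<in>F. e' i x))) \<longlongrightarrow> 0) (finite_subsets_at_top I)"
  proof (rule tendsto_cong, rule eventually_finite_subsets_at_top_weakI)
    fix F assume "F \<subseteq> I"
    then have "(\<Sum>i\<in>F. e i x) = (\<Sum>i\<in>F. e' i x)" for x using assms by (intro sum.cong) auto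
    then show "L2_norm M (\<lambda>x. b x - (\<Sum>i\<in>F. e i x)) = L2_norm M (\<lambda>x. b x - (\<Sum>i\<in>F. e' i x))" by simp
  qed
  then show ?thesis by (simp add: L2_has_sum_def)
qed

lemma exp_diff_le:
  fixes a b R :: real
  assumes "\<bar>a\<bar> \<le> R" "\<bar>b\<bar> \<le> R"
  shows "\<bar>exp a - exp b\<bar> \<le> exp R * \<bar>a - b\<bar>"
proof -
  have *: "exp a - exp b \<le> exp R * \<bar>a - b\<bar>" if "\<bar>a\<bar> \<le> R" "b \<le> a" for a b
  proof -
    have "1 - exp (b - a) \<le> a - b" using exp_ge_add_one_self[of "b - a"] by linarith
    then have "exp a * (1 - exp (b - a)) \<le> exp a * (a - b)" by (intro mult_left_mono) auto
    moreover have "exp a * (1 - exp (b - a)) = exp a - exp b" by (simp add: right_diff_distrib exp_add[symmetric])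
    moreover have "exp a * (a - b) \<le> exp R * (a - b)" using that by (intro mult_right_mono) auto
    ultimately show ?thesis using that by simp
  qed
  show ?thesis
  proof (cases "b \<le> a")
    case True
    then show ?thesis using *[OF assms(1) True] by simp
  next
    case False
    then show ?thesis using *[OF assms(2), of a] by (simp add: abs_minus_commute)
  qed
qed

text \<open>Of the exponent 3 R, one R is the Lipschitz constant of the exponential and two come
  from the squared ellipticity constant exp (- R). The primed functions carry the pointwise bounds,
  because a sum in L2 is known only almost everywhere.\<close>

lemma weak_solution_exp_diff_le:
  fixes D :: "(real^'d) set"
  assumes D: "open D" "bounded D"
    and u: "weak_solution D (\<lambda>x. exp (a x)) f u" and w: "weak_solution D (\<lambda>x. exp (b x)) f w"
    and a: "AE x in lebesgue_on D. a x = a' x" and b: "AE x in lebesgue_on D. b x = b' x"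
    and R: "\<And>x. \<bar>a' x\<bar> \<le> R" "\<And>x. \<bar>b' x\<bar> \<le> R" and e: "\<And>x. \<bar>a' x - b' x\<bar> \<le> \<epsilon>"
    and C: "C \<ge> 0" and f: "\<And>v. v \<in> H10 D \<Longrightarrow> \<bar>f v\<bar> \<le> C * V_norm D v"
  shows "V_norm D (\<lambda>x. u x - w x) \<le> C * exp (3 * R) * \<epsilon>"
proof -
  have "V_norm D (\<lambda>x. u x - w x) \<le> C * (exp R * \<epsilon>) / (exp (- R))\<^sup>2"
  proof (rule weak_solution_diff_le[OF D u w])
    have ge: "exp (- R) \<le> exp y" if "\<bar>y\<bar> \<le> R" for y using that by simp
    show "AE x in lebesgue_on D. exp (- R) \<le> exp (a x)"
      using a by eventually_elim (use ge R(1) in simp)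
    show "AE x in lebesgue_on D. exp (- R) \<le> exp (b x)"
      using b by eventually_elim (use ge R(2) in simp)
    show "AE x in lebesgue_on D. \<bar>exp (a x) - exp (b x)\<bar> \<le> exp R * \<epsilon>"
      using a b
    proof eventually_elim
      case (elim x)
      have "\<bar>exp (a' x) - exp (b' x)\<bar> \<le> exp R * \<bar>a' x - b' x\<bar>" by (rule exp_diff_le[OF R])
      also have "\<dots> \<le> exp R * \<epsilon>" by (intro mult_left_mono e) auto
      finally show ?case using elim by simp
    qed
    have "0 \<le> \<epsilon>" using e[of 0] by linarith
    then show "0 \<le> exp R * \<epsilon>" by simp
  qed (use C f in auto)
  also have "\<dots> = C * exp (3 * R) * \<epsilon>"
  proof -
    have "exp (3 * R) * (exp (- R))\<^sup>2 = exp R"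
      by (simp add: power2_eq_square exp_add[symmetric] mult_ac)
    then show ?thesis by (simp add: field_simps)
  qed
  finally show ?thesis .
qed

section \<open>Simple partitions and strong measurability\<close>

lemma simple_function_clamped_floor:
  fixes g :: "'w \<Rightarrow> real"
  assumes [measurable]: "g \<in> borel_measurable M" and "0 \<le> K" "0 \<le> m"
  shows "simple_function M (\<lambda>w. \<lfloor>m * max (- K) (min K (g w))\<rfloor>)"
  unfolding simple_function_eq_measurable
proof
  have "(\<lambda>w. \<lfloor>m * max (- K) (min K (g w))\<rfloor>) ` space M \<subseteq> {\<lfloor>m * (- K)\<rfloor>..\<lfloor>m * K\<rfloor>}"
    unfolding image_subset_iff atLeastAtMost_iff
    using assms(2,3) by (intro ballI conjI floor_mono mult_left_mono) auto
  then show "finite ((\<lambda>w. \<lfloor>m * max (- K) (min K (g w))\<rfloor>) ` space M)" by (rule finite_subset) simp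
qed measurable

lemma simple_function_finite_family:
  assumes "finite J" "\<And>i. i \<in> J \<Longrightarrow> simple_function M (F i)"
  shows "simple_function M (\<lambda>w i. if i \<in> J then F i w else d)"
  using assms
proof (induction J rule: finite_induct)
  case (insert j J)
  have "(\<lambda>w i. if i \<in> insert j J then F i w else d) = (\<lambda>w. (\<lambda>i. if i \<in> J then F i w else d)(j := F j w))"
    by (auto simp: fun_eq_iff)
  then show ?case
    using simple_function_compose2[of M "\<lambda>w i. if i \<in> J then F i w else d" "F j" "\<lambda>f v. f(j := v)"] insert
    by simp
qed simp

text \<open>Equal integer parts put the clamped values within 1 / m of each other. The margin of 1
  below K then shows that b was not clamped at all.\<close>

lemma clamped_floor_eqD:
  fixes a b :: real
  assumes "\<lfloor>m * max (- K) (min K b)\<rfloor> = \<lfloor>m * max (- K) (min K a)\<rfloor>" and m: "1 \<le> m" and a: "\<bar>a\<bar> + 1 < K"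
  shows "\<bar>a - b\<bar> \<le> 1 / m"
proof -
  define b' where "b' = max (- K) (min K b)"
  have "max (- K) (min K a) = a" using a by (simp add: abs_less_iff max_absorb2 min_absorb2)
  then have "\<lfloor>m * b'\<rfloor> = \<lfloor>m * a\<rfloor>" using assms(1) by (simp add: b'_def)
  then have "\<bar>m * a - m * b'\<bar> \<le> 1" by linarith
  then have "m * \<bar>a - b'\<bar> \<le> 1" using m by (simp add: abs_mult flip: right_diff_distrib)
  then have le: "\<bar>a - b'\<bar> \<le> 1 / m" using m by (simp add: field_simps)
  also have "\<dots> \<le> 1" using m by simp
  finally have "b' = b" using a by (auto simp: b'_def max_def min_def split: if_splits)
  then show ?thesis using le by simp
qed

text \<open>Strong measurability without an existence theorem for the elliptic problem: each cell of a
  simple partition is represented by the solution at one of its own points.\<close>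

lemma strongly_measurable_V_cells:
  fixes h :: "nat \<Rightarrow> 'w \<Rightarrow> 'c"
  assumes \<Omega>: "\<Omega> \<noteq> {}" "AE w in M. w \<in> \<Omega>" and v: "\<And>w. w \<in> \<Omega> \<Longrightarrow> v w \<in> H10 D"
    and h: "\<And>n. simple_function M (h n)"
    and conv: "\<And>w r. w \<in> \<Omega> \<Longrightarrow> (\<And>n. r n \<in> \<Omega>) \<Longrightarrow> (\<And>n. h n (r n) = h n w) \<Longrightarrow>
      (\<lambda>n. V_norm D (\<lambda>x. v w x - v (r n) x)) \<longlonglongrightarrow> 0"
  shows "strongly_measurable_V M D v"
proof -
  \<comment> \<open>A code that occurs on \<Omega> is represented by a point of \<Omega> with that
    code, any other code by an arbitrary point of \<Omega>. Thus every representative lies in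
    \<Omega>, and the simple functions take values in \<open>H10 D\<close> on the whole
    space.\<close>
  define rep where "rep n c = (SOME w. w \<in> \<Omega> \<and> ((\<exists>w'\<in>\<Omega>. h n w' = c) \<longrightarrow> h n w = c))" for n c
  have rep: "rep n c \<in> \<Omega> \<and> ((\<exists>w'\<in>\<Omega>. h n w' = c) \<longrightarrow> h n (rep n c) = c)" for n c
  proof -
    have "\<exists>w. w \<in> \<Omega> \<and> ((\<exists>w'\<in>\<Omega>. h n w' = c) \<longrightarrow> h n w = c)" using \<Omega>(1) by blast
    from someI_ex[OF this] show ?thesis unfolding rep_def .
  qed
  define S where "S n w = v (rep n (h n w))" for n w
  have "simple_function M (S n)" for n
    unfolding S_def by (rule simple_function_compose1[OF h])
  moreover have "S n ` space M \<subseteq> H10 D" for n using rep v by (auto simp: S_def)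
  moreover have "AE w in M. v w \<in> H10 D \<and> (\<lambda>n. V_norm D (\<lambda>x. v w x - S n w x)) \<longlonglongrightarrow> 0"
    using \<Omega>(2)
  proof eventually_elim
    case (elim w)
    show ?case unfolding S_def using v[OF elim]
    proof (intro conjI conv)
      show "h n (rep n (h n w)) = h n w" for n using rep[of n "h n w"] elim by blast
    qed (use elim rep in auto)
  qed
  ultimately show ?thesis unfolding strongly_measurable_V_def by blast
qed

text \<open>The norms of the simple approximants converge to the norm in question, but only almost
  everywhere; completeness of the measure makes up for the null set.\<close>

lemma strongly_measurable_V_norm:
  fixes D :: "(real^'d) set"
  assumes D: "open D" "bounded D" and M: "complete_measure M" and v: "strongly_measurable_V M D v"
  shows "(\<lambda>w. V_norm D (v w)) \<in> borel_measurable M"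
proof -
  interpret complete_measure M by (rule M)
  obtain S where S: "\<And>n::nat. simple_function M (S n)" "\<And>n. S n ` space M \<subseteq> H10 D"
    and lim: "AE w in M. v w \<in> H10 D \<and> (\<lambda>n. V_norm D (\<lambda>x. v w x - S n w x)) \<longlonglongrightarrow> 0"
    using v unfolding strongly_measurable_V_def by blast
  have [measurable]: "(\<lambda>w. V_norm D (S n w)) \<in> borel_measurable M" for n
    by (rule borel_measurable_simple_function, rule simple_function_compose1[OF S(1)])
  define L where "L w = lim (\<lambda>n. V_norm D (S n w))" for w
  have L: "L \<in> borel_measurable M" unfolding L_def by measurable
  have "AE w in M. L w = V_norm D (v w)"
    using lim AE_space
  proof eventually_elim
    case (elim w)
    have "norm (V_norm D (S n w) - V_norm D (v w)) \<le> V_norm D (\<lambda>x. v w x - S n w x)" for n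
    proof -
      have "v w \<in> H1 D" "S n w \<in> H1 D" using elim S(2)[of n] by (auto intro: H10_D)
      from V_norm_abs_diff_le[OF D this] show ?thesis by (simp add: abs_minus_commute)
    qed
    then have "(\<lambda>n. V_norm D (S n w) - V_norm D (v w)) \<longlonglongrightarrow> 0"
      by (intro Lim_null_comparison[OF always_eventually[OF allI] elim(1)[THEN conjunct2]])
    then have "(\<lambda>n. V_norm D (S n w)) \<longlonglongrightarrow> V_norm D (v w)" by (rule LIM_zero_cancel)
    then show ?case unfolding L_def by (rule limI)
  qed
  then have ae: "AE w in M. L w = V_norm D (v w)" .
  show ?thesis
  proof (rule measurableI)
    fix A :: "real set" assume A: "A \<in> sets borel"
    have "AE w in M. w \<in> L -` A \<inter> space M \<longleftrightarrow> w \<in> (\<lambda>w. V_norm D (v w)) -` A \<inter> space M"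
      using ae by eventually_elim auto
    then show "(\<lambda>w. V_norm D (v w)) -` A \<inter> space M \<in> sets M"
      by (rule in_sets_AE) (use measurable_sets[OF L A] in auto)
  qed simp
qed

text \<open>Young's inequality for the conjugate exponents r / (r - q) and r / q, with constants 1.
  Comparing a with b^(r - q) decides which summand alone dominates the product.\<close>

lemma mult_powr_le_sum:
  fixes a b q r :: real
  assumes "0 \<le> a" "0 \<le> b" "1 \<le> q" "q < r"
  shows "a * b powr q \<le> a powr (r / (r - q)) + b powr r"
proof (cases "a \<le> b powr (r - q)")
  case True
  then have "a * b powr q \<le> b powr (r - q) * b powr q" by (intro mult_right_mono) auto
  also have "\<dots> = b powr r" by (simp add: powr_add[symmetric])
  finally show ?thesis using powr_ge_zero[of a "r / (r - q)"] by linarith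
next
  case False
  then have "(b powr (r - q)) powr (q / (r - q)) \<le> a powr (q / (r - q))"
    using assms by (intro powr_mono2) auto
  then have "b powr q \<le> a powr (q / (r - q))" using assms by (simp add: powr_powr)
  then have "a * b powr q \<le> a powr 1 * a powr (q / (r - q))"
    using assms by (intro mult_mono) auto
  also have "\<dots> = a powr (r / (r - q))"
  proof -
    have "1 + q / (r - q) = r / (r - q)" using assms by (simp add: field_simps)
    then show ?thesis by (simp only: powr_add[symmetric])
  qed
  finally show ?thesis using powr_ge_zero[of b r] by linarith
qed

text \<open>If the inequality already holds at q, it persists slightly above q, since it is strict.
  Otherwise \<gamma> \<ge> 0, the hypothesis reduces to t < \<delta>, and a large r lets the
  negative product outweigh \<gamma>.\<close>

lemma higher_exponent_exists:
  fixes q t \<delta> \<gamma> :: real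
  assumes "1 \<le> q" "t < \<delta> - min \<gamma> 0 / q"
  obtains r where "q < r" "r * (t - \<delta>) + \<gamma> < 0"
proof (cases "q * (t - \<delta>) + \<gamma> < 0")
  case True
  define \<eta> where "\<eta> = - (q * (t - \<delta>) + \<gamma>) / (\<bar>t - \<delta>\<bar> + 1)"
  have \<eta>: "0 < \<eta>" unfolding \<eta>_def using True by (intro divide_pos_pos) auto
  have "\<eta> * (t - \<delta>) < \<eta> * (\<bar>t - \<delta>\<bar> + 1)" using \<eta> by (intro mult_strict_left_mono) auto
  also have "\<dots> = - (q * (t - \<delta>) + \<gamma>)" by (simp add: \<eta>_def)
  finally show ?thesis using \<eta> by (intro that[of "q + \<eta>"]) (auto simp: distrib_right)
next
  case False
  have "q * (t - \<delta>) + min \<gamma> 0 < 0" using assms by (simp add: field_simps)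
  then have \<gamma>: "0 \<le> \<gamma>" and "q * (t - \<delta>) < 0" using False by linarith+
  then have t: "t < \<delta>" using assms(1) by (simp add: mult_less_0_iff)
  define \<eta> where "\<eta> = (\<gamma> + 1) / (\<delta> - t)"
  have "0 < \<eta>" "\<eta> * (\<delta> - t) = \<gamma> + 1" using \<gamma> t by (simp_all add: \<eta>_def)
  then show ?thesis using \<open>q * (t - \<delta>) < 0\<close> by (intro that[of "q + \<eta>"]) (auto simp: algebra_simps)
qed

section \<open>Truncation error\<close>

text \<open>The deterministic part of a term; splitting it off makes the series linear in the random
  coefficients.\<close>

definition besov_atom ::
    "(real \<Rightarrow> real) \<Rightarrow> (real \<Rightarrow> real) \<Rightarrow> real \<Rightarrow> real \<Rightarrow> 'd::finite windex \<Rightarrow> real^'d \<Rightarrow> real" where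
  "besov_atom \<phi> \<psi> p s i x =
    2 powr (- (real (fst i) * (s + real CARD('d) / 2 - real CARD('d) / p))) * psi_per \<phi> \<psi> i x"

lemma besov_term_atom: "besov_term \<phi> \<psi> p s X w i x = X i w * besov_atom \<phi> \<psi> p s i x"
  by (simp add: besov_term_def besov_atom_def)

lemma besov_atom_level_bound:
  assumes "wavelet_system \<alpha> \<phi> \<psi>" "1 \<le> \<alpha>"
  obtains C where "0 \<le> C"
    "\<And>j (x :: real^'d). (\<Sum>i\<in>level j. \<bar>besov_atom \<phi> \<psi> p s i x\<bar>) \<le> C * 2 powr (- (real j * (s - real CARD('d) / p)))"
    "\<And>i. besov_atom \<phi> \<psi> p s i \<in> borel_measurable (lebesgue_on (cbox 0 1 :: (real^'d) set))"
proof -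
  have w: "C_alpha \<alpha> \<phi>" "C_alpha \<alpha> \<psi>" "compactly_supported \<phi>" "compactly_supported \<psi>"
    using assms(1) by (auto simp: wavelet_system_def)
  have c: "continuous_on UNIV \<phi>" "continuous_on UNIV \<psi>"
    using C_alpha_continuous[OF _ assms(2)] w by blast+
  obtain R1 :: nat where R1: "\<And>x. \<bar>\<phi> x\<bar> \<le> real R1" "\<And>x. \<phi> x \<noteq> 0 \<Longrightarrow> \<bar>x\<bar> \<le> real R1"
    using compactly_supported_box[OF c(1) w(3)] by blast
  obtain R2 :: nat where R2: "\<And>x. \<bar>\<psi> x\<bar> \<le> real R2" "\<And>x. \<psi> x \<noteq> 0 \<Longrightarrow> \<bar>x\<bar> \<le> real R2"
    using compactly_supported_box[OF c(2) w(4)] by blast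
  define R where "R = max R1 R2"
  have le: "real R1 \<le> real R" "real R2 \<le> real R" by (simp_all add: R_def)
  have b: "\<bar>\<phi> x\<bar> \<le> real R" "\<bar>\<psi> x\<bar> \<le> real R" "0 \<le> real R"
    and r: "\<phi> x \<noteq> 0 \<Longrightarrow> \<bar>x\<bar> \<le> real R" "\<psi> x \<noteq> 0 \<Longrightarrow> \<bar>x\<bar> \<le> real R" for x
    using le R1[of x] R2[of x] by linarith+
  define C where "C = 2 ^ CARD('d) * (2 * real R + 1) ^ CARD('d) * real R ^ CARD('d)"
  have C: "0 \<le> C" by (simp add: C_def)
  show ?thesis
  proof (rule that[OF C])
    fix j and x :: "real^'d"
    let ?w = "2 powr (- (real j * (s + real CARD('d) / 2 - real CARD('d) / p)))"
    have "(\<Sum>i\<in>level j. \<bar>besov_atom \<phi> \<psi> p s i x\<bar>) = (\<Sum>i\<in>level j. ?w * \<bar>psi_per \<phi> \<psi> i x\<bar>)"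
      by (rule sum.cong) (auto simp: besov_atom_def level_def abs_mult)
    also have "\<dots> = ?w * (\<Sum>(k, l)\<in>K_set j \<times> L_set j. \<bar>psi_per \<phi> \<psi> (j, k, l) x\<bar>)"
      by (simp add: sum_level sum_distrib_left split_def)
    also have "\<dots> \<le> ?w * (C * 2 powr (real CARD('d) * real j / 2))"
      unfolding C_def by (intro mult_left_mono psi_per_level_bound[OF c b r]) auto
    also have "\<dots> = C * (?w * 2 powr (real CARD('d) * real j / 2))" by simp
    \<comment> \<open>The L2 normalisation of the wavelets cancels the d / 2 in the Besov weight and
      leaves the decay exponent s - d / p.\<close>
    also have "?w * 2 powr (real CARD('d) * real j / 2) = 2 powr (- (real j * (s - real CARD('d) / p)))"
      by (simp add: powr_add[symmetric] algebra_simps)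
    finally show "(\<Sum>i\<in>level j. \<bar>besov_atom \<phi> \<psi> p s i x\<bar>) \<le> C * 2 powr (- (real j * (s - real CARD('d) / p)))" .
  next
    fix i :: "'d windex"
    obtain j k l where i: "i = (j, k, l)" by (cases i)
    have [measurable]: "psi_per \<phi> \<psi> i \<in> borel_measurable (lebesgue_on (cbox 0 1))"
      unfolding i by (rule psi_per_measurable[OF c b r])
    show "besov_atom \<phi> \<psi> p s i \<in> borel_measurable (lebesgue_on (cbox 0 1))"
      unfolding besov_atom_def by measurable
  qed
qed

context
  fixes e :: "'d::finite windex \<Rightarrow> real^'d \<Rightarrow> real" and C \<delta> :: real
  assumes lev: "\<And>j x. (\<Sum>i\<in>level j. \<bar>e i x\<bar>) \<le> C * 2 powr (- (real j * \<delta>))"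
    and C: "0 \<le> C"
    and meas: "\<And>i. e i \<in> borel_measurable (lebesgue_on (cbox 0 1))"
begin

text \<open>Up to level n closeness of the coefficients is used; above n both families are merely
  bounded and the geometric tail is small. Knowing finitely many coefficients approximately
  therefore determines the field approximately.\<close>

lemma field_diff_close:
  assumes y: "\<And>i. i \<in> I_Psi \<Longrightarrow> \<bar>y i\<bar> \<le> Z * 2 powr (real (fst i) * \<theta>)"
    and z: "\<And>i. i \<in> I_Psi \<Longrightarrow> \<bar>z i\<bar> \<le> Z * 2 powr (real (fst i) * \<theta>)"
    and yz: "\<And>i. i \<in> I_Psi \<Longrightarrow> fst i \<le> n \<Longrightarrow> \<bar>y i - z i\<bar> \<le> m"
    and Z: "0 \<le> Z" and th: "\<theta> < \<delta>" and d: "0 < \<delta>" and m: "0 \<le> m"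
  shows "\<bar>field e y x - field e z x\<bar> \<le> C * m * level_tail \<delta> 0 + C * (2 * Z) * level_tail (\<delta> - \<theta>) (Suc n)"
proof -
  note sm = field_summable[OF lev C meas]
  let ?a = "\<lambda>i. if fst i \<le> n then y i - z i else 0" and ?b = "\<lambda>i. if fst i \<le> n then 0 else y i - z i"
  have Zp: "0 \<le> Z * 2 powr a" for a using Z by simp
  have yz2: "\<bar>y i - z i\<bar> \<le> 2 * Z * 2 powr (real (fst i) * \<theta>)" if "i \<in> I_Psi" for i
    using y[OF that] z[OF that] abs_triangle_ineq4[of "y i" "z i"] by linarith
  have sa: "(\<lambda>i. ?a i * e i x) summable_on I_Psi"
    by (rule sm[where Z = m and \<theta> = 0]) (use yz m d in auto)
  have sb: "(\<lambda>i. ?b i * e i x) summable_on I_Psi"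
    by (rule sm[where Z = "2 * Z" and \<theta> = \<theta>]) (use yz2 Z th Zp in auto)
  have sz: "(\<lambda>i. z i * e i x) summable_on I_Psi"
    by (rule sm[OF z Z th])
  have eq: "(\<lambda>i. ?a i + ?b i) = (\<lambda>i. y i - z i)" by auto
  have "(\<lambda>i. (?a i + ?b i) * e i x) summable_on I_Psi"
    using summable_on_add[OF sa sb] by (simp only: distrib_right)
  then have syz: "(\<lambda>i. (y i - z i) * e i x) summable_on I_Psi" by (simp only: eq fun_cong[OF eq])
  have "field e y x - field e z x = field e (\<lambda>i. ?a i + ?b i) x"
    unfolding eq by (rule field_diff[OF lev C meas syz sz])
  also have "\<dots> = field e ?a x + field e ?b x" by (rule field_add[OF lev C meas sa sb])
  finally have "\<bar>field e y x - field e z x\<bar> \<le> \<bar>field e ?a x\<bar> + \<bar>field e ?b x\<bar>" by simp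
  moreover have "\<bar>field e ?a x\<bar> \<le> C * m * level_tail (\<delta> - 0) 0"
    by (rule field_bound[OF lev C meas _ _ m]) (use yz m d in auto)
  moreover have "\<bar>field e ?b x\<bar> \<le> C * (2 * Z) * level_tail (\<delta> - \<theta>) (Suc n)"
    by (rule field_bound[OF lev C meas _ _ _ th]) (use yz2 Z in auto)
  ultimately show ?thesis by simp
qed

text \<open>The pointwise field shows that a sum exists, so the choice in \<open>L2_infsum\<close>
  is a genuine sum, and uniqueness identifies the two almost everywhere.\<close>

lemma L2_infsum_field:
  assumes y: "\<And>i. i \<in> I_Psi \<Longrightarrow> \<bar>y i\<bar> \<le> Z * 2 powr (real (fst i) * \<theta>)"
    and Z: "0 \<le> Z" and th: "\<theta> < \<delta>" and I: "I \<subseteq> I_Psi"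
  shows "AE x in lebesgue_on (cbox 0 1).
    L2_infsum (lebesgue_on (cbox 0 1)) (\<lambda>i x. y i * e i x) I x = field e (\<lambda>i. if i \<in> I then y i else 0) x"
proof -
  let ?M = "lebesgue_on (cbox 0 1 :: (real^'d) set)"
  let ?y = "\<lambda>i. if i \<in> I then y i else 0"
  interpret finite_measure ?M by (rule finite_measure_lebesgue_on) simp
  have Zp: "0 \<le> Z * 2 powr a" for a using Z by simp
  have s: "L2_has_sum ?M (\<lambda>i x. ?y i * e i x) I (field e ?y)"
    by (rule field_L2_has_sum[OF lev C meas _ Z th I]) (use y Zp in auto)
  then have "L2_has_sum ?M (\<lambda>i x. y i * e i x) I (field e ?y)"
    by (rule L2_has_sum_cong[THEN iffD1, rotated]) simp
  then have "L2_has_sum ?M (\<lambda>i x. y i * e i x) I (L2_infsum ?M (\<lambda>i x. y i * e i x) I)"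
    unfolding L2_infsum_def by (rule someI[where P = "L2_has_sum ?M (\<lambda>i x. y i * e i x) I"])
  then have s': "L2_has_sum ?M (\<lambda>i x. ?y i * e i x) I (L2_infsum ?M (\<lambda>i x. y i * e i x) I)"
    by (rule L2_has_sum_cong[THEN iffD1, rotated]) simp
  have "(\<lambda>x. ?y i * e i x) \<in> L2 ?M" for i
  proof (cases "i \<in> I")
    case True
    have [measurable]: "e i \<in> borel_measurable ?M" by (rule meas)
    let ?b = "\<bar>y i\<bar> * (C * 2 powr (- (real (fst i) * \<delta>)))"
    have bd: "\<bar>y i * e i x\<bar> \<le> ?b" for x
    proof -
      have "i \<in> level (fst i)" using True I by (auto simp: level_def)
      then have "\<bar>e i x\<bar> \<le> (\<Sum>i\<in>level (fst i). \<bar>e i x\<bar>)"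
        by (intro member_le_sum level_finite) auto
      also have "\<dots> \<le> C * 2 powr (- (real (fst i) * \<delta>))" by (rule lev)
      finally show ?thesis unfolding abs_mult by (intro mult_left_mono) auto
    qed
    have "integrable ?M (\<lambda>x. (y i * e i x)\<^sup>2)"
    proof (rule integrable_const_bound[where B = "?b\<^sup>2"])
      show "AE x in ?M. norm ((y i * e i x)\<^sup>2) \<le> ?b\<^sup>2"
        using bd C by (intro AE_I2) (simp add: power2_le_iff_abs_le)
    qed measurable
    then show ?thesis using True by (simp add: L2_def)
  qed (simp add: L2_def)
  from L2_has_sum_unique[OF s' s this] show ?thesis .
qed

end

lemma I_tree_measurable:
  assumes "T \<in> measurable M tree_sigma"
  shows "{w \<in> space M. i \<in> I_tree coord (T w)} \<in> sets M"
proof -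
  obtain j k l where i: "i = (j, k, l)" by (cases i)
  have "{w \<in> space M. i \<in> I_tree coord (T w)} =
      (\<Union>n\<in>{n. j = length n \<and> k = tree_index coord n \<and> l \<in> L_set j}. {w \<in> space M. n \<in> T w})"
    by (auto simp: i I_tree_def)
  also have "\<dots> \<in> sets M"
    by (intro sets.countable_UN'' tree_node_measurable[OF assms]) auto
  finally show ?thesis .
qed

text \<open>A truncation keeps level N, so the tail starts at N + 1; the extra factor 2^(-t) is
  given away.\<close>

lemma level_tail_Suc_le: "0 < t \<Longrightarrow> level_tail t (Suc N) \<le> 2 powr (- (real N * t)) / (1 - 2 powr (- t))"
  unfolding level_tail_def using two_powr_neg_less_1[of t]
  by (intro divide_right_mono powr_mono) (auto simp: algebra_simps)

theorem theorem4p4: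
  fixes coord :: "'d::finite \<Rightarrow> nat"
    and D :: "(real^'d) set"
    and p s \<gamma> \<beta> \<kappa> \<alpha> :: real
    and \<phi> \<psi> :: "real \<Rightarrow> real"
    and M :: "'w measure"
    and X :: "'d windex \<Rightarrow> 'w \<Rightarrow> real"
    and T :: "'w \<Rightarrow> nat list set"
    and f :: "(real^'d \<Rightarrow> real) \<Rightarrow> real"
    and u :: "'w \<Rightarrow> real^'d \<Rightarrow> real"
    and uN :: "nat \<Rightarrow> 'w \<Rightarrow> real^'d \<Rightarrow> real"
  assumes "CARD('d) \<in> {1, 2, 3}"
    and "bij_betw coord UNIV {1..CARD('d)}"
    and "convex_polytopal_domain D" and "D \<subseteq> cbox 0 1"
    and "1 < p" and "0 < s"
    and "\<gamma> \<le> real CARD('d)" and "\<beta> = 2 powr (\<gamma> - real CARD('d))"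
    and "s * p > real CARD('d)" and "real CARD('d) \<ge> real CARD('d) + min \<gamma> 0"
    and "\<alpha> \<ge> 1" and "\<alpha> \<ge> s" and "wavelet_system \<alpha> \<phi> \<psi>"
    and "prob_space M" and "complete_measure M"
    and "\<kappa> > 0" and "besov_tree_data M p \<kappa> \<beta> X T"
    and "f \<in> V_dual D"
    and "AE \<omega> in M. weak_solution D
           (\<lambda>x. exp (besov_tree_rv coord \<phi> \<psi> p s X T \<omega> x)) f (u \<omega>)"
    and "\<And>N. N \<ge> 1 \<Longrightarrow> AE \<omega> in M. weak_solution D
           (\<lambda>x. exp (besov_tree_rv_trunc coord \<phi> \<psi> p s X T N \<omega> x)) f (uN N \<omega>)"
  shows "\<forall>q t. q \<ge> 1 \<and> 0 < t \<and> t < s - real CARD('d) / p - min \<gamma> 0 / q \<longrightarrow>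
           (\<exists>C>0. \<forall>N\<ge>1.
              (\<lambda>\<omega> x. u \<omega> x - uN N \<omega> x) \<in> Lq_V M q D \<and>
              Lq_V_norm M q D (\<lambda>\<omega> x. u \<omega> x - uN N \<omega> x) \<le> C * 2 powr (- (real N * t)))"
proof (intro allI impI)
  fix q t :: real
  assume qt: "q \<ge> 1 \<and> 0 < t \<and> t < s - real CARD('d) / p - min \<gamma> 0 / q"
  interpret prob_space M by fact
  note uw = assms(19) and uNw = assms(20) and data = assms(17)
  let ?b = "\<lambda>w. besov_tree_rv coord \<phi> \<psi> p s X T w"
    and ?bN = "\<lambda>N w. besov_tree_rv_trunc coord \<phi> \<psi> p s X T N w"
  have D: "open D" "bounded D"
    using assms(3,4) bounded_subset[OF bounded_cbox] by (auto simp: convex_polytopal_domain_def)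
  define \<delta> where "\<delta> = s - real CARD('d) / p"
  have \<delta>: "0 < \<delta>" using assms(5,9) by (simp add: \<delta>_def field_simps)
  define e where "e = (besov_atom \<phi> \<psi> p s :: 'd windex \<Rightarrow> real^'d \<Rightarrow> real)"
  obtain C0 where C0: "0 \<le> C0"
    and lev: "\<And>j x. (\<Sum>i\<in>level j. \<bar>e i x\<bar>) \<le> C0 * 2 powr (- (real j * \<delta>))"
    and meas: "\<And>i. e i \<in> borel_measurable (lebesgue_on (cbox 0 1))"
    unfolding e_def \<delta>_def
    by (rule besov_atom_level_bound[OF assms(13,11), where p = p and s = s and 'd='d]) blast
  obtain Cf where Cf: "0 \<le> Cf" "\<And>v. v \<in> H10 D \<Longrightarrow> \<bar>f v\<bar> \<le> Cf * V_norm D v"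
  proof -
    obtain c where c: "\<forall>v\<in>H10 D. \<bar>f v\<bar> \<le> c * V_norm D v" using assms(18) by (auto simp: V_dual_def)
    \<comment> \<open>\<open>V_dual\<close> does not fix the sign of its bound, while the estimates
      ask for a nonnegative one.\<close>
    have "\<bar>f v\<bar> \<le> max c 0 * V_norm D v" if "v \<in> H10 D" for v
      using c that mult_right_mono[of c "max c 0" "V_norm D v"] by fastforce
    then show ?thesis using that[of "max c 0"] by simp
  qed
  obtain r where r: "q < r" "r * (t - \<delta>) + \<gamma> < 0"
    using higher_exponent_exists[of q t \<delta> \<gamma>] qt by (auto simp: \<delta>_def)
  \<comment> \<open>Half of the decay \<delta> pays for the growth that \<open>Z\<close> permits,
    the other half sums the levels: \<open>C1\<close> times \<open>Z\<close> bounds both exponents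
    uniformly in x.\<close>
  define C1 where "C1 = C0 * level_tail (\<delta> - \<delta> / 2) 0"
  have C1: "0 \<le> C1" using C0 \<delta> level_tail_nonneg[of "\<delta> - \<delta> / 2" 0] by (simp add: C1_def)
  \<comment> \<open>The stability factor is exp (3 C1 Z). Its power q, raised to Young's exponent r
    / (r - q), has this coefficient in front of \<open>Z\<close>; the added 1 keeps c positive even
    for C1 = 0.\<close>
  define c where "c = 3 * C1 * q * (r / (r - q)) + 1"
  have c: "0 < c" using C1 qt r by (simp add: c_def add_nonneg_pos)
  have BC: "besov_coefficients M p \<kappa> X" using data by (simp add: besov_tree_data_def)
  have T: "T \<in> measurable M tree_sigma" using data by (simp add: besov_tree_data_def GW_tree_def)
  obtain Z where Zm: "Z \<in> borel_measurable M" and Z0: "\<And>w. 0 \<le> Z w"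
    and Zi: "integrable M (\<lambda>w. exp (c * Z w))"
    and Zb: "AE w in M. \<forall>i\<in>I_Psi. \<bar>X i w\<bar> \<le> Z w * 2 powr (real (fst i) * (\<delta> / 2))"
    using besov_uniform_bound[OF assms(14) BC assms(5,16) c, of "\<delta> / 2"] \<delta> by auto
  \<comment> \<open>Used with \<theta> = t - \<delta>: coefficients of size 2^(j (\<delta> - t)) on
    the tree meet atoms of size 2^(-j \<delta>), so level j contributes 2^(-j t).\<close>
  obtain W where Wm: "W \<in> borel_measurable M" and W0: "\<And>w. 0 \<le> W w"
    and Wi: "integrable M (\<lambda>w. W w powr r)"
    and Wb: "AE w in M. \<forall>i\<in>I_tree coord (T w). \<bar>X i w\<bar> \<le> W w * 2 powr (- (real (fst i) * (t - \<delta>)))"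
    using besov_tree_bound[OF assms(14) data assms(5,16,8,7) _ r(2), of coord] r(1) qt by auto
  define y where "y w i = (if i \<in> I_tree coord (T w) then X i w else 0)" for w and i :: "'d windex"
  define yN where "yN N w i = (if fst i \<le> N then y w i else 0)" for N w and i :: "'d windex"
  define good where "good w \<longleftrightarrow> (\<forall>i\<in>I_Psi. \<bar>X i w\<bar> \<le> Z w * 2 powr (real (fst i) * (\<delta> / 2)))" for w
  have Zp: "0 \<le> Z w * 2 powr a" for w a using Z0 by simp
  have yb: "\<bar>y w i\<bar> \<le> Z w * 2 powr (real (fst i) * (\<delta> / 2))" if "good w" "i \<in> I_Psi" for w i
    using that Zp by (auto simp: y_def good_def)
  have yNb: "\<bar>yN N w i\<bar> \<le> Z w * 2 powr (real (fst i) * (\<delta> / 2))" if "good w" "i \<in> I_Psi" for N w i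
    using yb[OF that] Zp by (auto simp: yN_def)
  have \<delta>2: "\<delta> / 2 < \<delta>" using \<delta> by simp
  \<comment> \<open>The series is summed in L2 of the unit cube. As D lies in the cube, the identity
    almost everywhere restricts to D.\<close>
  have b_eq: "AE x in lebesgue_on D. ?b w x = field e (y w) x" if g: "good w" for w
  proof -
    have "AE x in lebesgue_on (cbox 0 1). ?b w x = field e (y w) x"
      using L2_infsum_field[OF lev C0 meas _ Z0 \<delta>2 I_tree_subset, where y = "\<lambda>i. X i w"] g
      unfolding good_def besov_tree_rv_def y_def e_def besov_term_atom by blast
    then have "AE x in lebesgue. x \<in> cbox 0 1 \<longrightarrow> ?b w x = field e (y w) x"
      by (subst (asm) AE_restrict_space_iff) auto
    then have "AE x in lebesgue. x \<in> D \<longrightarrow> ?b w x = field e (y w) x"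
      by eventually_elim (use assms(4) in auto)
    then show ?thesis using domain_sets[OF D] by (subst AE_restrict_space_iff) auto
  qed
  have bN_eq: "?bN N w x = field e (yN N w) x" for N w x
  proof -
    let ?I = "{i \<in> I_tree coord (T w). fst i \<le> N}"
    have "?I \<subseteq> {i \<in> I_Psi. fst i \<le> N}" using I_tree_subset[of coord "T w"] by auto
    then have "finite ?I" "?I \<subseteq> I_Psi" using finite_subset[OF _ I_Psi_upto_finite] by auto
    then have "field e (yN N w) x = (\<Sum>i\<in>?I. yN N w i * e i x)"
      by (rule field_finite[OF lev C0 meas]) (auto simp: yN_def y_def)
    also have "\<dots> = (\<Sum>i\<in>?I. besov_term \<phi> \<psi> p s X w i x)"
      by (rule sum.cong) (auto simp: yN_def y_def besov_term_atom e_def)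
    finally show ?thesis by (simp add: besov_tree_rv_trunc_def)
  qed
  have fb: "\<bar>field e a x\<bar> \<le> C1 * Z w" if "\<And>i. i \<in> I_Psi \<Longrightarrow> \<bar>a i\<bar> \<le> Z w * 2 powr (real (fst i) * (\<delta> / 2))" for a w x
  proof -
    have "\<bar>field e a x\<bar> \<le> C0 * Z w * level_tail (\<delta> - \<delta> / 2) 0"
      by (rule field_bound[OF lev C0 meas _ _ Z0 \<delta>2]) (use that in auto)
    then show ?thesis by (simp add: C1_def mult_ac)
  qed
  note fy = fb[OF yb] and fyN = fb[OF yNb]
  have ym: "(\<lambda>w. y w i) \<in> borel_measurable M" if "i \<in> I_Psi" for i
    unfolding y_def using besov_measurable[OF BC that] I_tree_measurable[OF T, of i coord]
    by (intro measurable_If) simp_all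
  \<comment> \<open>\<open>None\<close> stands for \<open>Z\<close>: a cell has to fix
    \<open>Z\<close> approximately as well, so that all fields that belong to it obey one common
    bound.\<close>
  define g where "g k w = (case k of None \<Rightarrow> Z w | Some i \<Rightarrow> y w i)" for k w
  define J where "J n = insert None (Some ` {i \<in> I_Psi :: 'd windex set. fst i \<le> n})" for n
  \<comment> \<open>Once Z \<le> n, both \<open>Z\<close> and the coefficients up to level n are at
    most n 2^(n \<delta> / 2). The surplus 2 gives the strict margin that
    \<open>clamped_floor_eqD\<close> asks for.\<close>
  define K where "K n = real n * 2 powr (real n * (\<delta> / 2)) + 2" for n
  define h where "h n w k =
    (if k \<in> J n then \<lfloor>real (Suc n) * max (- K n) (min (K n) (g k w))\<rfloor> else 0)" for n w k
  have h: "simple_function M (h n)" for n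
    unfolding h_def
  proof (intro simple_function_finite_family simple_function_clamped_floor)
    show "finite (J n)" unfolding J_def by (intro finite.insertI finite_imageI I_Psi_upto_finite)
    show "0 \<le> K n" by (simp add: K_def)
    show "g k \<in> borel_measurable M" if "k \<in> J n" for k
    proof (cases k)
      case None
      then show ?thesis using Zm by (simp add: g_def cong: measurable_cong)
    next
      case (Some i)
      then have "i \<in> I_Psi" using that by (auto simp: J_def)
      from ym[OF this] show ?thesis by (simp add: Some g_def cong: measurable_cong)
    qed
  qed simp
  have close: "Z w' \<le> Z w + 1 \<and> (\<forall>i\<in>I_Psi. fst i \<le> n \<longrightarrow> \<bar>y w i - y w' i\<bar> \<le> 1 / real (Suc n))"
    if g1: "good w" and hh: "h n w' = h n w" and n: "Z w \<le> real n" for w w' n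
  proof -
    have gb: "\<bar>g k w\<bar> \<le> real n * 2 powr (real n * (\<delta> / 2))" if "k \<in> J n" for k
    proof (cases k)
      case None
      have "1 \<le> 2 powr (real n * (\<delta> / 2))" using \<delta> by (intro ge_one_powr_ge_zero) auto
      then have "real n * 1 \<le> real n * 2 powr (real n * (\<delta> / 2))" by (intro mult_left_mono) auto
      then show ?thesis using None n Z0[of w] by (simp add: g_def)
    next
      case (Some i)
      then have i: "i \<in> I_Psi" "fst i \<le> n" using that by (auto simp: J_def)
      have "\<bar>y w i\<bar> \<le> Z w * 2 powr (real (fst i) * (\<delta> / 2))" by (rule yb[OF g1 i(1)])
      also have "\<dots> \<le> real n * 2 powr (real n * (\<delta> / 2))"
        using i(2) \<delta> n Z0[of w] by (intro mult_mono powr_mono) auto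
      finally show ?thesis by (simp add: Some g_def)
    qed
    have d: "\<bar>g k w - g k w'\<bar> \<le> 1 / real (Suc n)" if "k \<in> J n" for k
    proof (rule clamped_floor_eqD[where K = "K n"])
      show "\<bar>g k w\<bar> + 1 < K n" using gb[OF that] by (simp add: K_def)
    qed (use fun_cong[OF hh, of k] that in \<open>simp_all add: h_def\<close>)
    have "1 / real (Suc n) \<le> 1" by simp
    moreover have "\<bar>Z w - Z w'\<bar> \<le> 1 / real (Suc n)" using d[of None] by (simp add: J_def g_def)
    ultimately have "Z w' \<le> Z w + 1" by linarith
    moreover have "\<bar>y w i - y w' i\<bar> \<le> 1 / real (Suc n)" if "i \<in> I_Psi" "fst i \<le> n" for i
      using d[of "Some i"] that by (simp add: J_def g_def)
    ultimately show ?thesis by blast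
  qed
  define G where "G = 1 / (1 - 2 powr (- t))"
  have G: "0 \<le> G" using two_powr_neg_less_1[of t] qt by (simp add: G_def)
  \<comment> \<open>N does not occur here: \<open>Z\<close> and \<open>W\<close> serve all
    truncations, and this makes the final constant uniform in N.\<close>
  define E where "E = (\<integral>w. exp (c * Z w) + W w powr r \<partial>M)"
  have Ei: "integrable M (\<lambda>w. exp (c * Z w) + W w powr r)" using Zi Wi by simp
  have E: "0 \<le> E" unfolding E_def by (intro integral_nonneg_AE AE_I2) (simp add: add_nonneg_nonneg)
  define Cq where "Cq = Cf * C0 * G * E powr (1 / q)"
  have Cq: "0 \<le> Cq" using Cf(1) C0 G by (simp add: Cq_def)
  have main: "(\<lambda>w x. u w x - uN N w x) \<in> Lq_V M q D \<and>
      Lq_V_norm M q D (\<lambda>w x. u w x - uN N w x) \<le> Cq * 2 powr (- (real N * t))" if N: "N \<ge> 1" for N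
  proof -
    let ?v = "\<lambda>w x. u w x - uN N w x"
    \<comment> \<open>All almost sure statements for this N at once, so that cell representatives
      taken from \<Omega> satisfy each of them exactly.\<close>
    define \<Omega> where "\<Omega> = {w \<in> space M. good w \<and>
      (\<forall>i\<in>I_tree coord (T w). \<bar>X i w\<bar> \<le> W w * 2 powr (- (real (fst i) * (t - \<delta>)))) \<and>
      weak_solution D (\<lambda>x. exp (?b w x)) f (u w) \<and> weak_solution D (\<lambda>x. exp (?bN N w x)) f (uN N w)}"
    have \<Omega>AE: "AE w in M. w \<in> \<Omega>"
      using AE_space Zb[folded good_def] Wb uw uNw[OF N] by eventually_elim (simp add: \<Omega>_def)
    have \<Omega>ne: "\<Omega> \<noteq> {}"
    proof
      assume "\<Omega> = {}"
      then have "AE w in M. False" using \<Omega>AE by simp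
      then show False by simp
    qed
    have \<Omega>D: "good w" "weak_solution D (\<lambda>x. exp (?b w x)) f (u w)"
      "weak_solution D (\<lambda>x. exp (?bN N w x)) f (uN N w)" "u w \<in> H10 D" "uN N w \<in> H10 D" if "w \<in> \<Omega>" for w
      using that by (auto simp: \<Omega>_def weak_solution_def)
    have bN_AE: "AE x in lebesgue_on D. ?bN N w x = field e (yN N w) x" for w by (simp add: bN_eq)
    have conv: "(\<lambda>n. V_norm D (\<lambda>x. ?v w x - ?v (\<rho> n) x)) \<longlonglongrightarrow> 0"
      if w: "w \<in> \<Omega>" and \<rho>: "\<And>n. \<rho> n \<in> \<Omega>" "\<And>n. h n (\<rho> n) = h n w" for w \<rho>
    proof -
      \<comment> \<open>The first summand is the cell width 1 / (n + 1) propagated through all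
        levels, the second the tail above n. \<open>Z w + 1\<close> bounds \<open>Z\<close> both at
        w and at the representative. The 2 in \<open>B\<close> counts \<open>u\<close> and
        \<open>uN\<close>.\<close>
      define \<epsilon> where "\<epsilon> n = C0 * (1 / real (Suc n)) * level_tail \<delta> 0 +
        C0 * (2 * (Z w + 1)) * level_tail (\<delta> - \<delta> / 2) (Suc n)" for n
      define B where "B = 2 * (Cf * exp (3 * (C1 * (Z w + 1))))"
      have "(\<lambda>n. B * \<epsilon> n) \<longlonglongrightarrow> B * (C0 * 0 * level_tail \<delta> 0 + C0 * (2 * (Z w + 1)) * 0)"
        unfolding \<epsilon>_def using \<delta>
        by (intro tendsto_intros LIMSEQ_Suc[OF lim_1_over_n] LIMSEQ_Suc[OF level_tail_tendsto]) auto
      then have lim: "(\<lambda>n. B * \<epsilon> n) \<longlonglongrightarrow> 0" by simp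
      have bound: "V_norm D (\<lambda>x. ?v w x - ?v (\<rho> n) x) \<le> B * \<epsilon> n" if n: "Z w \<le> real n" for n
      proof -
        note gw = \<Omega>D(1)[OF w] and g\<rho> = \<Omega>D(1)[OF \<rho>(1)]
        note cl = close[OF gw \<rho>(2) n]
        have Z1: "0 \<le> Z w + 1" using Z0[of w] by simp
        have mono: "Z w'' * a \<le> (Z w + 1) * a" if "Z w'' \<le> Z w + 1" "0 \<le> a" for w'' a
          using that by (rule mult_right_mono)
        have y1: "\<bar>y w i\<bar> \<le> (Z w + 1) * 2 powr (real (fst i) * (\<delta> / 2))"
          "\<bar>y (\<rho> n) i\<bar> \<le> (Z w + 1) * 2 powr (real (fst i) * (\<delta> / 2))" if "i \<in> I_Psi" for i
        proof -
          show "\<bar>y w i\<bar> \<le> (Z w + 1) * 2 powr (real (fst i) * (\<delta> / 2))"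
            by (rule order_trans[OF yb[OF gw that] mono]) simp_all
          show "\<bar>y (\<rho> n) i\<bar> \<le> (Z w + 1) * 2 powr (real (fst i) * (\<delta> / 2))"
            by (rule order_trans[OF yb[OF g\<rho> that] mono]) (simp_all add: cl)
        qed
        have dy: "\<bar>field e (y w) x - field e (y (\<rho> n)) x\<bar> \<le> \<epsilon> n" for x
          unfolding \<epsilon>_def
          by (rule field_diff_close[OF lev C0 meas y1 _ Z1 \<delta>2 \<delta>]) (use cl in auto)
        have dyN: "\<bar>field e (yN N w) x - field e (yN N (\<rho> n)) x\<bar> \<le> \<epsilon> n" for x
          unfolding \<epsilon>_def
        proof (rule field_diff_close[OF lev C0 meas _ _ _ Z1 \<delta>2 \<delta>])
          show "\<bar>yN N w i\<bar> \<le> (Z w + 1) * 2 powr (real (fst i) * (\<delta> / 2))"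
            "\<bar>yN N (\<rho> n) i\<bar> \<le> (Z w + 1) * 2 powr (real (fst i) * (\<delta> / 2))" if "i \<in> I_Psi" for i
            using y1[OF that] Z1 by (auto simp: yN_def)
          show "\<bar>yN N w i - yN N (\<rho> n) i\<bar> \<le> 1 / real (Suc n)" if "i \<in> I_Psi" "fst i \<le> n" for i
            using cl that by (auto simp: yN_def)
        qed simp
        have R: "C1 * Z w \<le> C1 * (Z w + 1)" "C1 * Z (\<rho> n) \<le> C1 * (Z w + 1)"
          using C1 cl by (auto intro!: mult_left_mono)
        have 1: "V_norm D (\<lambda>x. u w x - u (\<rho> n) x) \<le> Cf * exp (3 * (C1 * (Z w + 1))) * \<epsilon> n"
          by (rule weak_solution_exp_diff_le[OF D \<Omega>D(2)[OF w] \<Omega>D(2)[OF \<rho>(1)]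
                b_eq[OF gw] b_eq[OF g\<rho>] order_trans[OF fy[OF gw] R(1)]
                order_trans[OF fy[OF g\<rho>] R(2)] dy Cf])
        have 2: "V_norm D (\<lambda>x. uN N w x - uN N (\<rho> n) x) \<le> Cf * exp (3 * (C1 * (Z w + 1))) * \<epsilon> n"
          by (rule weak_solution_exp_diff_le[OF D \<Omega>D(3)[OF w] \<Omega>D(3)[OF \<rho>(1)]
                bN_AE bN_AE order_trans[OF fyN[OF gw] R(1)]
                order_trans[OF fyN[OF g\<rho>] R(2)] dyN Cf])
        have "(\<lambda>x. ?v w x - ?v (\<rho> n) x) = (\<lambda>x. (u w x - u (\<rho> n) x) - (uN N w x - uN N (\<rho> n) x))"
          by auto
        then have "V_norm D (\<lambda>x. ?v w x - ?v (\<rho> n) x) \<le>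
            V_norm D (\<lambda>x. u w x - u (\<rho> n) x) + V_norm D (\<lambda>x. uN N w x - uN N (\<rho> n) x)"
          using V_norm_triangle_diff[OF D H10_D[OF H10_diff[OF D \<Omega>D(4)[OF w] \<Omega>D(4)[OF \<rho>(1)]]]
              H10_D[OF H10_diff[OF D \<Omega>D(5)[OF w] \<Omega>D(5)[OF \<rho>(1)]]], of n n] by simp
        then show ?thesis using 1 2 by (simp add: B_def)
      qed
      \<comment> \<open>While n is below \<open>Z w\<close>, clamping may merge distant values; the
        limit concerns only later n.\<close>
      obtain n0 :: nat where n0: "Z w \<le> real n0" using real_arch_simple by blast
      have "\<forall>\<^sub>F n in sequentially. norm (V_norm D (\<lambda>x. ?v w x - ?v (\<rho> n) x)) \<le> B * \<epsilon> n"
        unfolding eventually_sequentially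
      proof (intro exI[of _ n0] allI impI)
        fix n assume "n0 \<le> n"
        then have "Z w \<le> real n" using n0 by linarith
        from bound[OF this] show "norm (V_norm D (\<lambda>x. ?v w x - ?v (\<rho> n) x)) \<le> B * \<epsilon> n" by simp
      qed
      then show ?thesis by (rule Lim_null_comparison[OF _ lim])
    qed
    have vH: "?v w \<in> H10 D" if "w \<in> \<Omega>" for w
      by (rule H10_diff[OF D \<Omega>D(4,5)[OF that]])
    have sm: "strongly_measurable_V M D ?v"
      by (rule strongly_measurable_V_cells[OF \<Omega>ne \<Omega>AE vH h conv])
    define k where "k = Cf * C0 * G * 2 powr (- (real N * t))"
    have k: "0 \<le> k" using Cf(1) C0 G by (simp add: k_def)
    have est: "V_norm D (?v w) \<le> k * (exp (3 * (C1 * Z w)) * W w)" if w: "w \<in> \<Omega>" for w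
    proof -
      have yy: "\<bar>field e (y w) x - field e (yN N w) x\<bar> \<le> C0 * W w * level_tail t (Suc N)" for x
      proof -
        have s1: "(\<lambda>i. yN N w i * e i x) summable_on I_Psi"
          by (rule field_summable[OF lev C0 meas yNb[OF \<Omega>D(1)[OF w]] Z0 \<delta>2])
        \<comment> \<open>The bound by \<open>W\<close> is known only on the tree; off the tree both
          coefficients are 0.\<close>
        have tail: "\<bar>y w i - yN N w i\<bar> \<le> W w * 2 powr (real (fst i) * (\<delta> - t))" for i
        proof -
          have "- (real (fst i) * (t - \<delta>)) = real (fst i) * (\<delta> - t)" by (simp add: algebra_simps)
          then show ?thesis using w W0[of w] by (auto simp: \<Omega>_def y_def yN_def)
        qed
        have t: "\<delta> - t < \<delta>" using qt by simp
        have s2: "(\<lambda>i. (y w i - yN N w i) * e i x) summable_on I_Psi"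
          by (rule field_summable[OF lev C0 meas tail W0 t])
        have "\<bar>field e (\<lambda>i. y w i - yN N w i) x\<bar> \<le> C0 * W w * level_tail (\<delta> - (\<delta> - t)) (Suc N)"
          by (rule field_bound[OF lev C0 meas _ tail W0 t]) (simp add: yN_def)
        then show ?thesis unfolding field_diff[OF lev C0 meas s2 s1] by simp
      qed
      have "V_norm D (?v w) \<le> Cf * exp (3 * (C1 * Z w)) * (C0 * W w * level_tail t (Suc N))"
        by (rule weak_solution_exp_diff_le[OF D \<Omega>D(2,3)[OF w] b_eq[OF \<Omega>D(1)[OF w]] bN_AE
              fy[OF \<Omega>D(1)[OF w]] fyN[OF \<Omega>D(1)[OF w]] yy Cf])
      also have "\<dots> \<le> Cf * exp (3 * (C1 * Z w)) * (C0 * W w * (2 powr (- (real N * t)) / (1 - 2 powr (- t))))"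
        using Cf(1) C0 W0[of w] qt by (intro mult_left_mono level_tail_Suc_le) auto
      also have "\<dots> = k * (exp (3 * (C1 * Z w)) * W w)" by (simp add: k_def G_def)
      finally show ?thesis .
    qed
    have estq: "V_norm D (?v w) powr q \<le> k powr q * (exp (c * Z w) + W w powr r)" if w: "w \<in> \<Omega>" for w
    proof -
      let ?a = "exp (3 * (C1 * Z w))"
      have "(?a powr q) powr (r / (r - q)) = exp ((3 * C1 * q * (r / (r - q))) * Z w)"
        by (simp add: powr_powr exp_powr_real mult_ac)
      also have "\<dots> \<le> exp (c * Z w)"
        unfolding exp_le_cancel_iff by (rule mult_right_mono) (simp_all add: c_def Z0)
      finally have a: "(?a powr q) powr (r / (r - q)) \<le> exp (c * Z w)" .
      \<comment> \<open>The random factors split here: the exponential goes to \<open>Z\<close> and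
        the power r to \<open>W\<close>, each with its own integrability.\<close>
      have "?a powr q * W w powr q \<le> (?a powr q) powr (r / (r - q)) + W w powr r"
        using qt r(1) W0[of w] by (intro mult_powr_le_sum) auto
      with a have aw: "?a powr q * W w powr q \<le> exp (c * Z w) + W w powr r" by linarith
      have "V_norm D (?v w) powr q \<le> (k * (?a * W w)) powr q"
        using est[OF w] qt by (intro powr_mono2) auto
      also have "\<dots> = k powr q * (?a powr q * W w powr q)"
        using k W0[of w] by (simp add: powr_mult)
      also have "\<dots> \<le> k powr q * (exp (c * Z w) + W w powr r)"
        by (rule mult_left_mono[OF aw]) simp
      finally show ?thesis .
    qed
    have Vm[measurable]: "(\<lambda>w. V_norm D (?v w)) \<in> borel_measurable M"
      by (rule strongly_measurable_V_norm[OF D assms(15) sm])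
    have ae: "AE w in M. V_norm D (?v w) powr q \<le> k powr q * (exp (c * Z w) + W w powr r)"
      using \<Omega>AE by eventually_elim (rule estq)
    have iR: "integrable M (\<lambda>w. k powr q * (exp (c * Z w) + W w powr r))" using Ei by simp
    have iV: "integrable M (\<lambda>w. V_norm D (?v w) powr q)"
    proof (rule Bochner_Integration.integrable_bound[OF iR])
      show "AE w in M. norm (V_norm D (?v w) powr q) \<le> norm (k powr q * (exp (c * Z w) + W w powr r))"
        using ae by eventually_elim simp
    qed measurable
    have "(\<integral>w. V_norm D (?v w) powr q \<partial>M) \<le> (\<integral>w. k powr q * (exp (c * Z w) + W w powr r) \<partial>M)"
      by (rule integral_mono_AE[OF iV iR ae])
    also have "\<dots> = k powr q * E" by (simp add: E_def)
    finally have "(\<integral>w. V_norm D (?v w) powr q \<partial>M) powr (1 / q) \<le> (k powr q * E) powr (1 / q)"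
      using qt by (intro powr_mono2 integral_nonneg_AE AE_I2) auto
    also have "\<dots> = k * E powr (1 / q)" using k E qt by (simp add: powr_mult powr_powr)
    also have "\<dots> = Cq * 2 powr (- (real N * t))" by (simp add: k_def Cq_def)
    finally show ?thesis using sm iV by (simp add: Lq_V_def Lq_V_norm_def)
  qed
  show "\<exists>C>0. \<forall>N\<ge>1. (\<lambda>w x. u w x - uN N w x) \<in> Lq_V M q D \<and>
      Lq_V_norm M q D (\<lambda>w x. u w x - uN N w x) \<le> C * 2 powr (- (real N * t))"
  \<comment> \<open>\<open>Cq\<close> can be 0, for instance when \<open>Cf\<close> is 0, while the
    constant has to be positive.\<close>
  proof (intro exI[of _ "Cq + 1"] conjI allI impI)
    show "0 < Cq + 1" using Cq by simp
    fix N :: nat assume N: "1 \<le> N"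
    show "(\<lambda>w x. u w x - uN N w x) \<in> Lq_V M q D" using main[OF N] by blast
    have "Cq * 2 powr (- (real N * t)) \<le> (Cq + 1) * 2 powr (- (real N * t))"
      by (intro mult_right_mono) auto
    then show "Lq_V_norm M q D (\<lambda>w x. u w x - uN N w x) \<le> (Cq + 1) * 2 powr (- (real N * t))"
      using main[OF N] by linarith
  qed
qed

end
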